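(* Let $X$ be a strongly locally homogeneous completely metrizable space, let $\mathcal K$ be a tame family of compact subsets of $X$, and let $\mathcal A,\mathcal B$ be dense $\mathcal K$-tame decompositions of $X$. Then the set of $(\mathcal A,\mathcal B)$-liftable homeomorphisms is dense in the space $\mathcal H(\mathcal A,\mathcal B)$ of all homeomorphisms $X/\mathcal A\to X/\mathcal B$, endowed with the limitation topology. (That is: for every homeomorphism $f:X/\mathcal A\to X/\mathcal B$ and every open cover $\mathcal U$ of $X/\mathcal B$ there is an $(\mathcal A,\mathcal B)$-liftable homeomorphism $\varphi:X/\mathcal A\to X/\mathcal B$ with $(f,\varphi)\prec\mathcal U$.)
   Context: Notation: for families of sets, $\mathcal F\prec\mathcal G$ means each $F\in\mathcal F$ is contained in some $G\in\mathcal G$. For functions $f,g:Z\to Y$ and a family $\mathcal U$ of subsets of $Y$, $(f,g)\prec\mathcal U$ means that for each $z\in Z$ with $f(z)\ne g(z)$ the set $\{f(z),g(z)\}$ lies in some $U\in\mathcal U$. Decompositions: a decomposition of a space $X$ is a cover $\mathcal D$ of $X$ by pairwise disjoint non-empty compact subsets; $q_{\mathcal D}:X\to X/\mathcal D$ sends a point to the element of $\mathcal D$ containing it, and $X/\mathcal D$ (the set $\mathcal D$) has the quotient topology. $\mathcal D^\circ=\{D\in\mathcal D:|D|>1\}$. $\mathcal D$ is dense if $\mathcal D^\circ$ is dense in $X/\mathcal D$. $\mathcal D$ is vanishing if for each open cover $\mathcal U$ of $X$ the subfamily $\mathcal D'=\{D\in\mathcal D:\forall U\in\mathcal U\ D\not\subset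 U\}$ is discrete in $X$ (each point of $X$ has a neighborhood meeting at most one set of $\mathcal D'$). A set is $\mathcal D$-saturated if it is a union of elements of $\mathcal D$; a family of sets is $\mathcal D$-saturated if all its members are. $\mathcal D$ is shrinkable if for each $\mathcal D$-saturated open cover $\mathcal U$ of $X$ and each open cover $\mathcal V$ of $X$ there is a homeomorphism $h:X\to X$ with $(h,\mathrm{id}_X)\prec\mathcal U$ and $\{h(D):D\in\mathcal D\}\prec\mathcal V$; $\mathcal D$ is strongly shrinkable if for each $\mathcal D$-saturated open set $U\subset X$ the decomposition $\{D\in\mathcal D:D\subset U\}$ of $U$ is shrinkable. Tame families: a compact $K\subset X$ is locally shrinkable if for each neighborhood $O(K)$ of $K$ and any open cover $\mathcal V$ of $O(K)$ there is a homeomorphism $h:X\to X$ with $h|_{X\setminus O(K)}=\mathrm{id}$ and $h(K)\subset V$ for some $V\in\mathcal V$. A family $\mathcal K$ of compact subsets of $X$ is ambiently invariant if $h(K)\in\mathcal K$ for each homeomorphism $h:X\to X$ and $K\in\mathcal K$; it has the local shift property if for any $x\in X$ and neighborhood $O_x$ of $x$ there is a neighborhood $U_x\subset O_x$ of $x$ such that for any $A,B\in\mathcal K$ with $A,B\subset U_x$ there is a homeomorphism $h:X\to X$ with $h(A)=B$ and $h|_{X\setminus O_x}=\mathrm{id}$; it is tame if it is ambiently invariant, consists of locally shrinkable sets, has the local shift property, and each non-empty open subset of $X$ contains a set $K\in\mathcal K$. $X$ is strongly locally homogeneous if the family of all singletons of $X$ is tame (equivalently, has the local shift property). For a tame family $\mathcal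 K$, a decomposition $\mathcal D$ of $X$ is $\mathcal K$-tame if it is vanishing, strongly shrinkable, and $\mathcal D^\circ\subset\mathcal K$. A homeomorphism $\varphi:X/\mathcal A\to X/\mathcal B$ is $(\mathcal A,\mathcal B)$-liftable if there is a homeomorphism $\Phi:X\to X$ with $q_{\mathcal B}\circ\Phi=\varphi\circ q_{\mathcal A}$. The limitation topology on the set $\mathcal H(Y,Z)$ of homeomorphisms $Y\to Z$ has as neighborhood base at $f$ the sets $\{g\in\mathcal H(Y,Z):(f,g)\prec\mathcal U\}$, where $\mathcal U$ runs over all open covers of $Z$. *)

theory Defs
  imports "HOL-Analysis.Analysis"
begin

text \<open>Spaces are abstract topologies; a map between spaces is only relevant on the
  \<^const>\<open>topspace\<close> of its domain.\<close>

definition open_cover :: "'a topology \<Rightarrow> 'a set set \<Rightarrow> bool" where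
  "open_cover X \<U> \<longleftrightarrow> (\<forall>U\<in>\<U>. openin X U) \<and> \<Union>\<U> = topspace X"

definition family_inscribed :: "'a set set \<Rightarrow> 'a set set \<Rightarrow> bool" where
  "family_inscribed \<F> \<G> \<longleftrightarrow> (\<forall>F\<in>\<F>. \<exists>G\<in>\<G>. F \<subseteq> G)"

definition maps_close_on :: "'z set \<Rightarrow> ('z \<Rightarrow> 'y) \<Rightarrow> ('z \<Rightarrow> 'y) \<Rightarrow> 'y set set \<Rightarrow> bool" where
  "maps_close_on Z f g \<U> \<longleftrightarrow> (\<forall>z\<in>Z. f z \<noteq> g z \<longrightarrow> (\<exists>U\<in>\<U>. {f z, g z} \<subseteq> U))"

definition decomposition :: "'a topology \<Rightarrow> 'a set set \<Rightarrow> bool" where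
  "decomposition X \<D> \<longleftrightarrow>
     (\<forall>D\<in>\<D>. D \<noteq> {} \<and> compactin X D) \<and> pairwise disjnt \<D> \<and> \<Union>\<D> = topspace X"

definition decomp_map :: "'a set set \<Rightarrow> 'a \<Rightarrow> 'a set" where
  "decomp_map \<D> x = (THE D. D \<in> \<D> \<and> x \<in> D)"

definition decomp_space :: "'a topology \<Rightarrow> 'a set set \<Rightarrow> 'a set topology" where
  "decomp_space X \<D> =
     topology (\<lambda>\<V>. \<V> \<subseteq> \<D> \<and> openin X {x \<in> topspace X. decomp_map \<D> x \<in> \<V>})"

definition nondegenerate :: "'a set set \<Rightarrow> 'a set set" where
  "nondegenerate \<D> = {D \<in> \<D>. \<exists>x\<in>D. \<exists>y\<in>D. x \<noteq> y}"

definition dense_decomposition :: "'a topology \<Rightarrow> 'a set set \<Rightarrow> bool" where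
  "dense_decomposition X \<D> \<longleftrightarrow>
     decomp_space X \<D> closure_of nondegenerate \<D> = topspace (decomp_space X \<D>)"

definition discrete_family :: "'a topology \<Rightarrow> 'a set set \<Rightarrow> bool" where
  "discrete_family X \<F> \<longleftrightarrow>
     (\<forall>x\<in>topspace X. \<exists>N. openin X N \<and> x \<in> N \<and>
        (\<forall>F\<in>\<F>. \<forall>G\<in>\<F>. F \<inter> N \<noteq> {} \<and> G \<inter> N \<noteq> {} \<longrightarrow> F = G))"

definition vanishing :: "'a topology \<Rightarrow> 'a set set \<Rightarrow> bool" where
  "vanishing X \<D> \<longleftrightarrow>
     (\<forall>\<U>. open_cover X \<U> \<longrightarrow> discrete_family X {D \<in> \<D>. \<forall>U\<in>\<U>. \<not> D \<subseteq> U})"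

definition saturated :: "'a set set \<Rightarrow> 'a set \<Rightarrow> bool" where
  "saturated \<D> S \<longleftrightarrow> (\<exists>\<E>\<subseteq>\<D>. S = \<Union>\<E>)"

definition shrinkable :: "'a topology \<Rightarrow> 'a set set \<Rightarrow> bool" where
  "shrinkable X \<D> \<longleftrightarrow>
     (\<forall>\<U> \<V>. open_cover X \<U> \<and> (\<forall>U\<in>\<U>. saturated \<D> U) \<and> open_cover X \<V> \<longrightarrow>
        (\<exists>h. homeomorphic_map X X h \<and> maps_close_on (topspace X) h id \<U> \<and>
             family_inscribed {h ` D | D. D \<in> \<D>} \<V>))"

definition strongly_shrinkable :: "'a topology \<Rightarrow> 'a set set \<Rightarrow> bool" where
  "strongly_shrinkable X \<D> \<longleftrightarrow>
     (\<forall>U. openin X U \<and> saturated \<D> U \<longrightarrow>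
        shrinkable (subtopology X U) {D \<in> \<D>. D \<subseteq> U})"

text \<open>Neighbourhoods \<open>O\<close> are taken open below. This is no restriction: for an arbitrary
  neighbourhood one passes to its interior and restricts the given cover to it.\<close>

definition locally_shrinkable :: "'a topology \<Rightarrow> 'a set \<Rightarrow> bool" where
  "locally_shrinkable X K \<longleftrightarrow>
     (\<forall>N \<V>. openin X N \<and> K \<subseteq> N \<and> open_cover (subtopology X N) \<V> \<longrightarrow>
        (\<exists>h. homeomorphic_map X X h \<and> (\<forall>x\<in>topspace X - N. h x = x) \<and>
             (\<exists>V\<in>\<V>. h ` K \<subseteq> V)))"

definition ambiently_invariant :: "'a topology \<Rightarrow> 'a set set \<Rightarrow> bool" where
  "ambiently_invariant X \<K> \<longleftrightarrow>
     (\<forall>h K. homeomorphic_map X X h \<and> K \<in> \<K> \<longrightarrow> h ` K \<in> \<K>)"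

definition local_shift_property :: "'a topology \<Rightarrow> 'a set set \<Rightarrow> bool" where
  "local_shift_property X \<K> \<longleftrightarrow>
     (\<forall>x N. x \<in> topspace X \<and> openin X N \<and> x \<in> N \<longrightarrow>
        (\<exists>U. openin X U \<and> x \<in> U \<and> U \<subseteq> N \<and>
           (\<forall>A\<in>\<K>. \<forall>B\<in>\<K>. A \<subseteq> U \<and> B \<subseteq> U \<longrightarrow>
              (\<exists>h. homeomorphic_map X X h \<and> h ` A = B \<and>
                   (\<forall>y\<in>topspace X - N. h y = y)))))"

definition tame_family :: "'a topology \<Rightarrow> 'a set set \<Rightarrow> bool" where
  "tame_family X \<K> \<longleftrightarrow>
     (\<forall>K\<in>\<K>. compactin X K) \<and>
     ambiently_invariant X \<K> \<and>
     (\<forall>K\<in>\<K>. locally_shrinkable X K) \<and>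
     local_shift_property X \<K> \<and>
     (\<forall>U. openin X U \<and> U \<noteq> {} \<longrightarrow> (\<exists>K\<in>\<K>. K \<subseteq> U))"

definition strongly_locally_homogeneous :: "'a topology \<Rightarrow> bool" where
  "strongly_locally_homogeneous X \<longleftrightarrow> tame_family X {{x} | x. x \<in> topspace X}"

definition tame_decomposition :: "'a topology \<Rightarrow> 'a set set \<Rightarrow> 'a set set \<Rightarrow> bool" where
  "tame_decomposition X \<K> \<D> \<longleftrightarrow>
     decomposition X \<D> \<and> vanishing X \<D> \<and> strongly_shrinkable X \<D> \<and> nondegenerate \<D> \<subseteq> \<K>"

text \<open>The maps are normalised outside \<open>topspace Y\<close>, so that distinct elements
  are distinct as maps on \<open>Y\<close>.\<close>

definition homeos :: "'y topology \<Rightarrow> 'z topology \<Rightarrow> ('y \<Rightarrow> 'z) set" where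
  "homeos Y Z = {f \<in> extensional (topspace Y). homeomorphic_map Y Z f}"

definition liftable ::
    "'a topology \<Rightarrow> 'a set set \<Rightarrow> 'a set set \<Rightarrow> ('a set \<Rightarrow> 'a set) \<Rightarrow> bool" where
  "liftable X \<A> \<B> \<phi> \<longleftrightarrow>
     homeomorphic_map (decomp_space X \<A>) (decomp_space X \<B>) \<phi> \<and>
     (\<exists>\<Phi>. homeomorphic_map X X \<Phi> \<and>
        (\<forall>x\<in>topspace X. decomp_map \<B> (\<Phi> x) = \<phi> (decomp_map \<A> x)))"

definition limitation_nbhd ::
    "'y topology \<Rightarrow> 'z topology \<Rightarrow> ('y \<Rightarrow> 'z) \<Rightarrow> 'z set set \<Rightarrow> ('y \<Rightarrow> 'z) set" where
  "limitation_nbhd Y Z f \<U> = {g \<in> homeos Y Z. maps_close_on (topspace Y) f g \<U>}"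

text \<open>The sets \<open>limitation_nbhd Y Z f \<U>\<close> are indeed neighbourhoods of \<open>f\<close> in this topology if
  every open cover of \<open>Z\<close> has an open star refinement, in particular if \<open>Z\<close> is metrizable.\<close>

definition limitation_topology :: "'y topology \<Rightarrow> 'z topology \<Rightarrow> ('y \<Rightarrow> 'z) topology" where
  "limitation_topology Y Z =
     topology (\<lambda>W. W \<subseteq> homeos Y Z \<and>
       (\<forall>f\<in>W. \<exists>\<U>. open_cover Z \<U> \<and> limitation_nbhd Y Z f \<U> \<subseteq> W))"

lemma openin_decomp_space:
  "openin (decomp_space X \<D>) \<V> \<longleftrightarrow>
     \<V> \<subseteq> \<D> \<and> openin X {x \<in> topspace X. decomp_map \<D> x \<in> \<V>}"
proof -
  have int: "{x \<in> topspace X. decomp_map \<D> x \<in> S \<inter> T} =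
      {x \<in> topspace X. decomp_map \<D> x \<in> S} \<inter> {x \<in> topspace X. decomp_map \<D> x \<in> T}" for S T
    by auto
  have un: "{x \<in> topspace X. decomp_map \<D> x \<in> \<Union>\<S>} =
      (\<Union>S\<in>\<S>. {x \<in> topspace X. decomp_map \<D> x \<in> S})" for \<S>
    by auto
  have "istopology (\<lambda>\<V>. \<V> \<subseteq> \<D> \<and> openin X {x \<in> topspace X. decomp_map \<D> x \<in> \<V>})"
    unfolding istopology_def int un by (auto intro!: openin_Int openin_Union)
  then show ?thesis
    unfolding decomp_space_def by (simp add: topology_inverse')
qed

lemma decomp_map_eq:
  assumes "decomposition X \<D>" "D \<in> \<D>" "x \<in> D"
  shows "decomp_map \<D> x = D"
  unfolding decomp_map_def
  using assms by (intro the_equality) (auto simp: decomposition_def pairwise_def disjnt_def)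

lemma decomp_map_in:
  assumes "decomposition X \<D>" "x \<in> topspace X"
  shows "decomp_map \<D> x \<in> \<D>" "x \<in> decomp_map \<D> x"
proof -
  obtain D where "D \<in> \<D>" "x \<in> D"
    using assms by (auto simp: decomposition_def)
  then show "decomp_map \<D> x \<in> \<D>" "x \<in> decomp_map \<D> x"
    using decomp_map_eq[OF assms(1)] by auto
qed

lemma topspace_decomp_space:
  assumes "decomposition X \<D>"
  shows "topspace (decomp_space X \<D>) = \<D>"
proof -
  have "{x \<in> topspace X. decomp_map \<D> x \<in> \<D>} = topspace X"
    using decomp_map_in[OF assms] by auto
  then have "openin (decomp_space X \<D>) \<D>"
    by (simp add: openin_decomp_space)
  then show ?thesis
    by (meson openin_decomp_space openin_subset openin_topspace subset_antisym)
qed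

lemma quotient_map_decomp_map:
  assumes "decomposition X \<D>"
  shows "quotient_map X (decomp_space X \<D>) (decomp_map \<D>)"
proof -
  have "decomp_map \<D> ` topspace X = \<D>"
  proof
    show "decomp_map \<D> ` topspace X \<subseteq> \<D>"
      using decomp_map_in[OF assms] by auto
    show "\<D> \<subseteq> decomp_map \<D> ` topspace X"
    proof
      fix D assume D: "D \<in> \<D>"
      then obtain x where x: "x \<in> D"
        using assms by (auto simp: decomposition_def)
      then have "x \<in> topspace X"
        using assms D by (auto simp: decomposition_def)
      then show "D \<in> decomp_map \<D> ` topspace X"
        using decomp_map_eq[OF assms D x] by (metis imageI)
    qed
  qed
  then show ?thesis
    by (simp add: quotient_map_def topspace_decomp_space[OF assms] openin_decomp_space)
qed

lemma openin_limitation_topology: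
  "openin (limitation_topology Y Z) W \<longleftrightarrow>
     W \<subseteq> homeos Y Z \<and> (\<forall>f\<in>W. \<exists>\<U>. open_cover Z \<U> \<and> limitation_nbhd Y Z f \<U> \<subseteq> W)"
proof -
  let ?P = "\<lambda>W. W \<subseteq> homeos Y Z \<and>
       (\<forall>f\<in>W. \<exists>\<U>. open_cover Z \<U> \<and> limitation_nbhd Y Z f \<U> \<subseteq> W)"
  have "istopology ?P"
    unfolding istopology_def
  proof (intro conjI allI impI)
    fix S T assume S: "?P S" and T: "?P T"
    show "S \<inter> T \<subseteq> homeos Y Z" using S by auto
    show "\<forall>f\<in>S \<inter> T. \<exists>\<U>. open_cover Z \<U> \<and> limitation_nbhd Y Z f \<U> \<subseteq> S \<inter> T"
    proof
      fix f assume "f \<in> S \<inter> T"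
      then have f: "f \<in> S" "f \<in> T" by auto
      obtain \<U> where U: "open_cover Z \<U>" "limitation_nbhd Y Z f \<U> \<subseteq> S"
        using S f(1) by auto
      obtain \<V> where V: "open_cover Z \<V>" "limitation_nbhd Y Z f \<V> \<subseteq> T"
        using T f(2) by auto
      let ?W = "{U \<inter> V | U V. U \<in> \<U> \<and> V \<in> \<V>}"
      have "open_cover Z ?W"
        unfolding open_cover_def
      proof
        show "\<forall>S\<in>?W. openin Z S"
          using U(1) V(1) by (auto simp: open_cover_def)
        have "\<Union>?W = \<Union>\<U> \<inter> \<Union>\<V>" by auto
        then show "\<Union>?W = topspace Z"
          using U(1) V(1) by (simp add: open_cover_def)
      qed
      moreover have "limitation_nbhd Y Z f ?W \<subseteq> limitation_nbhd Y Z f \<U> \<inter> limitation_nbhd Y Z f \<V>"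
        unfolding limitation_nbhd_def
      proof (rule subsetI)
        fix g assume "g \<in> {g \<in> homeos Y Z. maps_close_on (topspace Y) f g ?W}"
        then have g: "g \<in> homeos Y Z"
          and close: "\<And>z. z \<in> topspace Y \<Longrightarrow> f z \<noteq> g z \<Longrightarrow> \<exists>S\<in>?W. {f z, g z} \<subseteq> S"
          by (simp_all add: maps_close_on_def)
        have "maps_close_on (topspace Y) f g \<U>" "maps_close_on (topspace Y) f g \<V>"
          unfolding maps_close_on_def using close by fastforce+
        with g show "g \<in> {g \<in> homeos Y Z. maps_close_on (topspace Y) f g \<U>} \<inter>
            {g \<in> homeos Y Z. maps_close_on (topspace Y) f g \<V>}"
          by simp
      qed
      ultimately show "\<exists>\<U>. open_cover Z \<U> \<and> limitation_nbhd Y Z f \<U> \<subseteq> S \<inter> T"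
        using U(2) V(2) by blast
    qed
  next
    fix \<S> assume S: "\<forall>S\<in>\<S>. ?P S"
    then show "\<Union>\<S> \<subseteq> homeos Y Z" by blast
    show "\<forall>f\<in>\<Union>\<S>. \<exists>\<U>. open_cover Z \<U> \<and> limitation_nbhd Y Z f \<U> \<subseteq> \<Union>\<S>"
      using S by (meson Union_iff Sup_upper order_trans)
  qed
  then show ?thesis
    unfolding limitation_topology_def by (simp add: topology_inverse')
qed

lemma topspace_limitation_topology: "topspace (limitation_topology Y Z) = homeos Y Z"
proof -
  have "open_cover Z {topspace Z}"
    by (simp add: open_cover_def)
  then have "openin (limitation_topology Y Z) (homeos Y Z)"
    unfolding openin_limitation_topology limitation_nbhd_def by (auto intro!: exI[of _ "{topspace Z}"])
  then show ?thesis
    by (meson openin_limitation_topology openin_subset openin_topspace subset_antisym)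
qed

end

theory Submission
  imports Defs
begin

text \<open>Vanishing makes the decompositions upper semicontinuous, and elements accumulating at a
  point become small there. Bing's shrinking argument, carried out with covers of the non-compact
  space \<open>X\<close>, therefore approximates the quotient maps onto \<open>X/\<A>\<close> and \<open>X/\<B>\<close> by homeomorphisms,
  so \<open>f\<close> can be replaced by a homeomorphism \<open>h\<close> of \<open>X\<close> with \<open>q\<^sub>\<B> \<circ> h\<close> close to \<open>f \<circ> q\<^sub>\<A>\<close>.
  A back-and-forth construction then improves \<open>h\<close>. The elements of \<open>\<A>\<close> that are still too large
  form a discrete family; after shrinking the unmatched elements of \<open>\<B>\<close>, local shrinkability and
  the local shift property carry each \<open>h(A)\<close>, inside its own small neighbourhood, onto a shrunken
  element of \<open>\<B>\<close>, and pulling the shrinking back matches \<open>A\<close> with an element of \<open>\<B>\<close>.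
  As only the small elements remain unmatched, the successive homeomorphisms and their inverses
  converge uniformly, and the limit maps \<open>\<A>\<close> onto \<open>\<B>\<close>.\<close>

section \<open>Complete metrics\<close>

text \<open>As \<open>X\<close> is not compact, closeness is measured by open covers, and a limit of
  homeomorphisms need not be a homeomorphism. Both difficulties are met by changing the complete
  metric. Any open cover is refined by a complete metric in which distance below 1 forces two points
  into a common member, so conditions on covers become numerical. Homeomorphisms are tracked in one
  metric and their inverses in another, so that both sequences converge and the limits are mutually
  inverse. In the back-and-forth these metrics contain the pullbacks of a metric of
  \<open>X/\<B>\<close> along \<open>q\<^sub>\<B>\<close> and \<open>f \<circ> q\<^sub>\<A>\<close>,
  so small displacement already means staying close to \<open>f\<close>. A matching step makes the
  unmatched elements of one decomposition small but worsens the bound on their images; the next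
  step, in the opposite direction, resets that bound. Hence four radii are carried along. Matched
  elements must stay fixed while the others are shrunk. This is where strong shrinkability enters:
  it is applied on the complement of the matched elements, whose union is closed.\<close>

definition complete_metric_for :: "'a topology \<Rightarrow> ('a \<Rightarrow> 'a \<Rightarrow> real) \<Rightarrow> bool" where
  "complete_metric_for X d \<longleftrightarrow> Metric_space (topspace X) d \<and>
     Metric_space.mtopology (topspace X) d = X \<and> Metric_space.mcomplete (topspace X) d"

lemma complete_metric_forD:
  assumes "complete_metric_for X d"
  shows "Metric_space (topspace X) d" "Metric_space.mtopology (topspace X) d = X"
    "Metric_space.mcomplete (topspace X) d"
  using assms by (auto simp: complete_metric_for_def)

lemma complete_metric_for_exists:
  assumes "completely_metrizable_space X"
  obtains d where "complete_metric_for X d"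
proof -
  obtain M d where "Metric_space M d" "Metric_space.mcomplete M d" "X = Metric_space.mtopology M d"
    using assms by (auto simp: completely_metrizable_space_def)
  then have "complete_metric_for X d"
    by (simp add: complete_metric_for_def Metric_space.topspace_mtopology)
  then show ?thesis using that by blast
qed

lemma complete_metric_for_capped:
  assumes "complete_metric_for X d" "c > 0"
  shows "complete_metric_for X (\<lambda>x y. min c (d x y))"
proof -
  interpret Metric_space "topspace X" d using complete_metric_forD[OF assms(1)] by simp
  have eq: "capped_dist c = (\<lambda>x y. min c (d x y))" using assms(2) by (auto simp: capped_dist_def)
  show ?thesis
    using capped_dist[of c] mtopology_capped_metric[of c] mcomplete_capped_metric[of c]
      complete_metric_forD[OF assms(1)]
    by (simp add: complete_metric_for_def eq)
qed

text \<open>\<open>g\<close> is a continuous pseudometric. The sum dominates \<open>d\<close>, so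
  its Cauchy sequences are \<open>d\<close>-Cauchy and its balls lie in those of \<open>d\<close>;
  continuity of \<open>g\<close> at the diagonal gives the reverse comparison of topologies. Both
  uses, refining a metric along a cover and pulling back a metric of a quotient, are of this
  form.\<close>

lemma complete_metric_for_add:
  assumes d: "complete_metric_for X d"
    and nonneg: "\<And>x y. 0 \<le> g x y" and comm: "\<And>x y. g x y = g y x"
    and refl: "\<And>x. x \<in> topspace X \<Longrightarrow> g x x = 0"
    and tri: "\<And>x y z. \<lbrakk>x \<in> topspace X; y \<in> topspace X; z \<in> topspace X\<rbrakk> \<Longrightarrow> g x z \<le> g x y + g y z"
    and cont: "\<And>x e. \<lbrakk>x \<in> topspace X; e > 0\<rbrakk> \<Longrightarrow> \<exists>U. openin X U \<and> x \<in> U \<and> (\<forall>y\<in>U. g x y < e)"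
  shows "complete_metric_for X (\<lambda>x y. d x y + g x y)"
proof -
  let ?M = "topspace X"
  let ?d = "\<lambda>x y. d x y + g x y"
  interpret A: Metric_space ?M d using complete_metric_forD[OF d] by simp
  have top: "A.mtopology = X" using complete_metric_forD[OF d] by simp
  interpret B: Metric_space ?M ?d
  proof
    show "0 \<le> ?d x y" for x y by (simp add: nonneg)
    show "?d x y = ?d y x" for x y using comm[of x y] by (simp add: A.commute)
    show "x \<in> ?M \<Longrightarrow> y \<in> ?M \<Longrightarrow> (?d x y = 0) = (x = y)" for x y
      using nonneg[of x y] A.nonneg[of x y] A.zero[of x y] refl[of x] by (smt (verit))
    show "?d x z \<le> ?d x y + ?d y z" if "x \<in> ?M" "y \<in> ?M" "z \<in> ?M" for x y z
      using A.triangle[OF that] tri[OF that] by linarith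
  qed
  have AB: "\<exists>\<delta>>0. A.mball x \<delta> \<subseteq> B.mball x e" if x: "x \<in> ?M" and e: "e > 0" for x e
  proof -
    have "e / 2 > 0" using e by simp
    from cont[OF x this] obtain U where U: "openin X U" "x \<in> U" and g: "\<forall>y\<in>U. g x y < e / 2"
      by blast
    obtain r where r: "r > 0" "A.mball x r \<subseteq> U"
      using U top A.openin_mtopology by metis
    have "A.mball x (min r (e/2)) \<subseteq> B.mball x e"
    proof
      fix y assume "y \<in> A.mball x (min r (e/2))"
      then have y: "y \<in> ?M" "d x y < r" "d x y < e / 2" using x by auto
      then have "y \<in> U" using r x by auto
      then show "y \<in> B.mball x e" using g y x by fastforce
    qed
    then show ?thesis using r e by (intro exI[of _ "min r (e/2)"]) auto
  qed
  have BA: "B.mball x e \<subseteq> A.mball x e" for x e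
  proof
    fix y assume "y \<in> B.mball x e"
    then show "y \<in> A.mball x e" using nonneg[of x y] by auto
  qed
  have topB: "B.mtopology = X"
  proof -
    have "openin B.mtopology U \<longleftrightarrow> openin A.mtopology U" for U
    proof
      assume L: "openin B.mtopology U"
      show "openin A.mtopology U"
        unfolding A.openin_mtopology
      proof (intro conjI allI impI)
        show "U \<subseteq> ?M" using L B.openin_mtopology by blast
        fix x assume "x \<in> U"
        with L obtain r where "r > 0" "B.mball x r \<subseteq> U" using B.openin_mtopology by blast
        with AB[of x r] \<open>x \<in> U\<close> \<open>U \<subseteq> ?M\<close> show "\<exists>r>0. A.mball x r \<subseteq> U"
          by (meson subsetD subset_trans)
      qed
    next
      assume L: "openin A.mtopology U"
      show "openin B.mtopology U"
        unfolding B.openin_mtopology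
        using L BA by (meson A.openin_mtopology subset_trans)
    qed
    then show ?thesis using top by (simp add: topology_eq)
  qed
  have "B.mcomplete"
    unfolding B.mcomplete_def
  proof (intro allI impI)
    fix \<sigma> assume \<sigma>: "B.MCauchy \<sigma>"
    have "A.MCauchy \<sigma>"
      unfolding A.MCauchy_def
    proof (intro conjI allI impI)
      show "range \<sigma> \<subseteq> ?M" using \<sigma> B.MCauchy_def by blast
      fix e :: real assume "e > 0"
      then obtain N where N: "\<forall>n n'. N \<le> n \<longrightarrow> N \<le> n' \<longrightarrow> ?d (\<sigma> n) (\<sigma> n') < e"
        using \<sigma> unfolding B.MCauchy_def by blast
      have "d (\<sigma> n) (\<sigma> n') < e" if "N \<le> n" "N \<le> n'" for n n'
        using N[rule_format, OF that] nonneg[of "\<sigma> n" "\<sigma> n'"] by linarith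
      then show "\<exists>N. \<forall>n n'. N \<le> n \<longrightarrow> N \<le> n' \<longrightarrow> d (\<sigma> n) (\<sigma> n') < e" by blast
    qed
    then obtain x where "limitin A.mtopology \<sigma> x sequentially"
      using complete_metric_forD(3)[OF d] unfolding A.mcomplete_def by blast
    then show "\<exists>x. limitin B.mtopology \<sigma> x sequentially" using top topB by auto
  qed
  then show ?thesis
    unfolding complete_metric_for_def using B.Metric_space_axioms topB by simp
qed

text \<open>The metric \<open>ln (1 + d x y / min (l x) (l y))\<close>, for a Lebesgue function \<open>l\<close> of the cover,
  is the \<open>j\<close>-metric of quasiconformal analysis; its triangle inequality only needs that \<open>l\<close>
  is positive and 1-Lipschitz.\<close>

lemma complete_metric_for_refine:
  assumes d: "complete_metric_for X d" and O: "open_cover X \<O>"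
  obtains d' where "complete_metric_for X d'" "\<And>x y. d x y \<le> d' x y"
    "\<And>x y. \<lbrakk>x \<in> topspace X; y \<in> topspace X; d' x y < 1\<rbrakk> \<Longrightarrow> \<exists>U\<in>\<O>. x \<in> U \<and> y \<in> U"
proof -
  let ?M = "topspace X"
  interpret A: Metric_space ?M d using complete_metric_forD[OF d] by simp
  have top: "A.mtopology = X" using complete_metric_forD[OF d] by simp
  define S where "S x = {r. 0 < r \<and> r \<le> 1 \<and> (\<exists>U\<in>\<O>. A.mball x r \<subseteq> U)}" for x
  \<comment> \<open>The cap at 1 in \<open>S\<close> makes the supremum exist even where balls of
    every radius fit into a member of the cover. The value 1 off the space keeps \<open>l\<close>
    positive everywhere, so that \<open>t\<close> and \<open>g\<close> are non-negative for all
    arguments, as \<open>complete_metric_for_add\<close> demands.\<close>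
  define l where "l x = (if x \<in> ?M then Sup (S x) / 2 else 1)" for x
  have bdd: "bdd_above (S x)" for x by (rule bdd_aboveI[of _ 1]) (auto simp: S_def)
  have ne: "S x \<noteq> {}" if x: "x \<in> ?M" for x
  proof -
    obtain U where U: "U \<in> \<O>" "x \<in> U" using O x unfolding open_cover_def by blast
    then have "openin A.mtopology U" using O top by (simp add: open_cover_def)
    then obtain r where r: "r > 0" "A.mball x r \<subseteq> U" using U A.openin_mtopology by blast
    have "A.mball x (min r 1) \<subseteq> U" using r A.mball_subset_concentric[of "min r 1" r x] by simp
    then have "min r 1 \<in> S x" using U r unfolding S_def by auto
    then show ?thesis by blast
  qed
  have lpos: "l x > 0" for x
  proof (cases "x \<in> ?M")
    case True
    then obtain r where r: "r \<in> S x" using ne by blast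
    then have "r \<le> Sup (S x)" using bdd by (simp add: cSup_upper)
    moreover have "r > 0" using r by (simp add: S_def)
    ultimately show ?thesis using True by (simp add: l_def)
  qed (simp add: l_def)
  have lip: "l x \<le> l y + d x y" if x: "x \<in> ?M" and y: "y \<in> ?M" for x y
  proof -
    have "r \<le> Sup (S y) + d x y" if r: "r \<in> S x" for r
    proof (cases "r - d x y > 0")
      case True
      have "A.mball y (r - d x y) \<subseteq> A.mball x r"
        using A.mball_subset[of y x "r - d x y" r] x A.commute[of x y] by simp
      moreover obtain U where "U \<in> \<O>" "A.mball x r \<subseteq> U" using r by (auto simp: S_def)
      moreover have "r - d x y \<le> 1" using r A.nonneg[of x y] unfolding S_def mem_Collect_eq by linarith
      ultimately have "r - d x y \<in> S y" using True unfolding S_def by blast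
      then have "r - d x y \<le> Sup (S y)" using bdd by (simp add: cSup_upper)
      then show ?thesis by linarith
    next
      case False
      then show ?thesis using lpos[of y] y by (simp add: l_def)
    qed
    then have "Sup (S x) \<le> Sup (S y) + d x y" using ne[OF x] by (intro cSup_least) auto
    moreover have "l x = Sup (S x) / 2" "l y = Sup (S y) / 2" using x y by (simp_all add: l_def)
    ultimately show ?thesis using A.nonneg[of x y] by linarith
  qed
  have leb: "\<exists>U\<in>\<O>. x \<in> U \<and> y \<in> U" if x: "x \<in> ?M" and y: "y \<in> ?M" and "d x y < l x" for x y
  proof -
    have "l x = Sup (S x) / 2" using x by (simp add: l_def)
    then have "d x y < Sup (S x)" using that lpos[of x] by linarith
    then obtain r where r: "r \<in> S x" "d x y < r" 
      using less_cSup_iff[OF ne[OF x] bdd] by blast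
    then obtain U where U: "U \<in> \<O>" "A.mball x r \<subseteq> U" by (auto simp: S_def)
    have "r > 0" using r by (simp add: S_def)
    then have "x \<in> A.mball x r" "y \<in> A.mball x r" using x y r by simp_all
    then have "x \<in> U" "y \<in> U" using U by blast+
    then show ?thesis using U by blast
  qed
  define t where "t x y = d x y / min (l x) (l y)" for x y
  \<comment> \<open>The factor 2 sets the threshold: \<open>t \<ge> 1\<close> gives
    \<open>g \<ge> 2 * ln 2 \<ge> 4/3\<close>, so a new distance below 1 forces
    \<open>d x y < l x\<close>, which puts both points into one member.\<close>
  define g where "g x y = 2 * ln (1 + t x y)" for x y
  have tpos: "t x y \<ge> 0" for x y using lpos[of x] lpos[of y] by (simp add: t_def)
  have tcomm: "t x y = t y x" for x y by (simp add: t_def A.commute min.commute)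
  have tri_t: "1 + t x z \<le> (1 + t x y) * (1 + t y z)"
    if M: "x \<in> ?M" "y \<in> ?M" "z \<in> ?M" and le: "l x \<le> l z" for x y z
  proof -
    have lx: "l x > 0" and ly: "l y > 0" and lz: "l z > 0" by (simp_all add: lpos)
    have txz: "t x z = d x z / l x" using le by (simp add: t_def)
    have tr: "d x z \<le> d x y + d y z" using A.triangle M by blast
    show ?thesis
    proof (cases "l y \<le> l x")
      case True
      have 1: "t x y = d x y / l y" "t y z = d y z / l y" using True le by (simp_all add: t_def)
      have "t x z \<le> (d x y + d y z) / l x" unfolding txz using tr lx by (simp add: divide_right_mono)
      also have "\<dots> \<le> (d x y + d y z) / l y" using True ly by (intro divide_left_mono) auto
      also have "\<dots> = t x y + t y z" by (simp add: 1 add_divide_distrib)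
      finally have "t x z \<le> t x y + t y z" .
      moreover have "0 \<le> t x y * t y z" using tpos by simp
      ultimately show ?thesis by (simp add: algebra_simps)
    next
      case False
      have 1: "t x y = d x y / l x" using False by (simp add: t_def)
      \<comment> \<open>Here \<open>l x\<close> is the smallest of the three values. Since
        \<open>1 + t x y = (l x + d x y) / l x\<close>, and the Lipschitz bound makes
        \<open>t y z\<close> at least \<open>d y z / (l x + d x y)\<close>, the factor
        \<open>l x + d x y\<close> cancels in the product.\<close>
      have ly': "l y \<le> l x + d x y" using lip[of y x] M A.commute[of x y] by simp
      have "d y z / (l x + d x y) \<le> t y z"
        unfolding t_def using ly' ly lz lx by (intro divide_left_mono) (auto intro!: mult_pos_pos add_pos_nonneg)
      then have "(1 + t x y) * (d y z / (l x + d x y)) \<le> (1 + t x y) * t y z"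
        using tpos by (intro mult_left_mono) auto
      moreover have "(1 + t x y) * (d y z / (l x + d x y)) = d y z / l x"
      proof -
        have "l x + d x y \<noteq> 0" using lx A.nonneg[of x y] by linarith
        moreover have "1 + t x y = (l x + d x y) / l x" unfolding 1 using lx by (simp add: add_divide_distrib)
        ultimately show ?thesis by simp
      qed
      moreover have "t x z \<le> d x y / l x + d y z / l x" unfolding txz using tr lx
        by (simp add: divide_right_mono flip: add_divide_distrib)
      ultimately have "t x z \<le> t x y + (1 + t x y) * t y z" unfolding 1 by linarith
      then show ?thesis by (simp add: algebra_simps)
    qed
  qed
  have tri_t': "1 + t x z \<le> (1 + t x y) * (1 + t y z)"
    if M: "x \<in> ?M" "y \<in> ?M" "z \<in> ?M" for x y z
  proof (cases "l x \<le> l z")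
    case True then show ?thesis using tri_t M by blast
  next
    case False
    then have "1 + t z x \<le> (1 + t z y) * (1 + t y x)" using tri_t[of z y x] M by simp
    then show ?thesis by (simp add: tcomm mult.commute)
  qed
  have "complete_metric_for X (\<lambda>x y. d x y + g x y)"
  proof (rule complete_metric_for_add[OF d])
    show "0 \<le> g x y" for x y using tpos[of x y] by (simp add: g_def)
    show "g x y = g y x" for x y by (simp add: g_def tcomm)
    show "x \<in> ?M \<Longrightarrow> g x x = 0" for x by (simp add: g_def t_def)
    show "g x z \<le> g x y + g y z" if M: "x \<in> ?M" "y \<in> ?M" "z \<in> ?M" for x y z
    proof -
      have p: "1 + t u v > 0" for u v using tpos[of u v] by linarith
      have "g x z \<le> 2 * ln ((1 + t x y) * (1 + t y z))" unfolding g_def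
        using tri_t'[OF M] p by (simp add: ln_le_cancel_iff)
      also have "ln ((1 + t x y) * (1 + t y z)) = ln (1 + t x y) + ln (1 + t y z)"
        using p by (intro ln_mult_pos) auto
      finally show ?thesis unfolding g_def by simp
    qed
    show "\<exists>U. openin X U \<and> x \<in> U \<and> (\<forall>y\<in>U. g x y < e)" if x: "x \<in> ?M" and e: "e > 0" for x e
    proof -
      \<comment> \<open>The bound \<open>l x / 2\<close> keeps \<open>l\<close> above half its value
        on the ball, so \<open>t x y\<close> is at most \<open>d x y / (l x / 2)\<close>; the second
        bound makes this less than \<open>e / 2\<close>, and \<open>g \<le> 2 * t\<close>.\<close>
      define r where "r = min (l x / 2) (e * l x / 4)"
      have r: "r > 0" using lpos[of x] e by (simp add: r_def)
      have "g x y < e" if y: "y \<in> A.mball x r" for y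
      proof -
        have dy: "d x y < r" "y \<in> ?M" using y by auto
        have "l x \<le> l y + d x y" using lip x dy by blast
        then have "l x / 2 < l y" using dy by (simp add: r_def)
        then have m: "l x / 2 \<le> min (l x) (l y)" using lpos[of x] by simp
        have "t x y \<le> d x y / (l x / 2)" unfolding t_def using m lpos[of x] lpos[of y]
          by (intro divide_left_mono) auto
        also have "\<dots> < e / 2" using dy lpos[of x] by (simp add: r_def field_simps)
        finally have "t x y < e / 2" .
        moreover have "g x y \<le> 2 * t x y" unfolding g_def
          using tpos[of x y] ln_add_one_self_le_self by simp
        ultimately show ?thesis by simp
      qed
      then show ?thesis using r x A.openin_mball[of x r] top by (intro exI[of _ "A.mball x r"]) auto
    qed
  qed
  moreover have "d x y \<le> d x y + g x y" for x y using tpos[of x y] by (simp add: g_def)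
  moreover have "\<exists>U\<in>\<O>. x \<in> U \<and> y \<in> U" if x: "x \<in> ?M" and y: "y \<in> ?M" and 1: "d x y + g x y < 1" for x y
  proof (cases "d x y < l x")
    case True then show ?thesis using leb x y by blast
  next
    case False
    have "d x y / l x \<le> t x y" unfolding t_def using lpos by (intro divide_left_mono) auto
    then have t1: "t x y \<ge> 1" using False lpos[of x] by (smt (verit) le_divide_eq_1_pos)
    have "ln (1 + t x y) \<ge> ln 2" using t1 by simp
    then have "g x y \<ge> 1" using ln2_ge_two_thirds by (simp add: g_def)
    then show ?thesis using 1 A.nonneg[of x y] by linarith
  qed
  ultimately show ?thesis using that by blast
qed

section \<open>Homeomorphisms and discrete families\<close>

lemma homeomorphic_mapsD:
  assumes "homeomorphic_maps X Y h k"
  shows "x \<in> topspace X \<Longrightarrow> h x \<in> topspace Y" "y \<in> topspace Y \<Longrightarrow> k y \<in> topspace X"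
    "x \<in> topspace X \<Longrightarrow> k (h x) = x" "y \<in> topspace Y \<Longrightarrow> h (k y) = y"
  using assms by (auto simp: homeomorphic_maps_def continuous_map_def)

lemma homeomorphic_maps_openin_image:
  assumes "homeomorphic_maps X Y h k" "openin X U"
  shows "openin Y (h ` U)"
  using homeomorphic_map_openness_eq[OF homeomorphic_maps_imp_map[OF assms(1)]] assms(2) by simp

lemma homeomorphic_maps_closedin_image:
  assumes "homeomorphic_maps X Y h k" "closedin X U"
  shows "closedin Y (h ` U)"
  using homeomorphic_map_closedness_eq[OF homeomorphic_maps_imp_map[OF assms(1)]] assms(2) by simp

lemma homeomorphic_maps_image_image:
  assumes "homeomorphic_maps X Y h k" "S \<subseteq> topspace X"
  shows "k ` h ` S = S"
proof -
  have "k (h x) = x" if "x \<in> S" for x using homeomorphic_mapsD(3)[OF assms(1)] that assms(2) by blast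
  then show ?thesis by (force simp: image_iff)
qed

lemma homeomorphic_maps_sym': "homeomorphic_maps X Y h k \<Longrightarrow> homeomorphic_maps Y X k h"
  using homeomorphic_maps_sym[of X Y h k] by (rule iffD1)

lemma homeomorphic_maps_compose':
  assumes "homeomorphic_maps X Y h k" "homeomorphic_maps Y Z h' k'"
  shows "homeomorphic_maps X Z (\<lambda>x. h' (h x)) (\<lambda>z. k (k' z))"
  using homeomorphic_maps_compose[of X Y h k Z h' k'] assms by (simp add: o_def)

lemma continuous_map_locally_eq:
  assumes "\<And>x. x \<in> topspace X \<Longrightarrow>
    \<exists>N g. openin X N \<and> x \<in> N \<and> continuous_map X Y g \<and> (\<forall>y\<in>N. f y = g y)"
  shows "continuous_map X Y f"
  unfolding continuous_map_eq_topcontinuous_at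
proof
  have allX: "f x \<in> topspace Y" if x: "x \<in> topspace X" for x
    using assms[OF x] x by (auto simp: continuous_map_def)
  fix x assume x: "x \<in> topspace X"
  obtain N g where N: "openin X N" "x \<in> N" and g: "continuous_map X Y g" and eq: "\<forall>y\<in>N. f y = g y"
    using assms[OF x] by blast
  have fx: "f x \<in> topspace Y" using allX x by blast
  have *: "\<exists>U. openin X U \<and> x \<in> U \<and> (\<forall>y\<in>U. f y \<in> V)" if V: "openin Y V \<and> f x \<in> V" for V
  proof -
  let ?U = "N \<inter> {y \<in> topspace X. g y \<in> V}"
  have "openin X ?U" using N g V openin_continuous_map_preimage by blast
  moreover have "x \<in> ?U" using N x V eq by auto
  moreover have "\<forall>y\<in>?U. f y \<in> V" using eq by auto
  ultimately show ?thesis by blast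
  qed
  show "topcontinuous_at X Y f x" unfolding topcontinuous_at_def using x fx * allX by (intro conjI allI impI Pi_I) simp_all
qed

lemma homeomorphic_maps_supported:
  assumes h: "homeomorphic_maps X X h k" and S: "S \<subseteq> topspace X"
    and id: "\<And>x. x \<in> topspace X - S \<Longrightarrow> h x = x"
  shows "\<And>x. x \<in> topspace X - S \<Longrightarrow> k x = x" "\<And>x. x \<in> S \<Longrightarrow> h x \<in> S" "\<And>x. x \<in> S \<Longrightarrow> k x \<in> S"
proof -
  show kid: "k x = x" if "x \<in> topspace X - S" for x
    using id[OF that] homeomorphic_mapsD(3)[OF h, of x] that by auto
  show "h x \<in> S" if x: "x \<in> S" for x
  proof (rule ccontr)
    assume n: "h x \<notin> S"
    have "h x \<in> topspace X" using homeomorphic_mapsD(1)[OF h] x S by blast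
    with n have "k (h x) = h x" using kid by blast
    then show False using homeomorphic_mapsD(3)[OF h, of x] x S n by auto
  qed
  show "k x \<in> S" if x: "x \<in> S" for x
  proof (rule ccontr)
    assume n: "k x \<notin> S"
    have "k x \<in> topspace X" using homeomorphic_mapsD(2)[OF h] x S by blast
    with n have "h (k x) = k x" using id by blast
    then show False using homeomorphic_mapsD(4)[OF h, of x] x S n by auto
  qed
qed

text \<open>Near any point at most one support is met, so the glued map agrees there with a single
  \<open>l i\<close> or with the identity, and continuity is local. The inverse is glued by the same
  recipe \<open>G\<close> from the \<open>l' i\<close>, which have the same supports. Discreteness
  is stated for indices rather than sets, which makes the index belonging to a point unique.\<close>

lemma homeomorphic_maps_glue:
  fixes X :: "'a topology" and I :: "'i set"
  assumes hom: "\<And>i. i \<in> I \<Longrightarrow> homeomorphic_maps X X (l i) (l' i)"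
    and S: "\<And>i. i \<in> I \<Longrightarrow> S i \<subseteq> topspace X"
    and id: "\<And>i x. i \<in> I \<Longrightarrow> x \<in> topspace X - S i \<Longrightarrow> l i x = x"
    and disc: "\<And>x. x \<in> topspace X \<Longrightarrow> \<exists>N. openin X N \<and> x \<in> N \<and>
      (\<forall>i\<in>I. \<forall>j\<in>I. S i \<inter> N \<noteq> {} \<and> S j \<inter> N \<noteq> {} \<longrightarrow> i = j)"
  obtains L L' where "homeomorphic_maps X X L L'"
    "\<And>i x. i \<in> I \<Longrightarrow> x \<in> S i \<Longrightarrow> L x = l i x \<and> L x \<in> S i"
    "\<And>x. (\<And>i. i \<in> I \<Longrightarrow> x \<notin> S i) \<Longrightarrow> L x = x"
proof -
  have uniq: "i = j" if "i \<in> I" "j \<in> I" "x \<in> S i" "x \<in> S j" for i j x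
  proof -
    have "x \<in> topspace X" using S that by blast
    from disc[OF this] obtain N where "openin X N \<and> x \<in> N \<and>
      (\<forall>i\<in>I. \<forall>j\<in>I. S i \<inter> N \<noteq> {} \<and> S j \<inter> N \<noteq> {} \<longrightarrow> i = j)" by (rule exE)
    then show ?thesis using that by blast
  qed
  define G where "G f x = (if \<exists>i\<in>I. x \<in> S i then f (THE i. i \<in> I \<and> x \<in> S i) x else x)"
    for f :: "'i \<Rightarrow> 'a \<Rightarrow> 'a" and x
  have G1: "G f x = f i x" if "i \<in> I" "x \<in> S i" for f i x
  proof -
    have "(THE i. i \<in> I \<and> x \<in> S i) = i" using that uniq by (intro the_equality) auto
    then show ?thesis using that by (auto simp: G_def)
  qed
  have G2: "G f x = x" if "\<And>i. i \<in> I \<Longrightarrow> x \<notin> S i" for f x using that by (auto simp: G_def)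
  have cont: "continuous_map X X (G f)"
    if f: "\<And>i. i \<in> I \<Longrightarrow> continuous_map X X (f i)"
      and fid: "\<And>i x. i \<in> I \<Longrightarrow> x \<in> topspace X - S i \<Longrightarrow> f i x = x" for f
  proof (rule continuous_map_locally_eq)
    fix x assume "x \<in> topspace X"
    from disc[OF this] obtain N where N0: "openin X N \<and> x \<in> N \<and>
      (\<forall>i\<in>I. \<forall>j\<in>I. S i \<inter> N \<noteq> {} \<and> S j \<inter> N \<noteq> {} \<longrightarrow> i = j)" by (rule exE)
    then have N: "openin X N" "x \<in> N" by simp_all
    have one: "i = j" if "i \<in> I" "j \<in> I" "S i \<inter> N \<noteq> {}" "S j \<inter> N \<noteq> {}" for i j
      using N0 that by simp
    have NX: "N \<subseteq> topspace X" using N openin_subset by blast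
    show "\<exists>N g. openin X N \<and> x \<in> N \<and> continuous_map X X g \<and> (\<forall>y\<in>N. G f y = g y)"
    proof (cases "\<exists>i\<in>I. S i \<inter> N \<noteq> {}")
      case True
      then obtain i where i: "i \<in> I" "S i \<inter> N \<noteq> {}" by blast
      have "G f y = f i y" if y: "y \<in> N" for y
      proof (cases "y \<in> S i")
        case True then show ?thesis using G1 i by blast
      next
        case False
        have "y \<notin> S j" if "j \<in> I" for j
        proof
          assume "y \<in> S j"
          then have "j = i" using one[OF that i(1)] i(2) y by blast
          then show False using False \<open>y \<in> S j\<close> by simp
        qed
        then have "G f y = y" using G2 by blast
        moreover have "f i y = y" using fid[OF i(1)] False y NX by blast
        ultimately show ?thesis by simp
      qed
      then show ?thesis using N f[OF i(1)] by blast
    next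
      case False
      then have "G f y = id y" if "y \<in> N" for y using G2[of y f] that by auto
      moreover have "continuous_map X X id" by simp
      ultimately show ?thesis using N by blast
    qed
  qed
  have sup: "\<And>x. x \<in> topspace X - S i \<Longrightarrow> l' i x = x" "\<And>x. x \<in> S i \<Longrightarrow> l i x \<in> S i"
    "\<And>x. x \<in> S i \<Longrightarrow> l' i x \<in> S i" if i: "i \<in> I" for i
    using homeomorphic_maps_supported[OF hom[OF i] S[OF i]] id[OF i] by blast+
  have "homeomorphic_maps X X (G l) (G l')"
    unfolding homeomorphic_maps_def
  proof (intro conjI ballI)
    show "continuous_map X X (G l)" using cont[of l] hom id by (auto simp: homeomorphic_maps_def)
    show "continuous_map X X (G l')" using cont[of l'] hom sup(1) by (auto simp: homeomorphic_maps_def)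
    fix x assume x: "x \<in> topspace X"
    show "G l' (G l x) = x"
    proof (cases "\<exists>i\<in>I. x \<in> S i")
      case True
      then obtain i where i: "i \<in> I" "x \<in> S i" by blast
      then show ?thesis using G1[OF i] G1[OF i(1) sup(2)[OF i]] homeomorphic_mapsD(3)[OF hom[OF i(1)] x] by metis
    next
      case False then show ?thesis using G2 by metis
    qed
    show "G l (G l' x) = x"
    proof (cases "\<exists>i\<in>I. x \<in> S i")
      case True
      then obtain i where i: "i \<in> I" "x \<in> S i" by blast
      then show ?thesis using G1[OF i] G1[OF i(1) sup(3)[OF i]] homeomorphic_mapsD(4)[OF hom[OF i(1)] x] by metis
    next
      case False then show ?thesis using G2 by metis
    qed
  qed
  moreover have "G l x = l i x \<and> G l x \<in> S i" if "i \<in> I" "x \<in> S i" for i x using G1[OF that] sup(2)[OF that] by simp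
  ultimately show ?thesis using that G2 by blast
qed

text \<open>Continuity of the extension is only in doubt at points outside \<open>V\<close>:
  \<open>bd\<close> asks that points of \<open>V\<close> close to such a point stay close to it
  under \<open>t\<close> and \<open>t'\<close>. The condition on \<open>t'\<close> makes the inverse
  extend as well.\<close>

lemma homeomorphic_maps_extend:
  assumes V: "openin X V" and t: "homeomorphic_maps (subtopology X V) (subtopology X V) t t'"
    and bd: "\<And>a Q. a \<in> topspace X - V \<Longrightarrow> openin X Q \<Longrightarrow> a \<in> Q \<Longrightarrow>
      \<exists>N. openin X N \<and> a \<in> N \<and> (\<forall>x\<in>V \<inter> N. t x \<in> Q \<and> t' x \<in> Q)"
  shows "homeomorphic_maps X X (\<lambda>x. if x \<in> V then t x else x) (\<lambda>x. if x \<in> V then t' x else x)"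
proof -
  have VX: "V \<subseteq> topspace X" using V openin_subset by blast
  then have ts: "topspace (subtopology X V) = V" by auto
  have cont: "continuous_map X X (\<lambda>x. if x \<in> V then s x else x)"
    if s: "continuous_map (subtopology X V) (subtopology X V) s"
      and b: "\<And>a Q. a \<in> topspace X - V \<Longrightarrow> openin X Q \<Longrightarrow> a \<in> Q \<Longrightarrow>
      \<exists>N. openin X N \<and> a \<in> N \<and> (\<forall>x\<in>V \<inter> N. s x \<in> Q)" for s
    unfolding continuous_map_eq_topcontinuous_at
  proof
    let ?s = "\<lambda>x. if x \<in> V then s x else x"
    have sV: "s y \<in> V" if "y \<in> V" for y using s that ts by (auto simp: continuous_map_def)
    then have allX: "?s x \<in> topspace X" if "x \<in> topspace X" for x using that VX by auto
    fix x assume x: "x \<in> topspace X"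
    have sx: "?s x \<in> topspace X" using allX x by blast
    have *: "\<exists>U. openin X U \<and> x \<in> U \<and> (\<forall>y\<in>U. ?s y \<in> W)" if W: "openin X W \<and> ?s x \<in> W" for W
    proof (cases "x \<in> V")
      case True
      let ?U = "{y \<in> topspace (subtopology X V). s y \<in> W \<inter> V}"
      have "openin (subtopology X V) (W \<inter> V)" using W by (simp add: openin_subtopology_Int)
      then have "openin (subtopology X V) ?U" using s openin_continuous_map_preimage by blast
      then have "openin X ?U" using V openin_trans_full by blast
      moreover have "x \<in> ?U" using True ts W sV by auto
      moreover have "\<forall>y\<in>?U. ?s y \<in> W" using ts by auto
      ultimately show ?thesis by blast
    next
      case False
      then have "x \<in> W" using W by simp
      with b[of x W] W x False obtain N where N: "openin X N" "x \<in> N" "\<forall>y\<in>V \<inter> N. s y \<in> W" by blast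
      have "\<forall>y\<in>N \<inter> W. ?s y \<in> W" using N by auto
      then show ?thesis using N W \<open>x \<in> W\<close> by (intro exI[of _ "N \<inter> W"]) auto
    qed
    show "topcontinuous_at X X ?s x" unfolding topcontinuous_at_def using x sx * allX by (intro conjI allI impI Pi_I) simp_all
  qed
  have tV: "t x \<in> V" "t' x \<in> V" "t' (t x) = x" "t (t' x) = x" if "x \<in> V" for x
    using homeomorphic_mapsD[OF t, unfolded ts] that by simp_all
  have bd1: "\<exists>N. openin X N \<and> a \<in> N \<and> (\<forall>x\<in>V \<inter> N. t x \<in> W)"
    and bd2: "\<exists>N. openin X N \<and> a \<in> N \<and> (\<forall>x\<in>V \<inter> N. t' x \<in> W)"
    if aW: "a \<in> topspace X - V" "openin X W" "a \<in> W" for a W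
  proof -
    obtain N where N: "openin X N \<and> a \<in> N \<and> (\<forall>x\<in>V \<inter> N. t x \<in> W \<and> t' x \<in> W)"
      using bd[OF aW] by (rule exE)
    show "\<exists>N. openin X N \<and> a \<in> N \<and> (\<forall>x\<in>V \<inter> N. t x \<in> W)"
      "\<exists>N. openin X N \<and> a \<in> N \<and> (\<forall>x\<in>V \<inter> N. t' x \<in> W)"
      by (rule exI[of _ N], use N in simp)+
  qed
  have "continuous_map X X (\<lambda>x. if x \<in> V then t x else x)"
    by (rule cont[OF _ bd1]) (use t in \<open>simp_all add: homeomorphic_maps_def\<close>)
  moreover have "continuous_map X X (\<lambda>x. if x \<in> V then t' x else x)"
    by (rule cont[OF _ bd2]) (use t in \<open>simp_all add: homeomorphic_maps_def\<close>)
  ultimately show ?thesis using tV by (auto simp: homeomorphic_maps_def)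
qed


section \<open>Discrete families: images and closed unions\<close>

lemma discrete_familyE:
  assumes "discrete_family X \<F>" "x \<in> topspace X"
  obtains N where "openin X N" "x \<in> N"
    "\<And>F G. F \<in> \<F> \<Longrightarrow> G \<in> \<F> \<Longrightarrow> F \<inter> N \<noteq> {} \<Longrightarrow> G \<inter> N \<noteq> {} \<Longrightarrow> F = G"
proof -
  from assms obtain N where N: "openin X N \<and> x \<in> N \<and>
        (\<forall>F\<in>\<F>. \<forall>G\<in>\<F>. F \<inter> N \<noteq> {} \<and> G \<inter> N \<noteq> {} \<longrightarrow> F = G)"
    unfolding discrete_family_def by (metis (no_types))
  show ?thesis by (rule that[of N]) (use N in simp_all)
qed

lemma discrete_family_subset:
  assumes "discrete_family X \<F>" "\<G> \<subseteq> \<F>"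
  shows "discrete_family X \<G>"
  unfolding discrete_family_def
proof
  fix x assume "x \<in> topspace X"
  from discrete_familyE[OF assms(1) this] obtain N where N: "openin X N" "x \<in> N"
    "\<And>F G. F \<in> \<F> \<Longrightarrow> G \<in> \<F> \<Longrightarrow> F \<inter> N \<noteq> {} \<Longrightarrow> G \<inter> N \<noteq> {} \<Longrightarrow> F = G" by metis
  show "\<exists>N. openin X N \<and> x \<in> N \<and> (\<forall>F\<in>\<G>. \<forall>G\<in>\<G>. F \<inter> N \<noteq> {} \<and> G \<inter> N \<noteq> {} \<longrightarrow> F = G)"
    by (rule exI[of _ N]) (use N assms(2) in \<open>simp add: subset_iff\<close>)
qed

lemma discrete_family_disjoint:
  assumes "discrete_family X \<F>" "F \<in> \<F>" "G \<in> \<F>" "x \<in> F" "x \<in> G" "x \<in> topspace X"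
  shows "F = G"
proof -
  obtain N where "x \<in> N"
    "\<And>F G. F \<in> \<F> \<Longrightarrow> G \<in> \<F> \<Longrightarrow> F \<inter> N \<noteq> {} \<Longrightarrow> G \<inter> N \<noteq> {} \<Longrightarrow> F = G"
    using discrete_familyE[OF assms(1,6)] by metis
  then show ?thesis using assms by blast
qed

lemma discrete_family_image:
  assumes h: "homeomorphic_maps X Y h k" and F: "discrete_family X \<F>" and sub: "\<And>F. F \<in> \<F> \<Longrightarrow> F \<subseteq> topspace X"
  shows "discrete_family Y ((`) h ` \<F>)"
  unfolding discrete_family_def
proof
  fix y assume y: "y \<in> topspace Y"
  then have "k y \<in> topspace X" using homeomorphic_mapsD[OF h] by blast
  then obtain N where N: "openin X N" "k y \<in> N"
    "\<And>F G. F \<in> \<F> \<Longrightarrow> G \<in> \<F> \<Longrightarrow> F \<inter> N \<noteq> {} \<Longrightarrow> G \<inter> N \<noteq> {} \<Longrightarrow> F = G"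
    using discrete_familyE[OF F] by metis
  have NX: "N \<subseteq> topspace X" using N openin_subset by blast
  have meet: "F \<inter> N \<noteq> {}" if "F \<in> \<F>" "h ` F \<inter> h ` N \<noteq> {}" for F
  proof -
    obtain a b where ab: "a \<in> F" "b \<in> N" "h a = h b" using \<open>h ` F \<inter> h ` N \<noteq> {}\<close> by auto
    have "a = k (h a)" "b = k (h b)"
      using homeomorphic_mapsD(3)[OF h] ab NX sub[OF that(1)] by force+
    then have "a = b" using ab by simp
    then show ?thesis using ab by blast
  qed
  show "\<exists>N. openin Y N \<and> y \<in> N \<and>
     (\<forall>F\<in>(`) h ` \<F>. \<forall>G\<in>(`) h ` \<F>. F \<inter> N \<noteq> {} \<and> G \<inter> N \<noteq> {} \<longrightarrow> F = G)"
  proof (intro exI[of _ "h ` N"] conjI)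
    show "openin Y (h ` N)" using homeomorphic_maps_openin_image[OF h N(1)] .
    show "y \<in> h ` N" using N(2) homeomorphic_mapsD(4)[OF h y] by (metis imageI)
    show "\<forall>F\<in>(`) h ` \<F>. \<forall>G\<in>(`) h ` \<F>. F \<inter> h ` N \<noteq> {} \<and> G \<inter> h ` N \<noteq> {} \<longrightarrow> F = G"
    proof (intro ballI impI, elim imageE conjE)
      fix F G F' G' assume *: "F \<inter> h ` N \<noteq> {}" "G \<inter> h ` N \<noteq> {}" "F = h ` F'" "G = h ` G'" "F' \<in> \<F>" "G' \<in> \<F>"
      have "F' = G'" using N(3)[OF *(5,6)] meet * by simp
      then show "F = G" using * by simp
    qed
  qed
qed

lemma discrete_family_closed_Union:
  assumes F: "discrete_family X \<F>" and cl: "\<And>F. F \<in> \<F> \<Longrightarrow> closedin X F"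
  shows "closedin X (\<Union>\<F>)"
proof -
  have sub: "\<Union>\<F> \<subseteq> topspace X" using cl closedin_subset by blast
  have "openin X (topspace X - \<Union>\<F>)"
  proof (subst openin_subopen, intro ballI)
    fix x assume x: "x \<in> topspace X - \<Union>\<F>"
    then have xX: "x \<in> topspace X" by blast
    obtain N where N: "openin X N" "x \<in> N"
      "\<And>F G. F \<in> \<F> \<Longrightarrow> G \<in> \<F> \<Longrightarrow> F \<inter> N \<noteq> {} \<Longrightarrow> G \<inter> N \<noteq> {} \<Longrightarrow> F = G"
      using discrete_familyE[OF F xX] by metis
    have NX: "N \<subseteq> topspace X" using N openin_subset by blast
    show "\<exists>T. openin X T \<and> x \<in> T \<and> T \<subseteq> topspace X - \<Union>\<F>"
    proof (cases "\<exists>F\<in>\<F>. F \<inter> N \<noteq> {}")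
      case True
      then obtain F where F: "F \<in> \<F>" "F \<inter> N \<noteq> {}" by blast
      then have "N - F \<subseteq> topspace X - \<Union>\<F>" using N(3) NX by blast
      moreover have "openin X (N - F)" using N(1) cl[OF F(1)] by (simp add: openin_diff)
      ultimately show ?thesis using x N F by blast
    next
      case False
      then have "N \<subseteq> topspace X - \<Union>\<F>" using NX by blast
      then show ?thesis using N by blast
    qed
  qed
  then show ?thesis using sub by (simp add: closedin_def)
qed

section \<open>Vanishing decompositions\<close>

lemma decomposition_eqI:
  assumes "decomposition X \<D>" "D \<in> \<D>" "E \<in> \<D>" "x \<in> D" "x \<in> E"
  shows "D = E"
proof (rule ccontr)
  assume "D \<noteq> E"
  then have "disjnt D E" using assms by (simp add: decomposition_def pairwise_def)
  then show False using assms(4,5) by (auto simp: disjnt_def)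
qed

lemma decomposition_subset: "decomposition X \<D> \<Longrightarrow> D \<in> \<D> \<Longrightarrow> D \<subseteq> topspace X"
  by (auto simp: decomposition_def)

lemma decomposition_closedin:
  assumes "Hausdorff_space X" "decomposition X \<D>" "D \<in> \<D>"
  shows "closedin X D"
  using assms(2,3) by (intro compactin_imp_closedin assms(1)) (simp add: decomposition_def)

lemma metrizable_closed_nbhd:
  assumes "metrizable_space X" "openin X Q" "x \<in> Q"
  obtains N F where "openin X N" "closedin X F" "x \<in> N" "N \<subseteq> F" "F \<subseteq> Q"
proof -
  have "neighbourhood_base_of (closedin X) X"
    using metrizable_imp_regular_space[OF assms(1)] by (simp add: neighbourhood_base_of_closedin)
  then obtain N F where "openin X N \<and> closedin X F \<and> x \<in> N \<and> N \<subseteq> F \<and> F \<subseteq> Q"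
    using assms(2,3) unfolding neighbourhood_base_of by metis
  then show ?thesis using that by blast
qed

text \<open>Vanishing is tested on the cover by \<open>Q\<close> and the complement of a closed
  neighbourhood \<open>F\<close> of \<open>a\<close> inside \<open>Q\<close>. An element that meets
  \<open>N \<subseteq> F\<close> and leaves \<open>Q\<close> lies in neither set, so at most one
  such element comes near \<open>a\<close>; if it misses \<open>a\<close> it is cut away, being
  compact and hence closed.\<close>

lemma vanishing_local:
  assumes X: "metrizable_space X" and D: "decomposition X \<D>" and v: "vanishing X \<D>"
    and Q: "openin X Q" "a \<in> Q"
  obtains N where "openin X N" "a \<in> N" "\<And>E. E \<in> \<D> \<Longrightarrow> E \<inter> N \<noteq> {} \<Longrightarrow> a \<in> E \<or> E \<subseteq> Q"
proof -
  obtain N F where N: "openin X N" "closedin X F" "a \<in> N" "N \<subseteq> F" "F \<subseteq> Q"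
    using metrizable_closed_nbhd[OF X Q] by metis
  let ?U = "{Q, topspace X - F}"
  have "open_cover X ?U"
    unfolding open_cover_def using Q N openin_subset[OF Q(1)] by (auto simp: closedin_def)
  then have dis': "discrete_family X {E \<in> \<D>. \<forall>U\<in>?U. \<not> E \<subseteq> U}" using v unfolding vanishing_def by blast
  define \<W> where "\<W> = {E \<in> \<D>. \<forall>U\<in>?U. \<not> E \<subseteq> U}"
  have dis: "discrete_family X \<W>" using dis' unfolding \<W>_def .
  have a: "a \<in> topspace X" using Q openin_subset by blast
  obtain N1 where N1: "openin X N1" "a \<in> N1"
    "\<And>E G. E \<in> \<W> \<Longrightarrow> G \<in> \<W> \<Longrightarrow> E \<inter> N1 \<noteq> {} \<Longrightarrow> G \<inter> N1 \<noteq> {} \<Longrightarrow> E = G"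
    using discrete_familyE[OF dis a] by metis
  have exc: "E = G" if "E \<in> \<D>" "G \<in> \<D>" "E \<inter> (N \<inter> N1) \<noteq> {}" "G \<inter> (N \<inter> N1) \<noteq> {}"
      "\<not> E \<subseteq> Q" "\<not> G \<subseteq> Q" for E G
  proof -
    have "E \<in> \<W>" "G \<in> \<W>" unfolding \<W>_def using that N(4) by auto
    then show ?thesis using N1(3)[of E G] that by blast
  qed
  show ?thesis
  proof (cases "\<exists>E\<in>\<D>. E \<inter> (N \<inter> N1) \<noteq> {} \<and> \<not> E \<subseteq> Q \<and> a \<notin> E")
    case True
    then obtain E where E: "E \<in> \<D>" "E \<inter> (N \<inter> N1) \<noteq> {}" "\<not> E \<subseteq> Q" "a \<notin> E" by blast
    have "closedin X E"
      using decomposition_closedin[OF metrizable_imp_Hausdorff_space[OF X] D E(1)] .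
    then have op: "openin X (N \<inter> N1 - E)" using N N1 by (simp add: openin_diff openin_Int)
    show ?thesis
    proof (rule that[OF op])
      show "a \<in> N \<inter> N1 - E" using N N1 E by blast
      show "a \<in> G \<or> G \<subseteq> Q" if G: "G \<in> \<D>" "G \<inter> (N \<inter> N1 - E) \<noteq> {}" for G
      proof (rule ccontr)
        assume "\<not> (a \<in> G \<or> G \<subseteq> Q)"
        then have "G = E" using exc[OF G(1) E(1) _ E(2) _ E(3)] G(2) by blast
        then show False using G(2) by blast
      qed
    qed
  next
    case False
    show ?thesis
      by (rule that[of "N \<inter> N1"]) (use N N1 False in \<open>auto simp: openin_Int\<close>)
  qed
qed

text \<open>The largest saturated subset of \<open>S\<close>. No openness is built in: that it is
  open for open \<open>S\<close> is a consequence of vanishing.\<close>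

definition saturated_interior :: "'a set set \<Rightarrow> 'a set \<Rightarrow> 'a set" where
  "saturated_interior \<D> S = \<Union>{E \<in> \<D>. E \<subseteq> S}"

lemma saturated_interior_subset: "saturated_interior \<D> S \<subseteq> S"
  by (auto simp: saturated_interior_def)

lemma saturated_saturated_interior: "saturated \<D> (saturated_interior \<D> S)"
  unfolding saturated_interior_def saturated_def by (rule exI[of _ "{E \<in> \<D>. E \<subseteq> S}"]) simp

lemma subset_saturated_interior: "E \<in> \<D> \<Longrightarrow> E \<subseteq> S \<Longrightarrow> E \<subseteq> saturated_interior \<D> S"
  by (auto simp: saturated_interior_def)

lemma saturated_meets:
  assumes "decomposition X \<D>" "saturated \<D> S" "E \<in> \<D>" "E \<inter> S \<noteq> {}"
  shows "E \<subseteq> S"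
proof -
  obtain \<E> where \<E>: "\<E> \<subseteq> \<D>" "S = \<Union>\<E>" using assms(2) unfolding saturated_def by blast
  then obtain x G where x: "x \<in> E" "x \<in> G" "G \<in> \<E>" using assms(4) by blast
  then have "E = G" using decomposition_eqI[OF assms(1,3)] \<E> by blast
  then show ?thesis using \<E> x by blast
qed

text \<open>At a point of an element \<open>E \<subseteq> Q\<close>, every nearby element either
  contains the point, and is then \<open>E\<close>, or lies in \<open>Q\<close>. This is upper
  semicontinuity of the decomposition.\<close>

lemma openin_saturated_interior:
  assumes X: "metrizable_space X" and D: "decomposition X \<D>" and v: "vanishing X \<D>" and Q: "openin X Q"
  shows "openin X (saturated_interior \<D> Q)"
proof (subst openin_subopen, intro ballI)
  fix x assume "x \<in> saturated_interior \<D> Q"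
  then obtain E where E: "E \<in> \<D>" "E \<subseteq> Q" "x \<in> E" by (auto simp: saturated_interior_def)
  then have "x \<in> Q" by blast
  obtain N where N: "openin X N" "x \<in> N" "\<And>E. E \<in> \<D> \<Longrightarrow> E \<inter> N \<noteq> {} \<Longrightarrow> x \<in> E \<or> E \<subseteq> Q"
    using vanishing_local[OF X D v Q \<open>x \<in> Q\<close>] by metis
  have "N \<subseteq> saturated_interior \<D> Q"
  proof
    fix y assume y: "y \<in> N"
    then have "y \<in> topspace X" using N openin_subset by blast
    then obtain G where G: "G \<in> \<D>" "y \<in> G" using D unfolding decomposition_def by blast
    then have "x \<in> G \<or> G \<subseteq> Q" using N(3) y by blast
    then have "G \<subseteq> Q" using decomposition_eqI[OF D G(1) E(1) _ E(3)] E by blast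
    then show "y \<in> saturated_interior \<D> Q" using G by (auto simp: saturated_interior_def)
  qed
  then show "\<exists>T. openin X T \<and> x \<in> T \<and> T \<subseteq> saturated_interior \<D> Q" using N by blast
qed

text \<open>Saturated open sets of \<open>X\<close> are the preimages of the open sets of the
  quotient, so density in the quotient can be used without leaving \<open>X\<close>.\<close>

lemma dense_decomposition_meets:
  assumes D: "decomposition X \<D>" and dn: "dense_decomposition X \<D>"
    and S: "openin X S" "saturated \<D> S" "S \<noteq> {}"
  obtains E where "E \<in> nondegenerate \<D>" "E \<subseteq> S"
proof -
  let ?V = "{E \<in> \<D>. E \<subseteq> S}"
  have SX: "S \<subseteq> topspace X" using S openin_subset by blast
  have "{x \<in> topspace X. decomp_map \<D> x \<in> ?V} = S"
  proof (intro set_eqI iffI)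
    fix x assume "x \<in> {x \<in> topspace X. decomp_map \<D> x \<in> ?V}"
    then show "x \<in> S" using decomp_map_in(2)[OF D] by blast
  next
    fix x assume x: "x \<in> S"
    then have xX: "x \<in> topspace X" using SX by blast
    have "decomp_map \<D> x \<subseteq> S"
      using saturated_meets[OF D S(2) decomp_map_in(1)[OF D xX]] decomp_map_in(2)[OF D xX] x by blast
    then show "x \<in> {x \<in> topspace X. decomp_map \<D> x \<in> ?V}" using decomp_map_in(1)[OF D xX] xX by blast
  qed
  then have op: "openin (decomp_space X \<D>) ?V" using S(1) by (simp add: openin_decomp_space)
  obtain x where x: "x \<in> S" using S by blast
  then have xX: "x \<in> topspace X" using SX by blast
  have "decomp_map \<D> x \<in> ?V"
    using saturated_meets[OF D S(2) decomp_map_in(1)[OF D xX]] decomp_map_in[OF D xX] x by blast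
  moreover have "decomp_map \<D> x \<in> decomp_space X \<D> closure_of nondegenerate \<D>"
    using dn decomp_map_in(1)[OF D xX] topspace_decomp_space[OF D] unfolding dense_decomposition_def by simp
  ultimately have "\<exists>E. E \<in> nondegenerate \<D> \<and> E \<in> ?V"
    using op unfolding in_closure_of by (elim conjE allE[of _ ?V]) simp
  then obtain E where "E \<in> nondegenerate \<D>" "E \<in> ?V" by blast
  then show ?thesis using that by blast
qed

text \<open>The second alternative really occurs: elements may have interior, like tame balls in \<open>\<real>\<^sup>n\<close>.\<close>

lemma dense_vanishing_dichotomy:
  assumes X: "metrizable_space X" and D: "decomposition X \<D>" and v: "vanishing X \<D>"
    and dn: "dense_decomposition X \<D>" and U: "openin X U" "y \<in> U"
  obtains E where "E \<in> nondegenerate \<D>" "E \<subseteq> U \<or> (\<exists>N. openin X N \<and> y \<in> N \<and> N \<subseteq> E)"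
proof (cases "\<exists>E\<in>\<D>. E \<subseteq> U")
  case True
  then obtain E0 where E0: "E0 \<in> \<D>" "E0 \<subseteq> U" by blast
  then have "E0 \<noteq> {}" using D by (simp add: decomposition_def)
  then have "saturated_interior \<D> U \<noteq> {}" using subset_saturated_interior[OF E0] by blast
  then obtain E where "E \<in> nondegenerate \<D>" "E \<subseteq> saturated_interior \<D> U"
    using dense_decomposition_meets[OF D dn openin_saturated_interior[OF X D v U(1)] saturated_saturated_interior]
    by blast
  then have "E \<subseteq> U" using saturated_interior_subset[of \<D> U] by simp
  then show ?thesis using that \<open>E \<in> nondegenerate \<D>\<close> by metis
next
  case False
  \<comment> \<open>No element fits into \<open>U\<close>, so every element meeting \<open>N\<close>
    must contain \<open>y\<close>: there is only one, and it contains \<open>N\<close>. It is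
    non-degenerate because \<open>{y}\<close> would fit into \<open>U\<close>.\<close>
  obtain N where N: "openin X N" "y \<in> N" "\<And>E. E \<in> \<D> \<Longrightarrow> E \<inter> N \<noteq> {} \<Longrightarrow> y \<in> E \<or> E \<subseteq> U"
    using vanishing_local[OF X D v U] by metis
  have NX: "N \<subseteq> topspace X" using N openin_subset by blast
  then have yX: "y \<in> topspace X" using N by blast
  let ?E = "decomp_map \<D> y"
  have E: "?E \<in> \<D>" "y \<in> ?E" using decomp_map_in[OF D yX] by auto
  have "N \<subseteq> ?E"
  proof
    fix z assume z: "z \<in> N"
    then have zX: "z \<in> topspace X" using NX by blast
    note G = decomp_map_in[OF D zX]
    have "y \<in> decomp_map \<D> z" using N(3)[OF G(1)] G False z by blast
    then show "z \<in> ?E" using decomposition_eqI[OF D E(1) G(1) E(2)] G by simp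
  qed
  moreover have "\<not> ?E \<subseteq> {y}" using False E U by blast
  then have "?E \<in> nondegenerate \<D>" using E unfolding nondegenerate_def by blast
  ultimately show ?thesis using that N(1,2) by metis
qed

section \<open>Shifting and shrinking with controlled support\<close>

definition enlarge :: "'a topology \<Rightarrow> ('a \<Rightarrow> 'a \<Rightarrow> real) \<Rightarrow> 'a set \<Rightarrow> real \<Rightarrow> 'a set" where
  "enlarge X d S r = {x \<in> topspace X. \<exists>s\<in>S. d s x < r}"

lemma complete_metric_for_imp_metrizable:
  assumes "complete_metric_for X d"
  shows "metrizable_space X"
  using Metric_space.metrizable_space_mtopology[OF complete_metric_forD(1)[OF assms]]
  by (simp add: complete_metric_forD(2)[OF assms])

lemma openin_enlarge:
  assumes d: "complete_metric_for X d" and S: "S \<subseteq> topspace X"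
  shows "openin X (enlarge X d S r)"
proof -
  interpret Metric_space "topspace X" d using complete_metric_forD[OF d] by simp
  have "enlarge X d S r = (\<Union>s\<in>S. mball s r)" using S by (fastforce simp: enlarge_def)
  moreover have "openin mtopology (\<Union>s\<in>S. mball s r)" by (intro openin_Union) auto
  ultimately show ?thesis using complete_metric_forD(2)[OF d] by simp
qed

lemma subset_enlarge:
  assumes d: "complete_metric_for X d" and S: "S \<subseteq> topspace X" and "r > 0"
  shows "S \<subseteq> enlarge X d S r"
proof
  interpret Metric_space "topspace X" d using complete_metric_forD[OF d] by simp
  fix x assume "x \<in> S"
  then have "x \<in> topspace X" "d x x < r" using S \<open>r > 0\<close> by auto
  then show "x \<in> enlarge X d S r" using \<open>x \<in> S\<close> unfolding enlarge_def by blast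
qed

lemma enlarge_mono: "r \<le> s \<Longrightarrow> enlarge X d S r \<subseteq> enlarge X d S s"
  by (force simp: enlarge_def)

lemma compact_enlarge:
  assumes d: "complete_metric_for X d" and S: "compactin X S" and U: "openin X U" "S \<subseteq> U"
  obtains r where "r > 0" "enlarge X d S r \<subseteq> U"
proof -
  interpret Metric_space "topspace X" d using complete_metric_forD[OF d] by simp
  have top: "mtopology = X" using complete_metric_forD(2)[OF d] .
  have SX: "S \<subseteq> topspace X" using S compactin_subset_topspace by blast
  \<comment> \<open>Lebesgue's number for the cover with the single member \<open>U\<close> replaces
    the distance to the complement of \<open>U\<close>, which may be empty.\<close>
  have "\<exists>\<epsilon>>0. \<forall>x\<in>S. \<exists>U\<in>{U}. mball x \<epsilon> \<subseteq> U"
    by (rule lebesgue_number) (use S U top in auto)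
  then obtain r where r: "r > 0" "\<And>x. x \<in> S \<Longrightarrow> mball x r \<subseteq> U" by blast
  have "enlarge X d S r \<subseteq> U"
  proof
    fix y assume "y \<in> enlarge X d S r"
    then obtain s where s: "s \<in> S" "d s y < r" "y \<in> topspace X" by (auto simp: enlarge_def)
    then have "y \<in> mball s r" using SX by auto
    then show "y \<in> U" using r(2)[OF s(1)] by blast
  qed
  then show ?thesis using that r by blast
qed

text \<open>\<open>\<N>\<close> is the set of admissible targets. Its members need not be small, so
  a target need not fit into a prescribed shift neighbourhood; \<open>dich\<close> leaves only the
  other extreme, a target that contains a whole neighbourhood of the point. In both cases a set of
  \<open>\<K>\<close> that has been shrunk close enough to the point is within reach of the target,
  with everything supported in \<open>S\<close>.\<close>

lemma single_shift:
  assumes K: "tame_family X \<K>" and S: "openin X S" and K0: "K0 \<in> \<K>" "K0 \<subseteq> S"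
    and N: "\<N> \<subseteq> \<K>"
    and dich: "\<And>y U. y \<in> S \<Longrightarrow> openin X U \<Longrightarrow> y \<in> U \<Longrightarrow> U \<subseteq> S \<Longrightarrow>
      \<exists>E\<in>\<N>. E \<subseteq> S \<and> (E \<subseteq> U \<or> (\<exists>N. openin X N \<and> y \<in> N \<and> N \<subseteq> E))"
  obtains l l' where "homeomorphic_maps X X l l'" "\<And>x. x \<in> topspace X - S \<Longrightarrow> l x = x" "l ` K0 \<in> \<N>"
proof -
  have SX: "S \<subseteq> topspace X" using S openin_subset by blast
  have inv: "h ` A \<in> \<K>" if "homeomorphic_maps X X h k" "A \<in> \<K>" for h k A
    using K that homeomorphic_maps_imp_map[OF that(1)] unfolding tame_family_def ambiently_invariant_def by blast
  have "\<forall>y\<in>S. \<exists>U. openin X U \<and> y \<in> U \<and> U \<subseteq> S \<and>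
      (\<forall>A\<in>\<K>. \<forall>B\<in>\<K>. A \<subseteq> U \<and> B \<subseteq> U \<longrightarrow>
         (\<exists>h. homeomorphic_map X X h \<and> h ` A = B \<and> (\<forall>y\<in>topspace X - S. h y = y)))"
  proof
    fix y assume y: "y \<in> S"
    have "local_shift_property X \<K>" using K by (simp add: tame_family_def)
    moreover have "y \<in> topspace X \<and> openin X S \<and> y \<in> S" using y S SX by blast
    ultimately show "\<exists>U. openin X U \<and> y \<in> U \<and> U \<subseteq> S \<and>
      (\<forall>A\<in>\<K>. \<forall>B\<in>\<K>. A \<subseteq> U \<and> B \<subseteq> U \<longrightarrow>
         (\<exists>h. homeomorphic_map X X h \<and> h ` A = B \<and> (\<forall>y\<in>topspace X - S. h y = y)))"
      unfolding local_shift_property_def by simp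
  qed
  then obtain U where U: "\<forall>y\<in>S. openin X (U y) \<and> y \<in> U y \<and> U y \<subseteq> S \<and>
      (\<forall>A\<in>\<K>. \<forall>B\<in>\<K>. A \<subseteq> U y \<and> B \<subseteq> U y \<longrightarrow>
         (\<exists>h. homeomorphic_map X X h \<and> h ` A = B \<and> (\<forall>y\<in>topspace X - S. h y = y)))"
    by (rule bchoice[THEN exE])
  then have U1: "openin X (U y)" "y \<in> U y" "U y \<subseteq> S" if "y \<in> S" for y using that by simp_all
  have U2: "\<exists>h h'. homeomorphic_maps X X h h' \<and> h ` A = B \<and> (\<forall>y\<in>topspace X - S. h y = y)"
    if "y \<in> S" "A \<in> \<K>" "B \<in> \<K>" "A \<subseteq> U y" "B \<subseteq> U y" for y A B
  proof -
    have "\<exists>h. homeomorphic_map X X h \<and> h ` A = B \<and> (\<forall>y\<in>topspace X - S. h y = y)"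
      using U that by simp
    then show ?thesis unfolding homeomorphic_map_maps by blast
  qed
  \<comment> \<open>\<open>W y\<close> is where \<open>K0\<close> may land: inside the shift
    neighbourhood \<open>U y\<close> and, if the target found for \<open>y\<close> does not fit into
    \<open>U y\<close>, inside that target. Shrinking \<open>K0\<close> along the cover by the sets
    \<open>W y\<close> then selects one \<open>y\<close> and with it the case.\<close>
  have "\<forall>y\<in>S. \<exists>W. openin X W \<and> y \<in> W \<and> W \<subseteq> U y \<and> (\<exists>E\<in>\<N>. E \<subseteq> S \<and> (E \<subseteq> U y \<or> W \<subseteq> E))"
  proof
    fix y assume y: "y \<in> S"
    obtain E where E: "E \<in> \<N>" "E \<subseteq> S" "E \<subseteq> U y \<or> (\<exists>N. openin X N \<and> y \<in> N \<and> N \<subseteq> E)"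
      using dich[OF y U1[OF y]] by blast
    show "\<exists>W. openin X W \<and> y \<in> W \<and> W \<subseteq> U y \<and> (\<exists>E\<in>\<N>. E \<subseteq> S \<and> (E \<subseteq> U y \<or> W \<subseteq> E))"
    proof (cases "E \<subseteq> U y")
      case True
      then show ?thesis using U1[OF y] E by (intro exI[of _ "U y"]) blast
    next
      case False
      then obtain N where N: "openin X N" "y \<in> N" "N \<subseteq> E" using E by blast
      have "openin X (U y \<inter> N)" using N U1[OF y] by (simp add: openin_Int)
      then show ?thesis using N U1[OF y] E by (intro exI[of _ "U y \<inter> N"]) blast
    qed
  qed
  then obtain W where W: "\<forall>y\<in>S. openin X (W y) \<and> y \<in> W y \<and> W y \<subseteq> U y \<and> (\<exists>E\<in>\<N>. E \<subseteq> S \<and> (E \<subseteq> U y \<or> W y \<subseteq> E))"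
    by (rule bchoice[THEN exE])
  have cover: "open_cover (subtopology X S) (T ` S)"
    if T: "\<And>y. y \<in> S \<Longrightarrow> openin X (T y) \<and> y \<in> T y \<and> T y \<subseteq> S" for T
    unfolding open_cover_def
  proof
    show "\<forall>V\<in>T ` S. openin (subtopology X S) V"
      using T by (simp add: openin_open_subtopology[OF S])
    have "\<Union>(T ` S) = S" using T by blast
    then show "\<Union>(T ` S) = topspace (subtopology X S)" using SX by auto
  qed
  have shr: "\<exists>h h'. homeomorphic_maps X X h h' \<and> (\<forall>y\<in>topspace X - S. h y = y) \<and> (\<exists>y\<in>S. h ` A \<subseteq> T y)"
    if T: "\<And>y. y \<in> S \<Longrightarrow> openin X (T y) \<and> y \<in> T y \<and> T y \<subseteq> S" and A: "A \<in> \<K>" "A \<subseteq> S" for T A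
  proof -
    have "locally_shrinkable X A" using K A unfolding tame_family_def by blast
    then have "\<exists>h. homeomorphic_map X X h \<and> (\<forall>x\<in>topspace X - S. h x = x) \<and> (\<exists>V\<in>T ` S. h ` A \<subseteq> V)"
      using S A(2) cover[of T] T unfolding locally_shrinkable_def by blast
    then show ?thesis unfolding homeomorphic_map_maps by blast
  qed
  have "\<And>y. y \<in> S \<Longrightarrow> openin X (W y) \<and> y \<in> W y \<and> W y \<subseteq> S" using W U1(3) by blast
  from shr[OF this K0] obtain k k' y where k: "homeomorphic_maps X X k k'"
    "\<forall>y\<in>topspace X - S. k y = y" and y: "y \<in> S" "k ` K0 \<subseteq> W y" by blast
  obtain E where E: "E \<in> \<N>" "E \<subseteq> S" "E \<subseteq> U y \<or> W y \<subseteq> E" using W y(1) by blast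
  have EK: "E \<in> \<K>" using E N by blast
  have WU: "W y \<subseteq> U y" using W y(1) by blast
  show ?thesis
  proof (cases "E \<subseteq> U y")
    case True
    from U2[OF y(1) inv[OF k(1) K0(1)] EK] True y(2) WU obtain f f'
      where f: "homeomorphic_maps X X f f'" "f ` k ` K0 = E" "\<forall>y\<in>topspace X - S. f y = y" by blast
    show ?thesis
    proof (rule that[OF homeomorphic_maps_compose'[OF k(1) f(1)]])
      show "f (k x) = x" if "x \<in> topspace X - S" for x using k(2) f(3) that by simp
      show "(\<lambda>x. f (k x)) ` K0 \<in> \<N>" using f(2) E by (simp add: image_image)
    qed
  next
    case False
    then have kE: "k ` K0 \<subseteq> E" using E y by blast
    \<comment> \<open>Here \<open>E\<close> swallows \<open>k ` K0\<close>, so shrinking \<open>E\<close> carries \<open>k ` K0\<close> along into the same small set.\<close>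
    have "\<And>y. y \<in> S \<Longrightarrow> openin X (U y) \<and> y \<in> U y \<and> U y \<subseteq> S" using U1 by blast
    from shr[OF this EK E(2)] obtain m m' z where m: "homeomorphic_maps X X m m'"
      "\<forall>y\<in>topspace X - S. m y = y" and z: "z \<in> S" "m ` E \<subseteq> U z" by blast
    have "m ` k ` K0 \<subseteq> U z" using z kE by blast
    from U2[OF z(1) inv[OF m(1) inv[OF k(1) K0(1)]] inv[OF m(1) EK] this z(2)] obtain f f'
      where f: "homeomorphic_maps X X f f'" "f ` m ` k ` K0 = m ` E" "\<forall>y\<in>topspace X - S. f y = y" by blast
    have m': "m' x = x" if "x \<in> topspace X - S" for x
      using homeomorphic_maps_supported(1)[OF m(1) SX] m(2) that by blast
    have "m' ` m ` E = E" using homeomorphic_maps_image_image[OF m(1)] E(2) SX by blast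
    \<comment> \<open>Conjugating by \<open>m\<close> undoes the shrinking of the target:
      \<open>f\<close> matches the two shrunken sets, and \<open>m'\<close> returns the target to
      its original place.\<close>
    then have im: "m' ` f ` m ` k ` K0 = E" using f(2) by simp
    show ?thesis
    proof (rule that[OF homeomorphic_maps_compose'[OF k(1) homeomorphic_maps_compose'[OF m(1)
             homeomorphic_maps_compose'[OF f(1) homeomorphic_maps_sym'[OF m(1)]]]]])
      show "m' (f (m (k x))) = x" if "x \<in> topspace X - S" for x using k(2) m(2) m' f(3) that by simp
      show "(\<lambda>x. m' (f (m (k x)))) ` K0 \<in> \<N>" using im E by (simp add: image_image)
    qed
  qed
qed

lemma shrink_off:
  assumes d: "complete_metric_for X d" and D: "decomposition X \<B>" and v: "vanishing X \<B>"
    and ss: "strongly_shrinkable X \<B>" and sub: "\<E> \<subseteq> \<B>" and cl: "closedin X (\<Union>\<E>)"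
    and Q: "\<And>E. E \<in> \<B> - \<E> \<Longrightarrow> openin X (Q E) \<and> E \<subseteq> Q E" and V: "open_cover X \<V>"
  obtains r r' where "homeomorphic_maps X X r r'" "\<And>x. x \<in> \<Union>\<E> \<Longrightarrow> r x = x"
    "\<And>x. x \<in> topspace X \<Longrightarrow> r x = x \<or> (\<exists>E\<in>\<B> - \<E>. x \<in> Q E \<and> r x \<in> Q E)"
    "\<And>E. E \<in> \<B> - \<E> \<Longrightarrow> \<exists>V\<in>\<V>. r ` E \<subseteq> V"
proof -
  interpret Metric_space "topspace X" d using complete_metric_forD[OF d] by simp
  have top: "mtopology = X" using complete_metric_forD(2)[OF d] .
  have X: "metrizable_space X" using complete_metric_for_imp_metrizable[OF d] .
  define V0 where "V0 = topspace X - \<Union>\<E>"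
  have V0: "openin X V0" using cl by (simp add: V0_def closedin_def)
  have V0X: "V0 \<subseteq> topspace X" by (simp add: V0_def)
  have ts: "topspace (subtopology X V0) = V0" using V0X by auto
  have un: "\<Union>\<B> = topspace X" using D by (simp add: decomposition_def)
  have ne: "E \<noteq> {}" if "E \<in> \<B>" for E using D that by (simp add: decomposition_def)
  have iff: "E \<subseteq> V0 \<longleftrightarrow> E \<notin> \<E>" if E: "E \<in> \<B>" for E
  proof
    assume "E \<subseteq> V0" then show "E \<notin> \<E>" using ne[OF E] by (auto simp: V0_def)
  next
    assume n: "E \<notin> \<E>"
    have "x \<notin> \<Union>\<E>" if x: "x \<in> E" for x
    proof
      assume "x \<in> \<Union>\<E>"
      then obtain F where F: "F \<in> \<E>" "x \<in> F" by blast
      then have "E = F" using decomposition_eqI[OF D E _ x] sub by blast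
      then show False using F n by simp
    qed
    then show "E \<subseteq> V0" using decomposition_subset[OF D E] by (auto simp: V0_def)
  qed
  have fam: "{E \<in> \<B>. E \<subseteq> V0} = \<B> - \<E>" using iff by blast
  \<comment> \<open>\<open>W E\<close> will stay within \<open>\<rho>\<close> of \<open>E\<close>,
    while the points within \<open>2 * \<rho>\<close> of \<open>E\<close> still belong to
    \<open>V0\<close>. So a point of \<open>W E\<close> at distance less than \<open>\<tau>\<close>
    from a point outside \<open>V0\<close> forces \<open>\<rho> < \<tau>\<close>.\<close>
  have "\<forall>E\<in>\<B> - \<E>. \<exists>\<rho>>0. enlarge X d E (2 * \<rho>) \<subseteq> V0"
  proof
    fix E assume E: "E \<in> \<B> - \<E>"
    then have "compactin X E" "E \<subseteq> V0" using D iff by (auto simp: decomposition_def)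
    then obtain r where "r > 0" "enlarge X d E r \<subseteq> V0" using compact_enlarge[OF d _ V0] by metis
    then show "\<exists>\<rho>>0. enlarge X d E (2 * \<rho>) \<subseteq> V0" by (intro exI[of _ "r/2"]) simp
  qed
  then obtain \<rho> where \<rho>: "\<forall>E\<in>\<B> - \<E>. \<rho> E > 0 \<and> enlarge X d E (2 * \<rho> E) \<subseteq> V0"
    by (rule bchoice[THEN exE])
  define W where "W E = saturated_interior \<B> (enlarge X d E (\<rho> E) \<inter> Q E \<inter> V0)" for E
  have Wop: "openin X (W E)" if E: "E \<in> \<B> - \<E>" for E
    unfolding W_def
  proof (rule openin_saturated_interior[OF X D v])
    have "openin X (enlarge X d E (\<rho> E))" using openin_enlarge[OF d] decomposition_subset[OF D] E by blast
    then show "openin X (enlarge X d E (\<rho> E) \<inter> Q E \<inter> V0)" using Q[OF E] V0 by (simp add: openin_Int)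
  qed
  have Wsub: "W E \<subseteq> enlarge X d E (\<rho> E)" "W E \<subseteq> Q E" "W E \<subseteq> V0" for E
    using saturated_interior_subset[of \<B> "enlarge X d E (\<rho> E) \<inter> Q E \<inter> V0"] unfolding W_def by blast+
  have EW: "E \<subseteq> W E" if E: "E \<in> \<B> - \<E>" for E
  proof -
    have "E \<subseteq> enlarge X d E (\<rho> E)" using subset_enlarge[OF d decomposition_subset[OF D]] E \<rho> by blast
    then have "E \<subseteq> enlarge X d E (\<rho> E) \<inter> Q E \<inter> V0" using Q[OF E] iff E by blast
    then show ?thesis unfolding W_def using subset_saturated_interior E by blast
  qed
  have "openin X V0 \<and> saturated \<B> V0"
  proof
    have "V0 = \<Union>(\<B> - \<E>)"
    proof
      show "V0 \<subseteq> \<Union>(\<B> - \<E>)" using un by (auto simp: V0_def)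
      show "\<Union>(\<B> - \<E>) \<subseteq> V0" using iff by blast
    qed
    then show "saturated \<B> V0" unfolding saturated_def by blast
  qed (rule V0)
  then have shr: "shrinkable (subtopology X V0) (\<B> - \<E>)"
    using ss fam unfolding strongly_shrinkable_def by metis
  have c1: "open_cover (subtopology X V0) (W ` (\<B> - \<E>))"
    unfolding open_cover_def
  proof
    show "\<forall>U\<in>W ` (\<B> - \<E>). openin (subtopology X V0) U"
      using Wop Wsub by (simp add: openin_open_subtopology[OF V0])
    have "V0 \<subseteq> \<Union>(W ` (\<B> - \<E>))"
    proof
      fix x assume x: "x \<in> V0"
      then obtain E where "E \<in> \<B>" "x \<in> E" using un V0X by blast
      moreover have "E \<notin> \<E>" using x \<open>x \<in> E\<close> by (auto simp: V0_def)
      ultimately show "x \<in> \<Union>(W ` (\<B> - \<E>))" using EW[of E] by blast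
    qed
    then show "\<Union>(W ` (\<B> - \<E>)) = topspace (subtopology X V0)" using Wsub(3) ts by blast
  qed
  have c2: "saturated (\<B> - \<E>) U" if U: "U \<in> W ` (\<B> - \<E>)" for U
  proof -
    obtain E where E: "U = W E" using U by blast
    let ?F = "{G \<in> \<B>. G \<subseteq> enlarge X d E (\<rho> E) \<inter> Q E \<inter> V0}"
    have "?F \<subseteq> \<B> - \<E>" using iff by blast
    moreover have "U = \<Union>?F" by (simp add: E W_def saturated_interior_def)
    ultimately show ?thesis unfolding saturated_def by blast
  qed
  have c3: "open_cover (subtopology X V0) ((\<lambda>V. V \<inter> V0) ` \<V>)"
    unfolding open_cover_def
  proof
    show "\<forall>U\<in>(\<lambda>V. V \<inter> V0) ` \<V>. openin (subtopology X V0) U"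
      using V by (auto simp: open_cover_def openin_subtopology)
    have "\<Union>\<V> = topspace X" using V by (simp add: open_cover_def)
    then show "\<Union>((\<lambda>V. V \<inter> V0) ` \<V>) = topspace (subtopology X V0)" using ts V0X by blast
  qed
  have "\<exists>h. homeomorphic_map (subtopology X V0) (subtopology X V0) h \<and>
     maps_close_on (topspace (subtopology X V0)) h id (W ` (\<B> - \<E>)) \<and>
     family_inscribed {h ` D | D. D \<in> \<B> - \<E>} ((\<lambda>V. V \<inter> V0) ` \<V>)"
    using shr c1 c2 c3 unfolding shrinkable_def by simp
  then obtain t where t012: "homeomorphic_map (subtopology X V0) (subtopology X V0) t \<and>
     maps_close_on (topspace (subtopology X V0)) t id (W ` (\<B> - \<E>)) \<and>
     family_inscribed {t ` D | D. D \<in> \<B> - \<E>} ((\<lambda>V. V \<inter> V0) ` \<V>)" by (rule exE)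
  then have t0: "homeomorphic_map (subtopology X V0) (subtopology X V0) t"
    and t1: "maps_close_on V0 t id (W ` (\<B> - \<E>))"
    and t2: "family_inscribed {t ` D | D. D \<in> \<B> - \<E>} ((\<lambda>V. V \<inter> V0) ` \<V>)"
    unfolding ts by blast+
  obtain t' where t: "homeomorphic_maps (subtopology X V0) (subtopology X V0) t t'"
    using t0 homeomorphic_map_maps by blast
  have tV: "t x \<in> V0" "t' x \<in> V0" "t (t' x) = x" if "x \<in> V0" for x
    using homeomorphic_mapsD[OF t, unfolded ts] that by simp_all
  have close: "t x = x \<or> (\<exists>E\<in>\<B> - \<E>. x \<in> W E \<and> t x \<in> W E)" if "x \<in> V0" for x
    using t1 that unfolding maps_close_on_def by auto
  have close': "t' x = x \<or> (\<exists>E\<in>\<B> - \<E>. x \<in> W E \<and> t' x \<in> W E)" if "x \<in> V0" for x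
  proof -
    have "t' x \<in> V0" "t (t' x) = x" using tV[OF that] by simp_all
    then show ?thesis using close[of "t' x"] by auto
  qed
  have "homeomorphic_maps X X (\<lambda>x. if x \<in> V0 then t x else x) (\<lambda>x. if x \<in> V0 then t' x else x)"
  proof (rule homeomorphic_maps_extend[OF V0 t])
    fix a O' assume a: "a \<in> topspace X - V0" and O': "openin X O'" "a \<in> O'"
    have aX: "a \<in> topspace X" using a by blast
    have "\<exists>r>0. mball a r \<subseteq> O'" using O' top openin_mtopology[of O'] by simp
    then obtain r where r: "r > 0" "mball a r \<subseteq> O'" by blast
    define \<epsilon> where "\<epsilon> = r / 2"
    have e: "\<epsilon> > 0" using r by (simp add: \<epsilon>_def)
    have "openin X (mball a \<epsilon>)" using top openin_mball by metis
    moreover have "a \<in> mball a \<epsilon>" using aX e by simp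
    ultimately obtain N where N: "openin X N" "a \<in> N" "\<And>E. E \<in> \<B> \<Longrightarrow> E \<inter> N \<noteq> {} \<Longrightarrow> a \<in> E \<or> E \<subseteq> mball a \<epsilon>"
      using vanishing_local[OF X D v] by metis
    have "\<exists>s>0. mball a s \<subseteq> N" using N top openin_mtopology[of N] by simp
    then obtain s where s: "s > 0" "mball a s \<subseteq> N" by blast
    \<comment> \<open>\<open>2 * \<tau> \<le> s\<close> brings a point of \<open>E\<close> into
      \<open>N\<close>, so \<open>E\<close> lies in the ball of radius \<open>\<epsilon>\<close>
      about \<open>a\<close>; \<open>\<tau> \<le> \<epsilon>\<close> bounds the additional
      \<open>\<rho> E\<close>, and \<open>W E\<close> stays within
      \<open>r = 2 * \<epsilon>\<close>.\<close>
    define \<tau> where "\<tau> = min (s / 2) \<epsilon>"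
    have \<tau>: "\<tau> > 0" "2 * \<tau> \<le> s" "\<tau> \<le> \<epsilon>" using s e by (auto simp: \<tau>_def)
    have key: "W E \<subseteq> O'" if E: "E \<in> \<B> - \<E>" and x: "x \<in> W E" "x \<in> mball a \<tau>" for E x
    proof -
      obtain c where c: "c \<in> E" "d c x < \<rho> E" using x(1) Wsub(1)[of E] by (auto simp: enlarge_def)
      have EX: "E \<subseteq> topspace X" using decomposition_subset[OF D] E by blast
      have EV: "E \<subseteq> V0" using iff[of E] E by simp
      have xX: "x \<in> topspace X" and dx: "d a x < \<tau>" using x(2) by simp_all
      have cX: "c \<in> topspace X" using c EX by blast
      have "\<not> d c a < 2 * \<rho> E"
      proof
        assume "d c a < 2 * \<rho> E"
        then have "a \<in> enlarge X d E (2 * \<rho> E)" using aX c by (auto simp: enlarge_def)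
        moreover have "enlarge X d E (2 * \<rho> E) \<subseteq> V0" using \<rho> E by simp
        ultimately show False using a by blast
      qed
      moreover have "d c a \<le> d c x + d a x" using triangle'[OF cX xX aX] by simp
      ultimately have "\<rho> E < \<tau>" "d c a < 2 * \<tau>" using c dx by linarith+
      then have "c \<in> mball a s" using aX cX \<tau> by (simp add: commute[of a c])
      then have "E \<inter> N \<noteq> {}" using c(1) s(2) by blast
      moreover have "a \<notin> E" using a EV by blast
      ultimately have Eb: "E \<subseteq> mball a \<epsilon>" using N(3)[of E] E by simp
      show "W E \<subseteq> O'"
      proof
        fix w assume "w \<in> W E"
        then have "w \<in> enlarge X d E (\<rho> E)" using Wsub(1) by blast
        then obtain b where b: "b \<in> E" "d b w < \<rho> E" "w \<in> topspace X" by (auto simp: enlarge_def)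
        have bb: "b \<in> topspace X" "d a b < \<epsilon>" using b(1) Eb by auto
        have "d a w \<le> d a b + d b w" using triangle[OF aX bb(1) b(3)] .
        then have "d a w < r" using bb(2) b(2) \<open>\<rho> E < \<tau>\<close> \<tau> by (simp add: \<epsilon>_def)
        then show "w \<in> O'" using r aX b by auto
      qed
    qed
    show "\<exists>N. openin X N \<and> a \<in> N \<and> (\<forall>x\<in>V0 \<inter> N. t x \<in> O' \<and> t' x \<in> O')"
    proof (intro exI[of _ "mball a \<tau>"] conjI ballI)
      show "openin X (mball a \<tau>)" using top openin_mball by metis
      show "a \<in> mball a \<tau>" using aX \<tau> by simp
      fix x assume x: "x \<in> V0 \<inter> mball a \<tau>"
      have "mball a \<tau> \<subseteq> mball a r" using \<tau> e by (intro mball_subset_concentric) (simp add: \<epsilon>_def)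
      then have xO: "x \<in> O'" using x r by blast
      show "t x \<in> O'" using close[of x] key[of _ x] x xO by auto
      show "t' x \<in> O'" using close'[of x] key[of _ x] x xO by auto
    qed
  qed
  then show ?thesis
  proof (rule that)
    show "(if x \<in> V0 then t x else x) = x" if "x \<in> \<Union>\<E>" for x using that by (auto simp: V0_def)
    show "(if x \<in> V0 then t x else x) = x \<or> (\<exists>E\<in>\<B> - \<E>. x \<in> Q E \<and> (if x \<in> V0 then t x else x) \<in> Q E)"
      if "x \<in> topspace X" for x
    proof (cases "x \<in> V0")
      case True
      from close[OF this] show ?thesis
      proof
        assume "\<exists>E\<in>\<B> - \<E>. x \<in> W E \<and> t x \<in> W E"
        then obtain E where "E \<in> \<B> - \<E>" "x \<in> W E" "t x \<in> W E" by blast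
        then show ?thesis using Wsub(2)[of E] True by auto
      qed simp
    qed simp
    show "\<exists>V\<in>\<V>. (\<lambda>x. if x \<in> V0 then t x else x) ` E \<subseteq> V" if E: "E \<in> \<B> - \<E>" for E
    proof -
      have "t ` E \<in> {t ` D | D. D \<in> \<B> - \<E>}" using E by blast
      from bspec[OF t2[unfolded family_inscribed_def] this]
      obtain T where T: "T \<in> (\<lambda>V. V \<inter> V0) ` \<V>" "t ` E \<subseteq> T" by (rule bexE)
      obtain V where V: "V \<in> \<V>" "T = V \<inter> V0" using T(1) by blast
      have EV: "E \<subseteq> V0" using iff[of E] E by simp
      have "(\<lambda>x. if x \<in> V0 then t x else x) ` E = t ` E" using EV by (intro image_cong) auto
      then show ?thesis using V T(2) by (intro bexI[OF _ V(1)]) simp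
    qed
  qed
qed

text \<open>Each member has a radius \<open>e K\<close> within which no other member is met
  (\<open>far\<close>). Neighbourhoods of a quarter of that radius cannot both come close to a point
  unless both radii are small too, and then the members themselves come close to it, against
  discreteness.\<close>

lemma discrete_family_expansion:
  assumes d: "complete_metric_for X d" and F: "discrete_family X \<F>"
    and comp: "\<And>K. K \<in> \<F> \<Longrightarrow> compactin X K"
    and G: "\<And>K. K \<in> \<F> \<Longrightarrow> openin X (G K) \<and> K \<subseteq> G K"
  obtains S where "\<And>K. K \<in> \<F> \<Longrightarrow> openin X (S K) \<and> K \<subseteq> S K \<and> S K \<subseteq> G K"
    "\<And>x. x \<in> topspace X \<Longrightarrow> \<exists>N. openin X N \<and> x \<in> N \<and>
       (\<forall>K\<in>\<F>. \<forall>L\<in>\<F>. S K \<inter> N \<noteq> {} \<and> S L \<inter> N \<noteq> {} \<longrightarrow> K = L)"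
proof -
  interpret Metric_space "topspace X" d using complete_metric_forD[OF d] by simp
  have top: "mtopology = X" using complete_metric_forD(2)[OF d] .
  have X: "Hausdorff_space X"
    using complete_metric_for_imp_metrizable[OF d] metrizable_imp_Hausdorff_space by blast
  have FX: "K \<subseteq> topspace X" if "K \<in> \<F>" for K using comp[OF that] compactin_subset_topspace by blast
  have "\<forall>K\<in>\<F>. \<exists>e>0. enlarge X d K e \<subseteq> G K \<inter> (topspace X - \<Union>(\<F> - {K}))"
  proof
    fix K assume K: "K \<in> \<F>"
    have "closedin X (\<Union>(\<F> - {K}))"
    proof (rule discrete_family_closed_Union)
      show "discrete_family X (\<F> - {K})" using discrete_family_subset[OF F] by blast
      show "closedin X L" if "L \<in> \<F> - {K}" for L using compactin_imp_closedin[OF X] comp that by blast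
    qed
    then have "openin X (G K \<inter> (topspace X - \<Union>(\<F> - {K})))" using G[OF K] by (simp add: openin_Int closedin_def)
    moreover have "K \<subseteq> G K \<inter> (topspace X - \<Union>(\<F> - {K}))"
      using G[OF K] FX[OF K] discrete_family_disjoint[OF F K] by blast
    ultimately show "\<exists>e>0. enlarge X d K e \<subseteq> G K \<inter> (topspace X - \<Union>(\<F> - {K}))"
      using compact_enlarge[OF d comp[OF K]] by metis
  qed
  then obtain e where e: "\<forall>K\<in>\<F>. e K > 0 \<and> enlarge X d K (e K) \<subseteq> G K \<inter> (topspace X - \<Union>(\<F> - {K}))"
    by (rule bchoice[THEN exE])
  have far: "e K \<le> d a b" if "K \<in> \<F>" "L \<in> \<F>" "K \<noteq> L" "a \<in> K" "b \<in> L" for K L a b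
  proof (rule ccontr)
    assume "\<not> e K \<le> d a b"
    then have "d a b < e K" by simp
    moreover have "b \<in> topspace X" using that FX by blast
    ultimately have "b \<in> enlarge X d K (e K)" using \<open>a \<in> K\<close> unfolding enlarge_def by blast
    moreover have "enlarge X d K (e K) \<subseteq> topspace X - \<Union>(\<F> - {K})" using e \<open>K \<in> \<F>\<close> by blast
    ultimately show False using that by blast
  qed
  define S where "S K = enlarge X d K (e K / 4)" for K
  show ?thesis
  proof (rule that[of S])
    fix K assume K: "K \<in> \<F>"
    have "S K \<subseteq> enlarge X d K (e K)" unfolding S_def using e K by (intro enlarge_mono) auto
    then show "openin X (S K) \<and> K \<subseteq> S K \<and> S K \<subseteq> G K"
      using openin_enlarge[OF d FX[OF K]] subset_enlarge[OF d FX[OF K]] e K unfolding S_def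
      by (metis Int_subset_iff order_trans zero_less_divide_iff zero_less_numeral)
  next
    fix x assume x: "x \<in> topspace X"
    obtain N where N: "openin X N" "x \<in> N"
      "\<And>F G. F \<in> \<F> \<Longrightarrow> G \<in> \<F> \<Longrightarrow> F \<inter> N \<noteq> {} \<Longrightarrow> G \<inter> N \<noteq> {} \<Longrightarrow> F = G"
      using discrete_familyE[OF F x] by metis
    have "\<exists>s>0. mball x s \<subseteq> N" using N top openin_mtopology[of N] by simp
    then obtain r where r: "r > 0" "mball x r \<subseteq> N" by blast
    \<comment> \<open>If both neighbourhoods meet the \<open>\<epsilon>\<close>-ball, then
      \<open>max (e K) (e L) \<le> d a b < 2 * \<epsilon> + (e K + e L) / 4\<close>, so both radii
      are below \<open>4 * \<epsilon>\<close> and both members meet the ball of radius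
      \<open>2 * \<epsilon>\<close>; the 10 is a generous bound.\<close>
    define \<epsilon> where "\<epsilon> = r / 10"
    have \<epsilon>: "\<epsilon> > 0" "r = 10 * \<epsilon>" using r by (simp_all add: \<epsilon>_def)
    have "K = L" if KL: "K \<in> \<F>" "L \<in> \<F>" "S K \<inter> mball x \<epsilon> \<noteq> {}" "S L \<inter> mball x \<epsilon> \<noteq> {}" for K L
    proof (rule ccontr)
      assume n: "K \<noteq> L"
      obtain u a where u: "u \<in> topspace X" "d x u < \<epsilon>" and a: "a \<in> K" "d a u < e K / 4"
        using KL(3) by (auto simp: S_def enlarge_def)
      obtain v b where v: "v \<in> topspace X" "d x v < \<epsilon>" and b: "b \<in> L" "d b v < e L / 4"
        using KL(4) by (auto simp: S_def enlarge_def)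
      have ab: "a \<in> topspace X" "b \<in> topspace X" using a b FX KL by blast+
      have 1: "e K \<le> d a b" "e L \<le> d a b"
        using far[OF KL(1,2) n a(1) b(1)] far[OF KL(2,1) n[symmetric] b(1) a(1)] by (simp_all add: commute)
      have xa: "d x a < \<epsilon> + e K / 4" using triangle'[OF x u(1) ab(1)] u(2) a(2) by simp
      have xb: "d x b < \<epsilon> + e L / 4" using triangle'[OF x v(1) ab(2)] v(2) b(2) by simp
      have "d a b \<le> d x a + d x b" using triangle''[OF ab(1) x ab(2)] .
      moreover have "e K > 0" "e L > 0" using e KL by auto
      ultimately have "e K < 10 * \<epsilon>" "e L < 10 * \<epsilon>" using 1 xa xb \<epsilon>(1) by linarith+
      then have "a \<in> mball x r" "b \<in> mball x r" using xa xb x ab \<epsilon> by auto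
      then have "K \<inter> N \<noteq> {}" "L \<inter> N \<noteq> {}" using r a b by blast+
      then show False using N(3)[OF KL(1,2)] n by blast
    qed
    moreover have "openin X (mball x \<epsilon>)" using top openin_mball by metis
    moreover have "x \<in> mball x \<epsilon>" using x \<epsilon> by simp
    ultimately show "\<exists>N. openin X N \<and> x \<in> N \<and>
       (\<forall>K\<in>\<F>. \<forall>L\<in>\<F>. S K \<inter> N \<noteq> {} \<and> S L \<inter> N \<noteq> {} \<longrightarrow> K = L)"
      by (intro exI[of _ "mball x \<epsilon>"] conjI ballI impI) auto
  qed
qed

section \<open>Moving a discrete family of sets onto elements of a decomposition\<close>

lemma tame_decompositionD:
  assumes "tame_decomposition X \<K> \<D>"
  shows "decomposition X \<D>" "vanishing X \<D>" "strongly_shrinkable X \<D>" "nondegenerate \<D> \<subseteq> \<K>"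
  using assms by (simp_all add: tame_decomposition_def)

lemma tame_family_image:
  assumes "tame_family X \<K>" "homeomorphic_maps X X h k" "A \<in> \<K>"
  shows "h ` A \<in> \<K>"
  using assms(1,3) homeomorphic_maps_imp_map[OF assms(2)]
  unfolding tame_family_def ambiently_invariant_def by blast

lemma forth_step:
  assumes d: "complete_metric_for X d" and K: "tame_family X \<K>"
    and B: "tame_decomposition X \<K> \<B>" and dn: "dense_decomposition X \<B>"
    and sub: "\<E> \<subseteq> \<B>" and cl: "closedin X (\<Union>\<E>)"
    and CK: "\<C> \<subseteq> \<K>" and disc: "discrete_family X \<C>"
    and disj: "\<And>C. C \<in> \<C> \<Longrightarrow> C \<inter> \<Union>\<E> = {}"
    and G: "\<And>C. C \<in> \<C> \<Longrightarrow> openin X (G C) \<and> C \<subseteq> G C"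
    and Q: "\<And>E. E \<in> \<B> - \<E> \<Longrightarrow> openin X (Q E) \<and> E \<subseteq> Q E" and V: "open_cover X \<V>"
  obtains l l' r r' where "homeomorphic_maps X X l l'" "homeomorphic_maps X X r r'"
    "\<And>C. C \<in> \<C> \<Longrightarrow> r' ` l ` C \<in> nondegenerate \<B>"
    "\<And>x. x \<in> \<Union>\<E> \<Longrightarrow> l x = x" "\<And>x. x \<in> \<Union>\<E> \<Longrightarrow> r x = x"
    "\<And>x. x \<in> topspace X \<Longrightarrow> l x = x \<or> (\<exists>C\<in>\<C>. x \<in> G C \<and> l x \<in> G C)"
    "\<And>x. x \<in> topspace X \<Longrightarrow> r x = x \<or> (\<exists>E\<in>\<B> - \<E>. x \<in> Q E \<and> r x \<in> Q E)"
    "\<And>E. E \<in> \<B> - \<E> \<Longrightarrow> \<exists>V\<in>\<V>. r ` E \<subseteq> V"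
proof -
  note BD = tame_decompositionD[OF B]
  have X: "metrizable_space X" using complete_metric_for_imp_metrizable[OF d] .
  have Hd: "Hausdorff_space X" using metrizable_imp_Hausdorff_space[OF X] .
  have comp: "compactin X C" if "C \<in> \<C>" for C using that CK K unfolding tame_family_def by blast
  have CX: "C \<subseteq> topspace X" if "C \<in> \<C>" for C using compactin_subset_topspace[OF comp[OF that]] .
  define V0 where "V0 = topspace X - \<Union>\<E>"
  have V0: "openin X V0" using cl by (simp add: V0_def closedin_def)
  have G': "openin X (G C \<inter> V0) \<and> C \<subseteq> G C \<inter> V0" if C: "C \<in> \<C>" for C
  proof
    show "openin X (G C \<inter> V0)" using G[OF C] V0 by (simp add: openin_Int)
    show "C \<subseteq> G C \<inter> V0" using G[OF C] CX[OF C] disj[OF C] by (auto simp: V0_def)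
  qed
  obtain S where S: "\<And>C. C \<in> \<C> \<Longrightarrow> openin X (S C) \<and> C \<subseteq> S C \<and> S C \<subseteq> G C \<inter> V0"
    and Sd: "\<And>x. x \<in> topspace X \<Longrightarrow> \<exists>N. openin X N \<and> x \<in> N \<and>
       (\<forall>K\<in>\<C>. \<forall>L\<in>\<C>. S K \<inter> N \<noteq> {} \<and> S L \<inter> N \<noteq> {} \<longrightarrow> K = L)"
    using discrete_family_expansion[OF d disc comp G'] by metis
  have SX: "S C \<subseteq> topspace X" if "C \<in> \<C>" for C using S[OF that] openin_subset by blast
  have Suniq: "C = C'" if "C \<in> \<C>" "C' \<in> \<C>" "x \<in> S C" "x \<in> S C'" for C C' x
  proof -
    have "x \<in> topspace X" using SX that by blast
    from Sd[OF this] obtain N where "openin X N \<and> x \<in> N \<and>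
       (\<forall>K\<in>\<C>. \<forall>L\<in>\<C>. S K \<inter> N \<noteq> {} \<and> S L \<inter> N \<noteq> {} \<longrightarrow> K = L)" by (rule exE)
    then show ?thesis using that by blast
  qed
  have clC: "closedin X (\<Union>\<C>)"
    using discrete_family_closed_Union[OF disc] compactin_imp_closedin[OF Hd comp] by blast
  \<comment> \<open>Every member of this refinement that meets some \<open>C\<close> lies in
    \<open>S C\<close>, so a shrunken element that meets \<open>C\<close> is contained in
    \<open>S C\<close>.\<close>
  define \<V>' where "\<V>' = {V \<inter> S C | V C. V \<in> \<V> \<and> C \<in> \<C>} \<union> {V - \<Union>\<C> | V. V \<in> \<V>}"
  have V': "open_cover X \<V>'"
    unfolding open_cover_def
  proof
    have "openin X V" if "V \<in> \<V>" for V using V that by (simp add: open_cover_def)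
    then show "\<forall>U\<in>\<V>'. openin X U" using S clC unfolding \<V>'_def by (auto intro: openin_Int openin_diff)
    then have "\<Union>\<V>' \<subseteq> topspace X" using openin_subset by blast
    moreover have "topspace X \<subseteq> \<Union>\<V>'"
    proof
      fix x assume "x \<in> topspace X"
      then obtain V where V: "V \<in> \<V>" "x \<in> V" using V by (auto simp: open_cover_def)
      show "x \<in> \<Union>\<V>'"
      proof (cases "x \<in> \<Union>\<C>")
        case True
        then obtain C where C: "C \<in> \<C>" "x \<in> C" by blast
        then have "x \<in> V \<inter> S C" using S V by blast
        moreover have "V \<inter> S C \<in> \<V>'" using V C unfolding \<V>'_def by blast
        ultimately show ?thesis by blast
      next
        case False
        then have "x \<in> V - \<Union>\<C>" using V by blast
        moreover have "V - \<Union>\<C> \<in> \<V>'" using V unfolding \<V>'_def by blast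
        ultimately show ?thesis by blast
      qed
    qed
    ultimately show "\<Union>\<V>' = topspace X" by blast
  qed
  obtain r r' where r: "homeomorphic_maps X X r r'" and r1: "\<And>x. x \<in> \<Union>\<E> \<Longrightarrow> r x = x"
    and r2: "\<And>x. x \<in> topspace X \<Longrightarrow> r x = x \<or> (\<exists>E\<in>\<B> - \<E>. x \<in> Q E \<and> r x \<in> Q E)"
    and r3: "\<And>E. E \<in> \<B> - \<E> \<Longrightarrow> \<exists>V\<in>\<V>'. r ` E \<subseteq> V"
    using shrink_off[OF d BD(1,2,3) sub cl Q V'] by metis
  note rD = homeomorphic_mapsD[OF r]
  note r' = homeomorphic_maps_sym'[OF r]
  \<comment> \<open>\<open>P C\<close> is the union of the shrunken elements inside
    \<open>S C\<close>, an open set around \<open>C\<close>. It contains every shrunken element that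
    it meets, so a target engulfing a neighbourhood of one of its points still lies in the support
    region.\<close>
  define T where "T C = saturated_interior \<B> (r' ` S C)" for C
  define P where "P C = r ` T C" for C
  have Top: "openin X (T C)" if "C \<in> \<C>" for C unfolding T_def
    using openin_saturated_interior[OF X BD(1,2)] homeomorphic_maps_openin_image[OF r'] S[OF that] by blast
  have Pop: "openin X (P C)" if "C \<in> \<C>" for C unfolding P_def
    using homeomorphic_maps_openin_image[OF r Top[OF that]] .
  have rr'S: "r ` r' ` S C = S C" if "C \<in> \<C>" for C
    using homeomorphic_maps_image_image[OF r' SX[OF that]] .
  have TS: "T C \<subseteq> r' ` S C" for C unfolding T_def by (rule saturated_interior_subset)
  have PS: "P C \<subseteq> S C" if "C \<in> \<C>" for C
    using image_mono[OF TS[of C], of r] rr'S[OF that] unfolding P_def by simp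
  have CP: "C \<subseteq> P C" if C: "C \<in> \<C>" for C
  proof
    fix z assume z: "z \<in> C"
    have zX: "z \<in> topspace X" using CX[OF C] z by blast
    note w = rD(2)[OF zX] rD(4)[OF zX]
    note E = decomp_map_in[OF BD(1) w(1)]
    let ?E = "decomp_map \<B> (r' z)"
    have EX: "?E \<subseteq> topspace X" using decomposition_subset[OF BD(1) E(1)] .
    have "?E \<notin> \<E>"
    proof
      assume "?E \<in> \<E>"
      then have "r' z \<in> \<Union>\<E>" using E by blast
      then have "z \<in> \<Union>\<E>" using r1[of "r' z"] w by simp
      then show False using disj[OF C] z by blast
    qed
    then obtain V where V: "V \<in> \<V>'" "r ` ?E \<subseteq> V" using r3[of ?E] E by blast
    have "z \<in> r ` ?E" using E(2) w(2) by (metis imageI)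
    then have zV: "z \<in> V" using V by blast
    have "V \<subseteq> S C"
      using V(1) unfolding \<V>'_def
    proof
      assume "V \<in> {V \<inter> S C | V C. V \<in> \<V> \<and> C \<in> \<C>}"
      then obtain V1 C1 where 1: "V = V1 \<inter> S C1" "C1 \<in> \<C>" by blast
      then have "z \<in> S C1" "z \<in> S C" using zV z S[OF C] by auto
      then have "C1 = C" using Suniq 1 C by blast
      then show ?thesis using 1 by blast
    next
      assume "V \<in> {V - \<Union>\<C> | V. V \<in> \<V>}"
      then have "z \<notin> \<Union>\<C>" using zV by blast
      then show ?thesis using z C by blast
    qed
    then have "r ` ?E \<subseteq> S C" using V by blast
    from image_mono[OF this, of r'] have "?E \<subseteq> r' ` S C" using homeomorphic_maps_image_image[OF r EX] by simp
    then have "?E \<subseteq> T C" unfolding T_def using subset_saturated_interior[OF E(1)] by blast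
    then show "z \<in> P C" unfolding P_def using \<open>z \<in> r ` ?E\<close> by blast
  qed
  have NK: "(`) r ` nondegenerate \<B> \<subseteq> \<K>"
    using tame_family_image[OF K r] BD(4) by blast
  \<comment> \<open>\<open>m\<close> is a homeomorphism paired with its inverse, so that one choice
    function serves for both.\<close>
  have "\<forall>C\<in>\<C>. \<exists>m. homeomorphic_maps X X (fst m) (snd m) \<and>
    (\<forall>x\<in>topspace X - P C. fst m x = x) \<and> fst m ` C \<in> (`) r ` nondegenerate \<B>"
  proof
    fix C assume C: "C \<in> \<C>"
    have dich: "\<exists>E\<in>(`) r ` nondegenerate \<B>. E \<subseteq> P C \<and> (E \<subseteq> U \<or> (\<exists>N. openin X N \<and> y \<in> N \<and> N \<subseteq> E))"
      if y: "y \<in> P C" and U: "openin X U" "y \<in> U" "U \<subseteq> P C" for y U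
    proof -
      have UX: "U \<subseteq> topspace X" using U openin_subset by blast
      then have yX: "y \<in> topspace X" using U by blast
      have "openin X (r' ` U)" using homeomorphic_maps_openin_image[OF r' U(1)] .
      moreover have "r' y \<in> r' ` U" using U by blast
      ultimately obtain E where E: "E \<in> nondegenerate \<B>"
          "E \<subseteq> r' ` U \<or> (\<exists>N. openin X N \<and> r' y \<in> N \<and> N \<subseteq> E)"
        using dense_vanishing_dichotomy[OF X BD(1,2) dn] by metis
      have EB: "E \<in> \<B>" using E by (simp add: nondegenerate_def)
      from E(2) show ?thesis
      proof
        assume "E \<subseteq> r' ` U"
        from image_mono[OF this, of r] have "r ` E \<subseteq> U" using homeomorphic_maps_image_image[OF r' UX] by simp
        then show ?thesis using E(1) U(3) by blast
      next
        assume "\<exists>N. openin X N \<and> r' y \<in> N \<and> N \<subseteq> E"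
        then obtain N where N: "openin X N" "r' y \<in> N" "N \<subseteq> E" by blast
        obtain w where w: "w \<in> T C" "y = r w" using y unfolding P_def by blast
        have "w \<in> topspace X" using w Top[OF C] openin_subset by blast
        then have "r' y = w" using rD(3) w by simp
        then have "E \<inter> T C \<noteq> {}" using N w by blast
        then have "E \<subseteq> T C"
          using saturated_meets[OF BD(1) saturated_saturated_interior EB] unfolding T_def by blast
        then have "r ` E \<subseteq> P C" unfolding P_def by blast
        moreover have "openin X (r ` N)" using homeomorphic_maps_openin_image[OF r N(1)] .
        moreover have "y \<in> r ` N" using N(2) rD(4)[OF yX] by (metis imageI)
        moreover have "r ` N \<subseteq> r ` E" using N by blast
        ultimately show ?thesis using E(1) by blast
      qed
    qed
    have "C \<in> \<K>" using C CK by blast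
    show "\<exists>m. homeomorphic_maps X X (fst m) (snd m) \<and>
      (\<forall>x\<in>topspace X - P C. fst m x = x) \<and> fst m ` C \<in> (`) r ` nondegenerate \<B>"
    proof (rule single_shift[OF K Pop[OF C] \<open>C \<in> \<K>\<close> CP[OF C] NK dich])
      fix l l' assume "homeomorphic_maps X X l l'" "\<And>x. x \<in> topspace X - P C \<Longrightarrow> l x = x"
        "l ` C \<in> (`) r ` nondegenerate \<B>"
      then show ?thesis by (intro exI[of _ "(l, l')"]) simp
    qed
  qed
  then obtain m where m: "\<forall>C\<in>\<C>. homeomorphic_maps X X (fst (m C)) (snd (m C)) \<and>
    (\<forall>x\<in>topspace X - P C. fst (m C) x = x) \<and> fst (m C) ` C \<in> (`) r ` nondegenerate \<B>"
    by (rule bchoice[THEN exE])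
  have PX: "P C \<subseteq> topspace X" if "C \<in> \<C>" for C using Pop[OF that] openin_subset by blast
  have m1: "homeomorphic_maps X X (fst (m C)) (snd (m C))" if "C \<in> \<C>" for C using m that by simp
  have m2: "fst (m C) x = x" if "C \<in> \<C>" "x \<in> topspace X - P C" for C x using m that by simp
  have m3: "fst (m C) ` C \<in> (`) r ` nondegenerate \<B>" if "C \<in> \<C>" for C using m that by simp
  have Pd: "\<exists>N. openin X N \<and> x \<in> N \<and> (\<forall>K\<in>\<C>. \<forall>L\<in>\<C>. P K \<inter> N \<noteq> {} \<and> P L \<inter> N \<noteq> {} \<longrightarrow> K = L)"
    if x: "x \<in> topspace X" for x
  proof -
    obtain N where N: "openin X N \<and> x \<in> N \<and>
       (\<forall>K\<in>\<C>. \<forall>L\<in>\<C>. S K \<inter> N \<noteq> {} \<and> S L \<inter> N \<noteq> {} \<longrightarrow> K = L)" using Sd[OF x] by (rule exE)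
    have KL: "K = L" if "K \<in> \<C>" "L \<in> \<C>" "P K \<inter> N \<noteq> {}" "P L \<inter> N \<noteq> {}" for K L
    proof -
      have "S K \<inter> N \<noteq> {}" "S L \<inter> N \<noteq> {}" using PS that by blast+
      then show ?thesis using N that by simp
    qed
    show ?thesis
    proof (intro exI[of _ N] conjI ballI impI)
      fix K L assume "K \<in> \<C>" "L \<in> \<C>" "P K \<inter> N \<noteq> {} \<and> P L \<inter> N \<noteq> {}"
      then show "K = L" using KL by simp
    qed (use N in simp_all)
  qed
  show ?thesis
  proof (rule homeomorphic_maps_glue[of \<C> X "\<lambda>C. fst (m C)" "\<lambda>C. snd (m C)" P, OF m1 PX m2 Pd])
    fix L L' assume L: "homeomorphic_maps X X L L'"
      and L1: "\<And>C x. C \<in> \<C> \<Longrightarrow> x \<in> P C \<Longrightarrow> L x = fst (m C) x \<and> L x \<in> P C"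
      and L2: "\<And>x. (\<And>C. C \<in> \<C> \<Longrightarrow> x \<notin> P C) \<Longrightarrow> L x = x"
    have PG: "P C \<subseteq> G C" "P C \<subseteq> V0" if "C \<in> \<C>" for C using PS[OF that] S[OF that] by blast+
    show thesis
    proof (rule that[OF L r])
      show "r' ` L ` C \<in> nondegenerate \<B>" if C: "C \<in> \<C>" for C
      proof -
        have "L ` C = fst (m C) ` C" using L1[OF C] CP[OF C] by (intro image_cong) auto
        then obtain E where E: "E \<in> nondegenerate \<B>" "L ` C = r ` E" using m3[OF C] by auto
        then have "E \<subseteq> topspace X" using decomposition_subset[OF BD(1)] by (simp add: nondegenerate_def)
        then show ?thesis using E homeomorphic_maps_image_image[OF r] by simp
      qed
      show "L x = x" if "x \<in> \<Union>\<E>" for x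
      proof (rule L2)
        show "x \<notin> P C" if "C \<in> \<C>" for C using PG(2)[OF that] \<open>x \<in> \<Union>\<E>\<close> by (auto simp: V0_def)
      qed
      show "L x = x \<or> (\<exists>C\<in>\<C>. x \<in> G C \<and> L x \<in> G C)" for x
      proof (cases "\<exists>C\<in>\<C>. x \<in> P C")
        case True
        then obtain C where C: "C \<in> \<C>" "x \<in> P C" by blast
        then show ?thesis using L1[OF C] PG(1)[OF C(1)] by blast
      next
        case False then show ?thesis using L2[of x] by blast
      qed
      show "\<exists>V\<in>\<V>. r ` E \<subseteq> V" if E: "E \<in> \<B> - \<E>" for E
      proof -
        obtain V where V: "V \<in> \<V>'" "r ` E \<subseteq> V" using r3[OF E] by blast
        then have "\<exists>V1\<in>\<V>. V \<subseteq> V1" unfolding \<V>'_def by blast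
        then show ?thesis using V(2) by (meson order_trans)
      qed
    qed (use r1 r2 in simp_all)
  qed
qed

section \<open>Back and forth\<close>

text \<open>Containment in an open ball rather than a bound on the diameter: the ball is itself
  open, so smallness passes to a neighbourhood with the same radius (\<open>small_nbhd\<close>);
  distances are then bounded by twice the radius. The centre may lie outside the set.\<close>

definition small :: "'a topology \<Rightarrow> ('a \<Rightarrow> 'a \<Rightarrow> real) \<Rightarrow> real \<Rightarrow> 'a set \<Rightarrow> bool" where
  "small X d r S \<longleftrightarrow> (\<exists>x\<in>topspace X. \<forall>y\<in>S. y \<in> topspace X \<and> d x y < r)"

text \<open>The elements of \<open>\<M>\<close> are already matched by \<open>h\<close> and will never be moved again. The radii
  \<open>a\<close>, \<open>a'\<close> bound the unmatched elements of \<open>\<D>\<close> and their images, \<open>b\<close>, \<open>b'\<close> those of \<open>\<E>\<close>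
  and their preimages.\<close>

definition partial_matching where
  "partial_matching X \<D> \<E> d1 d2 h k \<M> a a' b b' \<longleftrightarrow>
     homeomorphic_maps X X h k \<and> \<M> \<subseteq> nondegenerate \<D> \<and> (`) h ` \<M> \<subseteq> nondegenerate \<E> \<and>
     closedin X (\<Union>\<M>) \<and>
     (\<forall>D\<in>\<D> - \<M>. small X d1 a D \<and> small X d2 a' (h ` D)) \<and>
     (\<forall>E\<in>\<E> - (`) h ` \<M>. small X d2 b E \<and> small X d1 b' (k ` E))"

lemma small_nbhd:
  assumes d1: "complete_metric_for X d1" and d2: "complete_metric_for X d2"
    and h: "homeomorphic_maps X X h k" and S: "small X d2 a S" "small X d1 b (k ` S)"
  shows "\<exists>G. openin X G \<and> S \<subseteq> G \<and> small X d2 a G \<and> small X d1 b (k ` G)"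
proof -
  interpret A: Metric_space "topspace X" d1 using complete_metric_forD[OF d1] by simp
  interpret B: Metric_space "topspace X" d2 using complete_metric_forD[OF d2] by simp
  obtain x where x: "x \<in> topspace X" "\<forall>y\<in>S. y \<in> topspace X \<and> d2 x y < a" using S(1) by (auto simp: small_def)
  obtain z where z: "z \<in> topspace X" "\<forall>y\<in>k ` S. y \<in> topspace X \<and> d1 z y < b" using S(2) by (auto simp: small_def)
  let ?G = "B.mball x a \<inter> {y \<in> topspace X. k y \<in> A.mball z b}"
  have "openin X (B.mball x a)" using B.openin_mball[of x a] complete_metric_forD(2)[OF d2] by simp
  moreover have "openin X {y \<in> topspace X. k y \<in> A.mball z b}"
  proof (rule openin_continuous_map_preimage)
    show "continuous_map X X k" using h by (simp add: homeomorphic_maps_def)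
    show "openin X (A.mball z b)" using A.openin_mball[of z b] complete_metric_forD(2)[OF d1] by simp
  qed
  ultimately have "openin X ?G" by (rule openin_Int)
  moreover have "S \<subseteq> ?G" using x z by auto
  moreover have "small X d2 a ?G" unfolding small_def using x by (intro bexI[of _ x]) auto
  moreover have "small X d1 b (k ` ?G)" unfolding small_def using z by (intro bexI[of _ z]) auto
  ultimately show ?thesis by blast
qed

lemma small_dist:
  assumes "complete_metric_for X d" "small X d r S" "x \<in> S" "y \<in> S"
  shows "d x y \<le> 2 * r"
proof -
  interpret Metric_space "topspace X" d using complete_metric_forD[OF assms(1)] by simp
  obtain z where z: "z \<in> topspace X" "\<forall>y\<in>S. y \<in> topspace X \<and> d z y < r" using assms(2) by (auto simp: small_def)
  then have "d x y \<le> d z x + d z y" using assms(3,4) by (intro triangle'') auto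
  moreover have "d z x < r" "d z y < r" using z assms by auto
  ultimately show ?thesis by linarith
qed

text \<open>The invariant is symmetric, so the back step is the forth step for the inverse
  homeomorphism, with \<open>d1\<close>, \<open>d2\<close> and the pairs of radii exchanged.\<close>

lemma partial_matching_swap:
  assumes pm: "partial_matching X \<D> \<E> d1 d2 h k \<M> a a' b b'" and D: "decomposition X \<D>"
  shows "partial_matching X \<E> \<D> d2 d1 k h ((`) h ` \<M>) b b' a a'"
    "(`) k ` (`) h ` \<M> = \<M>"
proof -
  have h: "homeomorphic_maps X X h k" and M: "\<M> \<subseteq> nondegenerate \<D>" and cl: "closedin X (\<Union>\<M>)"
    using pm by (simp_all add: partial_matching_def)
  have "k ` h ` D = D" if "D \<in> \<M>" for D
    using homeomorphic_maps_image_image[OF h] decomposition_subset[OF D] M that by (auto simp: nondegenerate_def)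
  then show eq: "(`) k ` (`) h ` \<M> = \<M>" by (force simp: image_image)
  have "\<Union>((`) h ` \<M>) = h ` (\<Union>\<M>)" by blast
  then have "closedin X (\<Union>((`) h ` \<M>))" using homeomorphic_maps_closedin_image[OF h cl] by simp
  then show "partial_matching X \<E> \<D> d2 d1 k h ((`) h ` \<M>) b b' a a'"
    using pm homeomorphic_maps_sym'[OF h] unfolding partial_matching_def eq by simp
qed

text \<open>The new map is \<open>h1 = r' \<circ> l \<circ> h\<close>, with \<open>l\<close>
  confined to sets of \<open>d2\<close>-radius \<open>a'\<close> and \<open>r\<close> to sets of
  \<open>d2\<close>-radius \<open>b\<close>; hence the displacement \<open>2 * a' + 2 * b\<close>
  and the image radius \<open>a' + (2 * a' + 2 * b)\<close>. For the inverse
  \<open>k1 = k \<circ> l' \<circ> r\<close> the same sets, mapped by \<open>k\<close>, have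
  \<open>d1\<close>-radii \<open>a\<close> and \<open>b'\<close>. Preimages of the elements of
  \<open>\<E>\<close> get the fresh radius \<open>\<delta> + 2 * a\<close>, in which the old
  \<open>b'\<close> no longer occurs: this keeps the radii from growing over the rounds.\<close>

lemma partial_matching_step:
  assumes d1: "complete_metric_for X d1" and d2: "complete_metric_for X d2" and K: "tame_family X \<K>"
    and D: "tame_decomposition X \<K> \<D>"
    and E: "tame_decomposition X \<K> \<E>" and dn: "dense_decomposition X \<E>"
    and pm: "partial_matching X \<D> \<E> d1 d2 h k \<M> a a' b b'"
    and pos: "0 \<le> a" "0 \<le> a'" "0 \<le> b" "0 \<le> b'" "0 < \<epsilon>" "0 < \<delta>"
  obtains h1 k1 \<M>1 where
    "partial_matching X \<D> \<E> d1 d2 h1 k1 \<M>1 \<epsilon> (3 * a' + 2 * b) b (\<delta> + 2 * a)"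
    "\<M> \<subseteq> \<M>1" "\<And>x. x \<in> \<Union>\<M> \<Longrightarrow> h1 x = h x"
    "\<And>x. x \<in> topspace X \<Longrightarrow> d2 (h x) (h1 x) \<le> 2 * a' + 2 * b"
    "\<And>x. x \<in> topspace X \<Longrightarrow> d1 (k x) (k1 x) \<le> 2 * a + 2 * b'"
proof -
  interpret A: Metric_space "topspace X" d1 using complete_metric_forD[OF d1] by simp
  interpret B: Metric_space "topspace X" d2 using complete_metric_forD[OF d2] by simp
  note DD = tame_decompositionD[OF D] and ED = tame_decompositionD[OF E]
  have Hd: "Hausdorff_space X"
    using metrizable_imp_Hausdorff_space[OF complete_metric_for_imp_metrizable[OF d1]] .
  have h: "homeomorphic_maps X X h k" and M: "\<M> \<subseteq> nondegenerate \<D>"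
    and hM: "(`) h ` \<M> \<subseteq> nondegenerate \<E>" and cl: "closedin X (\<Union>\<M>)"
    and smD: "\<And>D. D \<in> \<D> - \<M> \<Longrightarrow> small X d1 a D \<and> small X d2 a' (h ` D)"
    and smE: "\<And>E. E \<in> \<E> - (`) h ` \<M> \<Longrightarrow> small X d2 b E \<and> small X d1 b' (k ` E)"
    using pm by (simp_all add: partial_matching_def)
  note hD = homeomorphic_mapsD[OF h]
  have DX: "D \<subseteq> topspace X" if "D \<in> \<D>" for D using decomposition_subset[OF DD(1) that] .
  have kh: "k ` h ` D = D" if "D \<in> \<D>" for D using homeomorphic_maps_image_image[OF h DX[OF that]] .
  \<comment> \<open>Failing to fit into an \<open>\<epsilon>\<close>-ball makes these elements
    non-degenerate, hence members of \<open>\<K>\<close>, and vanishing for the cover by such balls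
    makes them discrete.\<close>
  define \<C>0 where "\<C>0 = {D \<in> \<D> - \<M>. \<not> small X d1 \<epsilon> D}"
  have disc0: "discrete_family X \<C>0"
  proof (rule discrete_family_subset)
    let ?U = "(\<lambda>x. A.mball x \<epsilon>) ` topspace X"
    have "open_cover X ?U"
      unfolding open_cover_def
    proof
      show "\<forall>U\<in>?U. openin X U" using A.openin_mball complete_metric_forD(2)[OF d1] by auto
      show "\<Union>?U = topspace X" using pos(5) A.mball_subset_mspace by force
    qed
    then show "discrete_family X {D \<in> \<D>. \<forall>U\<in>?U. \<not> D \<subseteq> U}" using DD(2) unfolding vanishing_def by blast
    show "\<C>0 \<subseteq> {D \<in> \<D>. \<forall>U\<in>?U. \<not> D \<subseteq> U}"
    proof
      fix D assume D: "D \<in> \<C>0"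
      have "\<not> D \<subseteq> A.mball x \<epsilon>" if "x \<in> topspace X" for x
      proof
        assume "D \<subseteq> A.mball x \<epsilon>"
        then have "small X d1 \<epsilon> D" unfolding small_def using that by (intro bexI[of _ x]) auto
        then show False using D by (simp add: \<C>0_def)
      qed
      then show "D \<in> {D \<in> \<D>. \<forall>U\<in>?U. \<not> D \<subseteq> U}" using D by (auto simp: \<C>0_def)
    qed
  qed
  have C0D: "\<C>0 \<subseteq> \<D>" by (auto simp: \<C>0_def)
  have C0n: "\<C>0 \<subseteq> nondegenerate \<D>"
  proof
    fix D assume D: "D \<in> \<C>0"
    then have DD': "D \<in> \<D>" "\<not> small X d1 \<epsilon> D" by (auto simp: \<C>0_def)
    then obtain x where x: "x \<in> D" using DD(1) by (auto simp: decomposition_def)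
    then have xX: "x \<in> topspace X" using DX DD' by blast
    have "\<exists>y\<in>D. \<not> (y \<in> topspace X \<and> d1 x y < \<epsilon>)" using DD'(2) xX unfolding small_def by blast
    then obtain y where y: "y \<in> D" "\<not> (y \<in> topspace X \<and> d1 x y < \<epsilon>)" by blast
    then have "y \<noteq> x" using xX pos(5) by auto
    then show "D \<in> nondegenerate \<D>" using x y DD' by (auto simp: nondegenerate_def)
  qed
  define \<C> where "\<C> = (`) h ` \<C>0"
  define \<E>' where "\<E>' = (`) h ` \<M>"
  have CK: "\<C> \<subseteq> \<K>" unfolding \<C>_def using tame_family_image[OF K h] C0n DD(4) by blast
  have disc: "discrete_family X \<C>" unfolding \<C>_def using discrete_family_image[OF h disc0] DX C0D by blast
  have UE': "\<Union>\<E>' = h ` \<Union>\<M>" by (auto simp: \<E>'_def)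
  have clE: "closedin X (\<Union>\<E>')" using homeomorphic_maps_closedin_image[OF h cl] UE' by simp
  have subE: "\<E>' \<subseteq> \<E>" using hM by (auto simp: \<E>'_def nondegenerate_def)
  have MD: "\<M> \<subseteq> \<D>" using M by (auto simp: nondegenerate_def)
  have disj: "C \<inter> \<Union>\<E>' = {}" if C: "C \<in> \<C>" for C
  proof (rule ccontr)
    assume "C \<inter> \<Union>\<E>' \<noteq> {}"
    then obtain z where z: "z \<in> C" "z \<in> h ` \<Union>\<M>" using UE' by blast
    obtain D x where Dx: "D \<in> \<C>0" "x \<in> D" "z = h x" using C z by (auto simp: \<C>_def)
    obtain D' x' where D': "D' \<in> \<M>" "x' \<in> D'" "z = h x'" using z by auto
    have "x \<in> topspace X" "x' \<in> topspace X" using Dx D' DX C0D MD by blast+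
    then have "x = x'" using hD(3) Dx D' by metis
    then have "D = D'" using decomposition_eqI[OF DD(1), of D D' x] Dx D' C0D MD by blast
    then show False using Dx D' by (auto simp: \<C>0_def)
  qed
  have "\<forall>C\<in>\<C>. \<exists>G. openin X G \<and> C \<subseteq> G \<and> small X d2 a' G \<and> small X d1 a (k ` G)"
  proof
    fix C assume "C \<in> \<C>"
    then obtain D where D: "D \<in> \<C>0" "C = h ` D" by (auto simp: \<C>_def)
    then have "small X d1 a D \<and> small X d2 a' (h ` D)" using smD by (auto simp: \<C>0_def)
    moreover have "k ` C = D" using kh[of D] D C0D by auto
    ultimately show "\<exists>G. openin X G \<and> C \<subseteq> G \<and> small X d2 a' G \<and> small X d1 a (k ` G)"
      using small_nbhd[OF d1 d2 h] D(2) by simp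
  qed
  then obtain G where G: "\<forall>C\<in>\<C>. openin X (G C) \<and> C \<subseteq> G C \<and> small X d2 a' (G C) \<and> small X d1 a (k ` G C)"
    by (rule bchoice[THEN exE])
  have "\<forall>E\<in>\<E> - \<E>'. \<exists>Q. openin X Q \<and> E \<subseteq> Q \<and> small X d2 b Q \<and> small X d1 b' (k ` Q)"
    using small_nbhd[OF d1 d2 h] smE by (simp add: \<E>'_def)
  then obtain Q where Q: "\<forall>E\<in>\<E> - \<E>'. openin X (Q E) \<and> E \<subseteq> Q E \<and> small X d2 b (Q E) \<and> small X d1 b' (k ` Q E)"
    by (rule bchoice[THEN exE])
  \<comment> \<open>Smallness is demanded of the preimages under \<open>k\<close>, in
    \<open>d1\<close>: the unmatched elements of \<open>\<E>\<close> are already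
    \<open>b\<close>-small in \<open>d2\<close>, and it is their preimages that need a better
    bound.\<close>
  define \<V> where "\<V> = {V. openin X V \<and> small X d1 \<delta> (k ` V)}"
  have V: "open_cover X \<V>"
    unfolding open_cover_def
  proof
    show op: "\<forall>U\<in>\<V>. openin X U" by (simp add: \<V>_def)
    have "topspace X \<subseteq> \<Union>\<V>"
    proof
      fix x assume x: "x \<in> topspace X"
      have "small X d2 1 {x}" "small X d1 \<delta> (k ` {x})"
        unfolding small_def using x hD(2)[OF x] pos(6)
        by (intro bexI[of _ x] bexI[of _ "k x"]; simp)+
      from small_nbhd[OF d1 d2 h this] show "x \<in> \<Union>\<V>" by (auto simp: \<V>_def)
    qed
    then show "\<Union>\<V> = topspace X" using op openin_subset by blast
  qed
  have G': "openin X (G C) \<and> C \<subseteq> G C" if "C \<in> \<C>" for C using G that by simp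
  have Q': "openin X (Q E) \<and> E \<subseteq> Q E" if "E \<in> \<E> - \<E>'" for E using Q that by simp
  show ?thesis
  proof (rule forth_step[OF d1 K E dn subE clE CK disc disj G' Q' V])
    fix l l' r r' assume l: "homeomorphic_maps X X l l'" and r: "homeomorphic_maps X X r r'"
      and lr1: "\<And>C. C \<in> \<C> \<Longrightarrow> r' ` l ` C \<in> nondegenerate \<E>"
      and l2: "\<And>x. x \<in> \<Union>\<E>' \<Longrightarrow> l x = x" and r2: "\<And>x. x \<in> \<Union>\<E>' \<Longrightarrow> r x = x"
      and l3: "\<And>x. x \<in> topspace X \<Longrightarrow> l x = x \<or> (\<exists>C\<in>\<C>. x \<in> G C \<and> l x \<in> G C)"
      and r3: "\<And>x. x \<in> topspace X \<Longrightarrow> r x = x \<or> (\<exists>E\<in>\<E> - \<E>'. x \<in> Q E \<and> r x \<in> Q E)"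
      and r4: "\<And>E. E \<in> \<E> - \<E>' \<Longrightarrow> \<exists>V\<in>\<V>. r ` E \<subseteq> V"
    note lD = homeomorphic_mapsD[OF l] and rD = homeomorphic_mapsD[OF r]
    have L: "d2 u (l u) \<le> 2 * a'" "d1 (k u) (k (l u)) \<le> 2 * a" if u: "u \<in> topspace X" for u
    proof -
      have "d2 u (l u) \<le> 2 * a' \<and> d1 (k u) (k (l u)) \<le> 2 * a"
        using l3[OF u]
      proof
        assume "l u = u"
        then show ?thesis using u hD(2)[OF u] pos by simp
      next
        assume "\<exists>C\<in>\<C>. u \<in> G C \<and> l u \<in> G C"
        then obtain C where C: "C \<in> \<C>" "u \<in> G C" "l u \<in> G C" by blast
        then have "small X d2 a' (G C)" "small X d1 a (k ` G C)" using G by simp_all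
        then show ?thesis using small_dist[OF d2] small_dist[OF d1] C by blast
      qed
      then show "d2 u (l u) \<le> 2 * a'" "d1 (k u) (k (l u)) \<le> 2 * a" by simp_all
    qed
    have R: "d2 u (r u) \<le> 2 * b" "d1 (k u) (k (r u)) \<le> 2 * b'" if u: "u \<in> topspace X" for u
    proof -
      have "d2 u (r u) \<le> 2 * b \<and> d1 (k u) (k (r u)) \<le> 2 * b'"
        using r3[OF u]
      proof
        assume "r u = u"
        then show ?thesis using u hD(2)[OF u] pos by simp
      next
        assume "\<exists>E\<in>\<E> - \<E>'. u \<in> Q E \<and> r u \<in> Q E"
        then obtain E where E: "E \<in> \<E> - \<E>'" "u \<in> Q E" "r u \<in> Q E" by blast
        then have "small X d2 b (Q E)" "small X d1 b' (k ` Q E)" using Q by simp_all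
        then show ?thesis using small_dist[OF d2] small_dist[OF d1] E by blast
      qed
      then show "d2 u (r u) \<le> 2 * b" "d1 (k u) (k (r u)) \<le> 2 * b'" by simp_all
    qed
    define h1 where "h1 x = r' (l (h x))" for x
    define k1 where "k1 y = k (l' (r y))" for y
    have h1k1: "homeomorphic_maps X X h1 k1"
      using homeomorphic_maps_compose'[OF h homeomorphic_maps_compose'[OF l homeomorphic_maps_sym'[OF r]]]
      unfolding h1_def[abs_def] k1_def[abs_def] .
    have mv2: "d2 (h x) (h1 x) \<le> 2 * a' + 2 * b" if x: "x \<in> topspace X" for x
    proof -
      note 1 = hD(1)[OF x]
      note 2 = lD(1)[OF 1]
      note 3 = rD(2)[OF 2]
      have "d2 (r' (l (h x))) (l (h x)) \<le> 2 * b" using R(1)[OF 3] rD(4)[OF 2] by simp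
      then show ?thesis using B.triangle'[OF 1 2 3] L(1)[OF 1] unfolding h1_def by linarith
    qed
    \<comment> \<open>\<open>l'\<close> moves \<open>u\<close> back along the displacement of
      \<open>l\<close> at \<open>l' u\<close>, so the estimate \<open>L\<close> serves for the
      inverse too.\<close>
    have l'mv: "d1 (k u) (k (l' u)) \<le> 2 * a" if u: "u \<in> topspace X" for u
      using L(2)[OF lD(2)[OF u]] lD(4)[OF u] A.commute by metis
    have mv1: "d1 (k y) (k1 y) \<le> 2 * a + 2 * b'" if y: "y \<in> topspace X" for y
    proof -
      note 1 = rD(1)[OF y]
      note 2 = lD(2)[OF 1]
      show ?thesis using A.triangle[OF hD(2)[OF y] hD(2)[OF 1] hD(2)[OF 2]] R(2)[OF y] l'mv[OF 1]
        unfolding k1_def by linarith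
    qed
    have eqM: "h1 x = h x" if x: "x \<in> \<Union>\<M>" for x
    proof -
      have u: "h x \<in> \<Union>\<E>'" unfolding UE' using x by (rule imageI)
      have "\<Union>\<M> \<subseteq> topspace X" using closedin_subset[OF cl] .
      then have "x \<in> topspace X" using x by (rule subsetD)
      note rD(3)[OF hD(1)[OF this]]
      then have "r' (h x) = h x" using r2[OF u] by simp
      then show ?thesis using l2[OF u] by (simp add: h1_def)
    qed
    have h1M: "(`) h1 ` \<M> = \<E>'"
      unfolding \<E>'_def
    proof (rule image_cong[OF refl])
      fix D assume "D \<in> \<M>" then show "h1 ` D = h ` D" using eqM by (intro image_cong) auto
    qed
    have h1C: "(`) h1 ` \<C>0 \<subseteq> nondegenerate \<E>"
    proof
      fix F assume "F \<in> (`) h1 ` \<C>0"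
      then obtain D where D: "D \<in> \<C>0" "F = h1 ` D" by blast
      then have "F = r' ` l ` (h ` D)" by (simp add: h1_def[abs_def] image_image)
      then show "F \<in> nondegenerate \<E>" using lr1 D by (simp add: \<C>_def)
    qed
    have pm1: "partial_matching X \<D> \<E> d1 d2 h1 k1 (\<M> \<union> \<C>0) \<epsilon> (3 * a' + 2 * b) b (\<delta> + 2 * a)"
      unfolding partial_matching_def
    proof (intro conjI ballI)
      show "homeomorphic_maps X X h1 k1" by (rule h1k1)
      show "\<M> \<union> \<C>0 \<subseteq> nondegenerate \<D>" using M C0n by blast
      have "(`) h1 ` \<M> \<subseteq> nondegenerate \<E>" unfolding h1M \<E>'_def by (rule hM)
      then show "(`) h1 ` (\<M> \<union> \<C>0) \<subseteq> nondegenerate \<E>" unfolding image_Un using h1C by (rule Un_least)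
      have "closedin X (\<Union>\<C>0)"
        using discrete_family_closed_Union[OF disc0] decomposition_closedin[OF Hd DD(1)] C0D by blast
      then show "closedin X (\<Union>(\<M> \<union> \<C>0))" using cl by (simp add: closedin_Un)
      fix D assume D: "D \<in> \<D> - (\<M> \<union> \<C>0)"
      then show "small X d1 \<epsilon> D" by (auto simp: \<C>0_def)
      have "small X d2 a' (h ` D)" using smD D by simp
      then obtain z where z: "z \<in> topspace X" "\<forall>y\<in>h ` D. y \<in> topspace X \<and> d2 z y < a'" by (auto simp: small_def)
      show "small X d2 (3 * a' + 2 * b) (h1 ` D)" unfolding small_def
      proof (intro bexI[OF _ z(1)] ballI)
        fix y assume "y \<in> h1 ` D"
        then obtain x where x: "x \<in> D" "y = h1 x" by blast
        then have xX: "x \<in> topspace X" using D DX by blast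
        have h1X: "h1 x \<in> topspace X" using homeomorphic_mapsD(1)[OF h1k1 xX] .
        have "d2 z (h x) < a'" using z x by simp
        then have "d2 z (h1 x) < 3 * a' + 2 * b"
          using B.triangle[OF z(1) hD(1)[OF xX] h1X] mv2[OF xX] by linarith
        then show "y \<in> topspace X \<and> d2 z y < 3 * a' + 2 * b" using h1X x by simp
      qed
    next
      fix F assume F: "F \<in> \<E> - (`) h1 ` (\<M> \<union> \<C>0)"
      then have F': "F \<in> \<E> - \<E>'" using h1M by blast
      then show "small X d2 b F" using smE by (simp add: \<E>'_def)
      obtain V where V: "V \<in> \<V>" "r ` F \<subseteq> V" using r4[OF F'] by blast
      then have "small X d1 \<delta> (k ` V)" by (simp add: \<V>_def)
      then obtain z where z: "z \<in> topspace X" "\<forall>y\<in>k ` V. y \<in> topspace X \<and> d1 z y < \<delta>" by (auto simp: small_def)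
      show "small X d1 (\<delta> + 2 * a) (k1 ` F)" unfolding small_def
      proof (intro bexI[OF _ z(1)] ballI)
        fix y assume "y \<in> k1 ` F"
        then obtain x where x: "x \<in> F" "y = k1 x" by blast
        then have xX: "x \<in> topspace X" using F decomposition_subset[OF ED(1)] by blast
        note 1 = rD(1)[OF xX]
        have k1X: "k1 x \<in> topspace X" using homeomorphic_mapsD(2)[OF h1k1 xX] .
        have "k (r x) \<in> k ` V" using V x by blast
        then have "d1 z (k (r x)) < \<delta>" using z(2) by blast
        moreover have "d1 (k (r x)) (k1 x) \<le> 2 * a" using l'mv[OF 1] by (simp add: k1_def)
        ultimately have "d1 z (k1 x) < \<delta> + 2 * a"
          using A.triangle[OF z(1) hD(2)[OF 1] k1X] by linarith
        then show "y \<in> topspace X \<and> d1 z y < \<delta> + 2 * a" using k1X x by simp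
      qed
    qed
    show thesis by (rule that[OF pm1]) (use eqM mv1 mv2 in auto)
  qed
qed

text \<open>The pattern \<open>(e, 6e, e, 20e)\<close> reproduces itself with \<open>e\<close>
  halved. The forth step turns it into \<open>(e/2, 20e, e, 3e)\<close>, where
  \<open>20e = 3 * 6e + 2e\<close> and \<open>3e = e + 2e\<close>; the back step then gives
  \<open>10e = 3 * 3e + 2 * (e/2)\<close> for the preimages and again \<open>3e = e + 2e\<close> for
  the images. The displacements add up to \<open>14e + 42e\<close> for \<open>h\<close> and
  \<open>42e + 7e\<close> for \<open>k\<close>, both below \<open>60e\<close>.\<close>

lemma partial_matching_round:
  assumes d1: "complete_metric_for X d1" and d2: "complete_metric_for X d2" and K: "tame_family X \<K>"
    and D: "tame_decomposition X \<K> \<D>" and dnD: "dense_decomposition X \<D>"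
    and E: "tame_decomposition X \<K> \<E>" and dnE: "dense_decomposition X \<E>"
    and e: "0 < e" and pm: "partial_matching X \<D> \<E> d1 d2 h k \<M> e (6 * e) e (20 * e)"
  obtains h1 k1 \<M>1 where
    "partial_matching X \<D> \<E> d1 d2 h1 k1 \<M>1 (e / 2) (6 * (e / 2)) (e / 2) (20 * (e / 2))"
    "\<M> \<subseteq> \<M>1" "\<And>x. x \<in> \<Union>\<M> \<Longrightarrow> h1 x = h x"
    "\<And>x. x \<in> topspace X \<Longrightarrow> d2 (h x) (h1 x) \<le> 60 * e"
    "\<And>x. x \<in> topspace X \<Longrightarrow> d1 (k x) (k1 x) \<le> 60 * e"
proof -
  interpret A: Metric_space "topspace X" d1 using complete_metric_forD[OF d1] by simp
  interpret B: Metric_space "topspace X" d2 using complete_metric_forD[OF d2] by simp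
  note DD = tame_decompositionD[OF D] and ED = tame_decompositionD[OF E]
  have p: "0 \<le> e" "0 \<le> 6 * e" "0 \<le> 20 * e" "0 < e / 2" using e by simp_all
  show ?thesis
  proof (rule partial_matching_step[OF d1 d2 K D E dnE pm p(1) p(2) p(1) p(3) p(4) e])
    fix h1 k1 \<M>1
    assume pm1: "partial_matching X \<D> \<E> d1 d2 h1 k1 \<M>1 (e / 2) (3 * (6 * e) + 2 * e) e (e + 2 * e)"
      and M1: "\<M> \<subseteq> \<M>1" and eq1: "\<And>x. x \<in> \<Union>\<M> \<Longrightarrow> h1 x = h x"
      and mh1: "\<And>x. x \<in> topspace X \<Longrightarrow> d2 (h x) (h1 x) \<le> 2 * (6 * e) + 2 * e"
      and mk1: "\<And>x. x \<in> topspace X \<Longrightarrow> d1 (k x) (k1 x) \<le> 2 * e + 2 * (20 * e)"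
    note sw = partial_matching_swap[OF pm1 DD(1)]
    have q: "0 \<le> e + 2 * e" "0 \<le> e / 2" "0 \<le> 3 * (6 * e) + 2 * e" using e by simp_all
    show thesis
    proof (rule partial_matching_step[OF d2 d1 K E D dnD sw(1) p(1) q(1) q(2) q(3) p(4) e])
      fix k2 h2 \<N>
      assume pm2: "partial_matching X \<E> \<D> d2 d1 k2 h2 \<N> (e / 2) (3 * (e + 2 * e) + 2 * (e / 2)) (e / 2) (e + 2 * e)"
        and M2: "(`) h1 ` \<M>1 \<subseteq> \<N>" and eq2: "\<And>x. x \<in> \<Union>((`) h1 ` \<M>1) \<Longrightarrow> k2 x = k1 x"
        and mk2: "\<And>x. x \<in> topspace X \<Longrightarrow> d1 (k1 x) (k2 x) \<le> 2 * (e + 2 * e) + 2 * (e / 2)"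
        and mh2: "\<And>x. x \<in> topspace X \<Longrightarrow> d2 (h1 x) (h2 x) \<le> 2 * e + 2 * (3 * (6 * e) + 2 * e)"
      note sw2 = partial_matching_swap[OF pm2 ED(1)]
      have hk1: "homeomorphic_maps X X h1 k1" and M1n: "\<M>1 \<subseteq> nondegenerate \<D>"
        using pm1 by (simp_all add: partial_matching_def)
      have hk: "homeomorphic_maps X X h k" using pm by (simp add: partial_matching_def)
      have hk2: "homeomorphic_maps X X k2 h2" using pm2 by (simp add: partial_matching_def)
      have M1X: "D \<subseteq> topspace X" if "D \<in> \<M>1" for D
        using decomposition_subset[OF DD(1)] M1n that by (auto simp: nondegenerate_def)
      have k2: "k2 (h1 x) = x" if "D \<in> \<M>1" "x \<in> D" for D x
      proof -
        have "h1 x \<in> \<Union>((`) h1 ` \<M>1)" using that by blast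
        moreover have "k1 (h1 x) = x" using homeomorphic_mapsD(3)[OF hk1] M1X that by blast
        ultimately show ?thesis using eq2 by simp
      qed
      have sub: "\<M> \<subseteq> (`) k2 ` \<N>"
      proof
        fix D assume "D \<in> \<M>"
        then have D: "D \<in> \<M>1" using M1 by blast
        have "k2 ` h1 ` D = D" using k2[OF D] by (force simp: image_iff)
        moreover have "h1 ` D \<in> \<N>" using M2 D by blast
        ultimately show "D \<in> (`) k2 ` \<N>" by (metis imageI)
      qed
      show thesis
      proof (rule that[of h2 k2 "(`) k2 ` \<N>"])
        have "3 * (e + 2 * e) + 2 * (e / 2) = 20 * (e / 2)" "e + 2 * e = 6 * (e / 2)" by simp_all
        then show "partial_matching X \<D> \<E> d1 d2 h2 k2 ((`) k2 ` \<N>) (e / 2) (6 * (e / 2)) (e / 2) (20 * (e / 2))"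
          using sw2(1) by simp
        show "\<M> \<subseteq> (`) k2 ` \<N>" by (rule sub)
        show "h2 x = h x" if x: "x \<in> \<Union>\<M>" for x
        proof -
          obtain D where D: "D \<in> \<M>" "x \<in> D" using x by blast
          then have D1: "D \<in> \<M>1" using M1 by blast
          have xX: "x \<in> topspace X" using M1X[OF D1] D by blast
          have "h2 (k2 (h1 x)) = h1 x" using homeomorphic_mapsD(4)[OF homeomorphic_maps_sym'[OF hk2]]
            homeomorphic_mapsD(1)[OF hk1 xX] homeomorphic_mapsD(3)[OF hk2] by blast
          then show ?thesis using k2[OF D1 D(2)] eq1[OF x] by simp
        qed
        show "d2 (h x) (h2 x) \<le> 60 * e" if x: "x \<in> topspace X" for x
        proof -
          have "d2 (h x) (h1 x) \<le> 14 * e" "d2 (h1 x) (h2 x) \<le> 42 * e"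
            using mh1[OF x] mh2[OF x] by simp_all
          then show ?thesis using B.triangle[OF homeomorphic_mapsD(1)[OF hk x] homeomorphic_mapsD(1)[OF hk1 x]
              homeomorphic_mapsD(2)[OF hk2 x]] e by linarith
        qed
        show "d1 (k x) (k2 x) \<le> 60 * e" if x: "x \<in> topspace X" for x
        proof -
          have "d1 (k x) (k1 x) \<le> 42 * e" "d1 (k1 x) (k2 x) \<le> 7 * e"
            using mk1[OF x] mk2[OF x] by simp_all
          then show ?thesis using A.triangle[OF homeomorphic_mapsD(2)[OF hk x] homeomorphic_mapsD(2)[OF hk1 x]
              homeomorphic_mapsD(1)[OF hk2 x]] e by linarith
        qed
      qed
    qed
  qed
qed

section \<open>Limits of sequences of homeomorphisms with geometrically decreasing
  displacements\<close>

lemma limitin_geometric: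
  assumes d: "complete_metric_for X d" and "l \<in> topspace X"
    and u: "\<And>n. u n \<in> topspace X" "\<And>n. d (u n) l \<le> c / 2 ^ n"
  shows "limitin X u l sequentially"
proof -
  interpret Metric_space "topspace X" d using complete_metric_forD[OF d] by simp
  have "(\<lambda>n. c * (1 / 2) ^ n) \<longlonglongrightarrow> c * 0" by (intro tendsto_intros) auto
  then have c0: "(\<lambda>n. c / 2 ^ n) \<longlonglongrightarrow> 0" by (simp add: power_one_over field_simps)
  have "(\<lambda>n. d (u n) l) \<longlonglongrightarrow> 0"
    by (rule tendsto_sandwich[OF _ _ tendsto_const c0]) (use u(2) in simp_all)
  then have "limitin mtopology u l sequentially" using assms(2) u(1) by (simp add: limitin_metric_dist_null)
  then show ?thesis using complete_metric_forD(2)[OF d] by simp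
qed

lemma uniform_geometric_limit:
  assumes d: "complete_metric_for X d" and f: "\<And>n. continuous_map X X (f n)"
    and c: "0 \<le> c" and step: "\<And>n x. x \<in> topspace X \<Longrightarrow> d (f n x) (f (Suc n) x) \<le> c / 2 ^ n"
  obtains F where "continuous_map X X F" "\<And>n x. x \<in> topspace X \<Longrightarrow> d (f n x) (F x) \<le> 2 * c / 2 ^ n"
proof -
  interpret Metric_space "topspace X" d using complete_metric_forD[OF d] by simp
  have top: "mtopology = X" using complete_metric_forD(2)[OF d] .
  have fX: "f n x \<in> topspace X" if "x \<in> topspace X" for n x using f[of n] that by (auto simp: continuous_map_def)
  \<comment> \<open>The subtracted tail of the geometric series makes the induction on
    \<open>m\<close> close; it is dropped in \<open>bnd'\<close>.\<close>
  have bnd: "d (f n x) (f (n + m) x) \<le> 2 * c / 2 ^ n - 2 * c / 2 ^ (n + m)" if x: "x \<in> topspace X" for n m x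
  proof (induction m)
    case 0
    then show ?case using fX[OF x] by simp
  next
    case (Suc m)
    have "d (f n x) (f (n + Suc m) x) \<le> d (f n x) (f (n + m) x) + d (f (n + m) x) (f (n + Suc m) x)"
      using triangle fX[OF x] by simp
    also have "d (f (n + m) x) (f (n + Suc m) x) \<le> c / 2 ^ (n + m)" using step[OF x, of "n + m"] by simp
    also have "c / 2 ^ (n + m) = 2 * c / 2 ^ (n + m) - 2 * c / 2 ^ (n + Suc m)" by (simp add: field_simps)
    finally show ?case using Suc by linarith
  qed
  have bnd': "d (f n x) (f m x) \<le> 2 * c / 2 ^ n" if x: "x \<in> topspace X" and "n \<le> m" for n m x
  proof -
    have "0 \<le> 2 * c / 2 ^ m" using c by simp
    then show ?thesis using bnd[OF x, of n "m - n"] that by simp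
  qed
  have "(\<lambda>n. 2 * c * (1 / 2) ^ n) \<longlonglongrightarrow> 2 * c * 0" by (intro tendsto_intros) auto
  then have c0: "(\<lambda>n. 2 * c / 2 ^ n) \<longlonglongrightarrow> 0" by (simp add: power_one_over field_simps)
  obtain F where F: "continuous_map X mtopology F"
    and lim: "\<And>\<epsilon>. 0 < \<epsilon> \<Longrightarrow> \<forall>\<^sub>F n in sequentially. \<forall>x\<in>topspace X. d (f n x) (F x) < \<epsilon>"
  proof (rule continuous_map_uniformly_Cauchy_limit[of X f])
    show "mcomplete" using complete_metric_forD(3)[OF d] .
    show "\<forall>\<^sub>F n in sequentially. continuous_map X mtopology (f n)" using f top by simp
    fix \<epsilon> :: real assume "\<epsilon> > 0"
    then obtain N where N: "\<And>n. n \<ge> N \<Longrightarrow> norm (2 * c / 2 ^ n - 0) < \<epsilon>" using LIMSEQ_D[OF c0] by blast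
    have small: "2 * c / 2 ^ n < \<epsilon>" if "n \<ge> N" for n using N[OF that] c by simp
    show "\<exists>N. \<forall>m n x. N \<le> m \<longrightarrow> N \<le> n \<longrightarrow> x \<in> topspace X \<longrightarrow> d (f m x) (f n x) < \<epsilon>"
    proof (intro exI allI impI)
      fix m n x assume mn: "N \<le> m" "N \<le> n" and x: "x \<in> topspace X"
      show "d (f m x) (f n x) < \<epsilon>"
      proof (cases "m \<le> n")
        case True then show ?thesis using bnd'[OF x True] small[OF mn(1)] by linarith
      next
        case False
        then show ?thesis using bnd'[OF x, of n m] small[OF mn(2)] commute[of "f m x" "f n x"] by linarith
      qed
    qed
  qed (use that in blast)
  show ?thesis
  proof (rule that)
    show "continuous_map X X F" using F top by simp
    fix n x assume x: "x \<in> topspace X"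
    have FX: "F x \<in> topspace X" using F x by (auto simp: continuous_map_def)
    show "d (f n x) (F x) \<le> 2 * c / 2 ^ n"
    proof (rule field_le_epsilon)
      fix \<epsilon> :: real assume "\<epsilon> > 0"
      from lim[OF this] obtain N where N: "\<forall>m\<ge>N. \<forall>x\<in>topspace X. d (f m x) (F x) < \<epsilon>"
        by (auto simp: eventually_sequentially)
      define m where "m = max N n"
      have "d (f m x) (F x) < \<epsilon>" using N x by (simp add: m_def)
      moreover have "d (f n x) (f m x) \<le> 2 * c / 2 ^ n" using bnd'[OF x, of n m] by (simp add: m_def)
      moreover have "d (f n x) (F x) \<le> d (f n x) (f m x) + d (f m x) (F x)"
        using triangle[OF fX[OF x] fX[OF x] FX] .
      ultimately show "d (f n x) (F x) \<le> 2 * c / 2 ^ n + \<epsilon>" by linarith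
    qed
  qed
qed

text \<open>Uniform convergence of the maps alone would only give a continuous limit. Since the
  inverses converge uniformly as well, the limit of \<open>K (h n x)\<close> can be computed twice:
  it is \<open>K (H x)\<close> by continuity, and \<open>x\<close> because \<open>K\<close> is close
  to \<open>k n\<close> at the point \<open>h n x\<close>. The two metrics may differ, as only the
  topology has to be common.\<close>

lemma homeomorphic_maps_geometric_limit:
  assumes d1: "complete_metric_for X d1" and d2: "complete_metric_for X d2"
    and hk: "\<And>n. homeomorphic_maps X X (h n) (k n)" and c: "0 \<le> c"
    and mh: "\<And>n x. x \<in> topspace X \<Longrightarrow> d2 (h n x) (h (Suc n) x) \<le> c / 2 ^ n"
    and mk: "\<And>n x. x \<in> topspace X \<Longrightarrow> d1 (k n x) (k (Suc n) x) \<le> c / 2 ^ n"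
  obtains H K where "homeomorphic_maps X X H K"
    "\<And>n x. x \<in> topspace X \<Longrightarrow> d2 (h n x) (H x) \<le> 2 * c / 2 ^ n"
proof -
  have ch: "continuous_map X X (h n)" and ck: "continuous_map X X (k n)" for n
    using hk[of n] by (simp_all add: homeomorphic_maps_def)
  have Hd: "Hausdorff_space X"
    using metrizable_imp_Hausdorff_space[OF complete_metric_for_imp_metrizable[OF d1]] .
  obtain H where H: "continuous_map X X H"
    and H1: "\<And>n x. x \<in> topspace X \<Longrightarrow> d2 (h n x) (H x) \<le> 2 * c / 2 ^ n"
    using uniform_geometric_limit[OF d2 ch c mh] by metis
  obtain K where K: "continuous_map X X K"
    and K1: "\<And>n x. x \<in> topspace X \<Longrightarrow> d1 (k n x) (K x) \<le> 2 * c / 2 ^ n"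
    using uniform_geometric_limit[OF d1 ck c mk] by metis
  have inv: "G (F x) = x"
    if a: "complete_metric_for X da" and b: "complete_metric_for X db"
      and fg: "\<And>n. homeomorphic_maps X X (f n) (g n)"
      and F: "continuous_map X X F" and G: "continuous_map X X G"
      and F1: "\<And>n x. x \<in> topspace X \<Longrightarrow> db (f n x) (F x) \<le> 2 * c / 2 ^ n"
      and G1: "\<And>n x. x \<in> topspace X \<Longrightarrow> da (g n x) (G x) \<le> 2 * c / 2 ^ n"
      and x: "x \<in> topspace X" for f g F G da db x
  proof -
    interpret A: Metric_space "topspace X" da using complete_metric_forD[OF a] by simp
    have fX: "f n x \<in> topspace X" for n using homeomorphic_mapsD(1)[OF fg x] .
    have FX: "F x \<in> topspace X" using F x by (auto simp: continuous_map_def)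
    have "limitin X (\<lambda>n. f n x) (F x) sequentially" by (rule limitin_geometric[OF b FX fX F1[OF x]])
    from continuous_map_limit[OF G this]
    have 1: "limitin X (\<lambda>n. G (f n x)) (G (F x)) sequentially" by (simp add: o_def)
    have 2: "limitin X (\<lambda>n. G (f n x)) x sequentially"
    proof (rule limitin_geometric[OF a x])
      show "G (f n x) \<in> topspace X" for n using G fX by (auto simp: continuous_map_def)
      show "da (G (f n x)) x \<le> 2 * c / 2 ^ n" for n
        using G1[OF fX, of n n] homeomorphic_mapsD(3)[OF fg x, of n] A.commute by simp
    qed
    show ?thesis using limitin_Hausdorff_unique[OF 1 2 _ Hd] by simp
  qed
  have "homeomorphic_maps X X H K"
    unfolding homeomorphic_maps_def
  proof (intro conjI ballI H K)
    show "K (H x) = x" if "x \<in> topspace X" for x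
      by (rule inv[OF d1 d2 hk H K H1 K1 that])
    show "H (K x) = x" if "x \<in> topspace X" for x
      by (rule inv[OF d2 d1 homeomorphic_maps_sym'[OF hk] K H K1 H1 that])
  qed
  then show ?thesis using that H1 by blast
qed

text \<open>The radii at stage \<open>n\<close> are multiples of \<open>e / 2 ^ n\<close>, so an
  element that is never matched has diameter 0: every non-degenerate element is matched at some
  stage. From then on it is frozen, so \<open>H\<close> agrees with \<open>h n\<close> on it. The
  bound \<open>120 * e\<close> is the sum of the displacements
  \<open>60 * e / 2 ^ n\<close>.\<close>

lemma back_and_forth:
  assumes d1: "complete_metric_for X d1" and d2: "complete_metric_for X d2" and K: "tame_family X \<K>"
    and D: "tame_decomposition X \<K> \<D>" and dnD: "dense_decomposition X \<D>"
    and E: "tame_decomposition X \<K> \<E>" and dnE: "dense_decomposition X \<E>"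
    and e: "0 < e" and pm: "partial_matching X \<D> \<E> d1 d2 h0 k0 \<M>0 e (6 * e) e (20 * e)"
  obtains H K where "homeomorphic_maps X X H K"
    "\<And>x. x \<in> topspace X \<Longrightarrow> d2 (h0 x) (H x) \<le> 120 * e"
    "\<And>D. D \<in> \<D> \<Longrightarrow> H ` D \<in> \<E>" "\<And>E. E \<in> \<E> \<Longrightarrow> K ` E \<in> \<D>"
proof -
  interpret A: Metric_space "topspace X" d1 using complete_metric_forD[OF d1] by simp
  interpret B: Metric_space "topspace X" d2 using complete_metric_forD[OF d2] by simp
  note DD = tame_decompositionD[OF D] and ED = tame_decompositionD[OF E]
  define PM where "PM n s \<longleftrightarrow> partial_matching X \<D> \<E> d1 d2 (fst s) (fst (snd s)) (snd (snd s))
    (e / 2 ^ n) (6 * (e / 2 ^ n)) (e / 2 ^ n) (20 * (e / 2 ^ n))" for n :: nat and s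
  define ST where "ST n s t \<longleftrightarrow> snd (snd s) \<subseteq> snd (snd t) \<and> (\<forall>x\<in>\<Union>(snd (snd s)). fst t x = fst s x) \<and>
    (\<forall>x\<in>topspace X. d2 (fst s x) (fst t x) \<le> 60 * (e / 2 ^ n)) \<and>
    (\<forall>x\<in>topspace X. d1 (fst (snd s) x) (fst (snd t) x) \<le> 60 * (e / 2 ^ n))"
    for n :: nat and s t :: "('a \<Rightarrow> 'a) \<times> ('a \<Rightarrow> 'a) \<times> 'a set set"
  have "\<exists>f. (\<forall>n. PM n (f n)) \<and> f 0 = (h0, k0, \<M>0) \<and> (\<forall>n. ST n (f n) (f (Suc n)))"
  proof -
    have 0: "PM 0 (h0, k0, \<M>0)" using pm by (simp add: PM_def)
    have S: "\<exists>t. PM (Suc n) t \<and> ST n s t" if s: "PM n s" for n s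
    proof (rule partial_matching_round[OF d1 d2 K D dnD E dnE _ s[unfolded PM_def]])
      show "0 < e / 2 ^ n" using e by simp
      fix h1 k1 \<M>1
      assume *: "partial_matching X \<D> \<E> d1 d2 h1 k1 \<M>1 (e / 2 ^ n / 2) (6 * (e / 2 ^ n / 2))
          (e / 2 ^ n / 2) (20 * (e / 2 ^ n / 2))"
        "snd (snd s) \<subseteq> \<M>1" "\<And>x. x \<in> \<Union>(snd (snd s)) \<Longrightarrow> h1 x = fst s x"
        "\<And>x. x \<in> topspace X \<Longrightarrow> d2 (fst s x) (h1 x) \<le> 60 * (e / 2 ^ n)"
        "\<And>x. x \<in> topspace X \<Longrightarrow> d1 (fst (snd s) x) (k1 x) \<le> 60 * (e / 2 ^ n)"
      have "e / 2 ^ n / 2 = e / 2 ^ Suc n" by simp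
      then have "PM (Suc n) (h1, k1, \<M>1)" using *(1) unfolding PM_def fst_conv snd_conv by metis
      moreover have "ST n s (h1, k1, \<M>1)" unfolding ST_def fst_conv snd_conv
        by (intro conjI ballI *(2-5))
      ultimately show ?thesis by blast
    qed
    obtain g where g: "\<And>n s. PM n s \<Longrightarrow> PM (Suc n) (g n s) \<and> ST n s (g n s)" using S by metis
    define f where "f = rec_nat (h0, k0, \<M>0) g"
    have f0: "f 0 = (h0, k0, \<M>0)" and fS: "f (Suc n) = g n (f n)" for n by (simp_all add: f_def)
    have fP: "PM n (f n)" for n by (induction n) (use 0 g f0 fS in auto)
    then have "ST n (f n) (f (Suc n))" for n using g fS by simp
    then show ?thesis using fP f0 by blast
  qed
  then obtain f where fP: "\<And>n. PM n (f n)" and f0: "f 0 = (h0, k0, \<M>0)"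
    and fS: "\<And>n. ST n (f n) (f (Suc n))" by blast
  define h where "h n = fst (f n)" for n
  define k where "k n = fst (snd (f n))" for n
  define M where "M n = snd (snd (f n))" for n
  have pmn: "partial_matching X \<D> \<E> d1 d2 (h n) (k n) (M n) (e / 2 ^ n) (6 * (e / 2 ^ n)) (e / 2 ^ n) (20 * (e / 2 ^ n))" for n
    using fP[of n] by (simp add: PM_def h_def k_def M_def)
  have st: "M n \<subseteq> M (Suc n)" "\<And>x. x \<in> \<Union>(M n) \<Longrightarrow> h (Suc n) x = h n x"
    "\<And>x. x \<in> topspace X \<Longrightarrow> d2 (h n x) (h (Suc n) x) \<le> 60 * (e / 2 ^ n)"
    "\<And>x. x \<in> topspace X \<Longrightarrow> d1 (k n x) (k (Suc n) x) \<le> 60 * (e / 2 ^ n)" for n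
    using fS[of n] unfolding ST_def h_def k_def M_def by blast+
  have hk: "homeomorphic_maps X X (h n) (k n)" and Mn: "M n \<subseteq> nondegenerate \<D>"
    and hMn: "(`) (h n) ` M n \<subseteq> nondegenerate \<E>" for n
    using pmn[of n] by (simp_all add: partial_matching_def)
  have mono: "M n \<subseteq> M m" if "n \<le> m" for n m using lift_Suc_mono_le[of M, OF st(1) that] .
  obtain H K where HK: "homeomorphic_maps X X H K"
    and H1: "\<And>n x. x \<in> topspace X \<Longrightarrow> d2 (h n x) (H x) \<le> 2 * (60 * e) / 2 ^ n"
  proof (rule homeomorphic_maps_geometric_limit[OF d1 d2 hk, of "60 * e"])
    show "0 \<le> 60 * e" using e by simp
    show "d2 (h n x) (h (Suc n) x) \<le> 60 * e / 2 ^ n" if "x \<in> topspace X" for n x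
      using st(3)[OF that] by simp
    show "d1 (k n x) (k (Suc n) x) \<le> 60 * e / 2 ^ n" if "x \<in> topspace X" for n x
      using st(4)[OF that] by simp
  qed (rule that)
  note HD = homeomorphic_mapsD[OF HK]
  have DX: "D \<subseteq> topspace X" if "D \<in> nondegenerate \<D>" for D
    using decomposition_subset[OF DD(1)] that by (simp add: nondegenerate_def)
  have MX: "x \<in> topspace X" if "x \<in> \<Union>(M n)" for x n using that Mn[of n] DX by blast
  have stab: "h (n + m) x = h n x" if x: "x \<in> \<Union>(M n)" for n m x
  proof (induction m)
    case (Suc m)
    have "x \<in> \<Union>(M (n + m))" using x mono[of n "n + m"] by auto
    then show ?case using st(2) Suc by simp
  qed simp
  have c0: "(\<lambda>n. C / 2 ^ n) \<longlonglongrightarrow> 0" for C :: real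
  proof -
    have "(\<lambda>n. C * (1 / 2) ^ n) \<longlonglongrightarrow> C * 0" by (intro tendsto_intros) auto
    then show ?thesis by (simp add: power_one_over field_simps)
  qed
  have zero: "t \<le> 0" if "\<And>n. t \<le> C / 2 ^ n" for t C :: real
    using LIMSEQ_le_const[OF c0[of C]] that by blast
  have Hh: "H x = h n x" if x: "x \<in> \<Union>(M n)" for n x
  proof -
    have xX: "x \<in> topspace X" using MX[OF x] .
    have "d2 (h n x) (H x) \<le> 2 * (60 * e) / 2 ^ m" for m
    proof -
      have "d2 (h n x) (H x) \<le> 2 * (60 * e) / 2 ^ (n + m)" using H1[OF xX, of "n + m"] stab[OF x] by simp
      also have "\<dots> \<le> 2 * (60 * e) / 2 ^ m" using e by (intro divide_left_mono power_increasing) auto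
      finally show ?thesis .
    qed
    then have "d2 (h n x) (H x) \<le> 0" by (rule zero)
    then have "d2 (h n x) (H x) = 0" using B.nonneg[of "h n x" "H x"] by linarith
    then show ?thesis using B.zero[OF homeomorphic_mapsD(1)[OF hk xX] HD(1)[OF xX]] by simp
  qed
  have HM: "H ` D = h n ` D" if "D \<in> M n" for D n
  proof (rule image_cong[OF refl])
    fix x assume "x \<in> D" then show "H x = h n x" using Hh[of x n] that by blast
  qed
  have evD: "\<exists>n. D \<in> M n" if D: "D \<in> nondegenerate \<D>" for D
  proof (rule ccontr)
    assume n: "\<not> (\<exists>n. D \<in> M n)"
    obtain x y where xy: "x \<in> D" "y \<in> D" "x \<noteq> y" using D by (auto simp: nondegenerate_def)
    have "small X d1 (e / 2 ^ n) D" for n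
      using pmn[of n] n D by (simp add: partial_matching_def nondegenerate_def)
    from small_dist[OF d1 this xy(1,2)] have "d1 x y \<le> (2 * e) / 2 ^ n" for n by simp
    then have "d1 x y \<le> 0" by (rule zero)
    moreover have "x \<in> topspace X" "y \<in> topspace X" using xy DX[OF D] by blast+
    ultimately show False using A.mdist_pos_less[OF xy(3)] by fastforce
  qed
  have evE: "\<exists>n. E \<in> (`) (h n) ` M n" if E': "E \<in> nondegenerate \<E>" for E
  proof (rule ccontr)
    assume n: "\<not> (\<exists>n. E \<in> (`) (h n) ` M n)"
    obtain x y where xy: "x \<in> E" "y \<in> E" "x \<noteq> y" using E' by (auto simp: nondegenerate_def)
    have "small X d2 (e / 2 ^ n) E" for n
      using pmn[of n] n E' by (simp add: partial_matching_def nondegenerate_def)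
    from small_dist[OF d2 this xy(1,2)] have "d2 x y \<le> (2 * e) / 2 ^ n" for n by simp
    then have "d2 x y \<le> 0" by (rule zero)
    moreover have "x \<in> topspace X" "y \<in> topspace X"
      using xy decomposition_subset[OF ED(1)] E' by (auto simp: nondegenerate_def)
    ultimately show False using B.mdist_pos_less[OF xy(3)] by fastforce
  qed
  have HnD: "H ` D \<in> nondegenerate \<E>" if "D \<in> nondegenerate \<D>" for D
  proof -
    obtain n where n: "D \<in> M n" using evD \<open>D \<in> nondegenerate \<D>\<close> by blast
    then show ?thesis using HM[OF n] hMn[of n] by auto
  qed
  have KH: "K ` H ` D = D" if "D \<subseteq> topspace X" for D using homeomorphic_maps_image_image[OF HK that] .
  have HK': "H ` K ` D = D" if "D \<subseteq> topspace X" for D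
    using homeomorphic_maps_image_image[OF homeomorphic_maps_sym'[OF HK] that] .
  have KnE: "K ` E \<in> nondegenerate \<D>" if "E \<in> nondegenerate \<E>" for E
  proof -
    obtain n D where n: "D \<in> M n" "E = h n ` D" using evE \<open>E \<in> nondegenerate \<E>\<close> by blast
    then have "D \<in> nondegenerate \<D>" using Mn by blast
    moreover have "K ` E = K ` H ` D" using HM[OF n(1)] n(2) by simp
    ultimately show ?thesis using KH[OF DX] by simp
  qed
  have deg: "\<exists>x. D = {x}" if F: "decomposition X \<F>" "D \<in> \<F>" "D \<notin> nondegenerate \<F>" for D \<F>
  proof -
    have "D \<noteq> {}" using F by (simp add: decomposition_def)
    then obtain x where "x \<in> D" by blast
    then have "D = {x}" using F(2,3) by (auto simp: nondegenerate_def)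
    then show ?thesis by blast
  qed
  \<comment> \<open>The singletons take care of themselves: if the image of a singleton lay in a
    non-degenerate element, the preimage of that element would be a non-degenerate element
    containing the point.\<close>
  have trans: "F ` D \<in> \<E>'"
    if D': "decomposition X \<D>'" and E': "decomposition X \<E>'" and FG: "homeomorphic_maps X X F G"
      and Fn: "\<And>D. D \<in> nondegenerate \<D>' \<Longrightarrow> F ` D \<in> nondegenerate \<E>'"
      and Gn: "\<And>E. E \<in> nondegenerate \<E>' \<Longrightarrow> G ` E \<in> nondegenerate \<D>'" and D: "D \<in> \<D>'"
    for F G \<D>' \<E>' D
  proof (cases "D \<in> nondegenerate \<D>'")
    case True then show ?thesis using Fn by (simp add: nondegenerate_def)
  next
    case False
    then obtain x where x: "D = {x}" using deg[OF D' D] by blast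
    then have xX: "x \<in> topspace X" using decomposition_subset[OF D' D] by simp
    note FX = homeomorphic_mapsD(1)[OF FG xX]
    note E = decomp_map_in[OF E' FX]
    have "decomp_map \<E>' (F x) \<notin> nondegenerate \<E>'"
    proof
      assume "decomp_map \<E>' (F x) \<in> nondegenerate \<E>'"
      then have *: "G ` decomp_map \<E>' (F x) \<in> nondegenerate \<D>'" by (rule Gn)
      have "G (F x) \<in> G ` decomp_map \<E>' (F x)" using E(2) by (rule imageI)
      then have "x \<in> G ` decomp_map \<E>' (F x)" using homeomorphic_mapsD(3)[OF FG xX] by simp
      moreover have "G ` decomp_map \<E>' (F x) \<in> \<D>'" using * by (simp add: nondegenerate_def)
      ultimately have "G ` decomp_map \<E>' (F x) = D" using decomposition_eqI[OF D' _ D] x by blast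
      then show False using * False by simp
    qed
    then obtain y where "decomp_map \<E>' (F x) = {y}" using deg[OF E' E(1)] by blast
    then have "decomp_map \<E>' (F x) = {F x}" using E(2) by simp
    then show ?thesis using E(1) x by simp
  qed
  show ?thesis
  proof (rule that[OF HK])
    show "d2 (h0 x) (H x) \<le> 120 * e" if "x \<in> topspace X" for x
      using H1[OF that, of 0] f0 by (simp add: h_def)
    show "H ` D \<in> \<E>" if "D \<in> \<D>" for D by (rule trans[OF DD(1) ED(1) HK HnD KnE that])
    show "K ` E \<in> \<D>" if "E \<in> \<E>" for E
      by (rule trans[OF ED(1) DD(1) homeomorphic_maps_sym'[OF HK] KnE HnD that])
  qed
qed

section \<open>Shrinkable decompositions\<close>

text \<open>Choosing, for a point, an element whose radius is almost maximal turns the pointwise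
  construction into a barycentric refinement.\<close>

lemma saturated_barycentric_refinement:
  assumes d: "complete_metric_for X d" and D: "decomposition X \<D>" and v: "vanishing X \<D>"
    and U: "\<And>U. U \<in> \<U> \<Longrightarrow> openin X U" "\<And>D. D \<in> \<D> \<Longrightarrow> \<exists>U\<in>\<U>. D \<subseteq> U" and r: "0 < r"
  obtains \<W> where "open_cover X \<W>" "\<And>W. W \<in> \<W> \<Longrightarrow> saturated \<D> W"
    "\<And>x. x \<in> topspace X \<Longrightarrow> \<exists>U\<in>\<U>. \<exists>D\<in>\<D>. \<forall>W\<in>\<W>. x \<in> W \<longrightarrow> W \<subseteq> U \<inter> enlarge X d D r"
proof -
  interpret Metric_space "topspace X" d using complete_metric_forD[OF d] by simp
  have X: "metrizable_space X" using complete_metric_for_imp_metrizable[OF d] .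
  have DX: "E \<subseteq> topspace X" if "E \<in> \<D>" for E using decomposition_subset[OF D that] .
  have comp: "compactin X E" if "E \<in> \<D>" for E using D that by (simp add: decomposition_def)
  \<comment> \<open>The bound 1 is there for the supremum taken below, the bound \<open>r\<close>
    for the closeness to an element of \<open>\<D>\<close>.\<close>
  have "\<forall>E\<in>\<D>. \<exists>\<epsilon>. 0 < \<epsilon> \<and> \<epsilon> \<le> 1 \<and> \<epsilon> \<le> r \<and> (\<exists>U\<in>\<U>. enlarge X d E \<epsilon> \<subseteq> U)"
  proof
    fix E assume E: "E \<in> \<D>"
    then obtain T where T: "T \<in> \<U>" "E \<subseteq> T" using U(2) by blast
    obtain \<epsilon> where e: "\<epsilon> > 0" "enlarge X d E \<epsilon> \<subseteq> T" using compact_enlarge[OF d comp[OF E] U(1)[OF T(1)] T(2)] by metis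
    have "enlarge X d E (min \<epsilon> (min 1 r)) \<subseteq> T" using e(2) enlarge_mono[of "min \<epsilon> (min 1 r)" \<epsilon> X d E] by simp
    then show "\<exists>\<epsilon>. 0 < \<epsilon> \<and> \<epsilon> \<le> 1 \<and> \<epsilon> \<le> r \<and> (\<exists>U\<in>\<U>. enlarge X d E \<epsilon> \<subseteq> U)"
      using e(1) T(1) r by (intro exI[of _ "min \<epsilon> (min 1 r)"]) auto
  qed
  then obtain \<epsilon> where \<epsilon>: "\<forall>E\<in>\<D>. 0 < \<epsilon> E \<and> \<epsilon> E \<le> 1 \<and> \<epsilon> E \<le> r \<and> (\<exists>U\<in>\<U>. enlarge X d E (\<epsilon> E) \<subseteq> U)"
    by (rule bchoice[THEN exE])
  have "\<forall>E\<in>\<D>. \<exists>\<delta>. 0 < \<delta> \<and> \<delta> \<le> \<epsilon> E / 4 \<and>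
      (\<forall>F\<in>\<D>. F \<inter> enlarge X d E \<delta> \<noteq> {} \<longrightarrow> F \<subseteq> enlarge X d E (\<epsilon> E / 2))"
  proof
    fix E assume E: "E \<in> \<D>"
    let ?S = "saturated_interior \<D> (enlarge X d E (\<epsilon> E / 2))"
    have e: "\<epsilon> E > 0" using \<epsilon> E by simp
    have "openin X ?S" using openin_saturated_interior[OF X D v openin_enlarge[OF d DX[OF E]]] .
    moreover have "E \<subseteq> ?S" using subset_saturated_interior[OF E subset_enlarge[OF d DX[OF E]]] e by simp
    ultimately obtain \<rho> where \<rho>: "\<rho> > 0" "enlarge X d E \<rho> \<subseteq> ?S" using compact_enlarge[OF d comp[OF E]] by metis
    have "F \<subseteq> enlarge X d E (\<epsilon> E / 2)" if F: "F \<in> \<D>" "F \<inter> enlarge X d E (min \<rho> (\<epsilon> E / 4)) \<noteq> {}" for F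
    proof -
      have "enlarge X d E (min \<rho> (\<epsilon> E / 4)) \<subseteq> ?S" using \<rho>(2) enlarge_mono[of "min \<rho> (\<epsilon> E / 4)" \<rho> X d E] by simp
      then have "F \<inter> ?S \<noteq> {}" using F(2) by blast
      from saturated_meets[OF D saturated_saturated_interior F(1) this]
      show ?thesis using saturated_interior_subset by (rule order_trans)
    qed
    then show "\<exists>\<delta>. 0 < \<delta> \<and> \<delta> \<le> \<epsilon> E / 4 \<and>
      (\<forall>F\<in>\<D>. F \<inter> enlarge X d E \<delta> \<noteq> {} \<longrightarrow> F \<subseteq> enlarge X d E (\<epsilon> E / 2))"
      using \<rho>(1) e by (intro exI[of _ "min \<rho> (\<epsilon> E / 4)"]) auto
  qed
  then obtain \<delta> where \<delta>: "\<forall>E\<in>\<D>. 0 < \<delta> E \<and> \<delta> E \<le> \<epsilon> E / 4 \<and>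
      (\<forall>F\<in>\<D>. F \<inter> enlarge X d E (\<delta> E) \<noteq> {} \<longrightarrow> F \<subseteq> enlarge X d E (\<epsilon> E / 2))"
    by (rule bchoice[THEN exE])
  \<comment> \<open>If \<open>\<delta> F < 2 * \<delta> E\<close> and \<open>W E\<close>,
    \<open>W F\<close> have a common point, then a point of \<open>F\<close> is within
    \<open>\<delta> E / 8 + \<delta> F / 8 < \<delta> E\<close> of \<open>E\<close>; so
    \<open>F\<close> stays within \<open>\<epsilon> E / 2\<close> of \<open>E\<close>, and
    \<open>W F\<close> within
    \<open>\<epsilon> E / 2 + \<delta> F / 8 < \<epsilon> E\<close>.\<close>
  define W where "W E = saturated_interior \<D> (enlarge X d E (\<delta> E / 8))" for E
  have Wsub: "W E \<subseteq> enlarge X d E (\<delta> E / 8)" for E unfolding W_def by (rule saturated_interior_subset)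
  have EW: "E \<subseteq> W E" if E: "E \<in> \<D>" for E
    unfolding W_def using subset_saturated_interior[OF E subset_enlarge[OF d DX[OF E]]] \<delta> E by simp
  show ?thesis
  proof (rule that[of "W ` \<D>"])
    show "open_cover X (W ` \<D>)"
      unfolding open_cover_def
    proof
      show op: "\<forall>V\<in>W ` \<D>. openin X V"
        using openin_saturated_interior[OF X D v openin_enlarge[OF d DX]] by (simp add: W_def)
      have "topspace X = \<Union>\<D>" using D by (simp add: decomposition_def)
      then have "topspace X \<subseteq> \<Union>(W ` \<D>)" using EW by blast
      moreover have "\<Union>(W ` \<D>) \<subseteq> topspace X" using Wsub by (auto simp: enlarge_def)
      ultimately show "\<Union>(W ` \<D>) = topspace X" by blast
    qed
    show "saturated \<D> V" if "V \<in> W ` \<D>" for V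
      using that saturated_saturated_interior by (auto simp: W_def)
    fix x assume x: "x \<in> topspace X"
    define A where "A = \<delta> ` {E \<in> \<D>. x \<in> W E}"
    have "decomp_map \<D> x \<in> {E \<in> \<D>. x \<in> W E}" using EW decomp_map_in[OF D x] by blast
    then have Ane: "A \<noteq> {}" unfolding A_def by blast
    have \<delta>1: "\<delta> E \<le> 1" if "E \<in> \<D>" for E using \<delta> \<epsilon> that by force
    then have Abd: "bdd_above A" unfolding A_def by (intro bdd_aboveI[of _ 1]) auto
    have "Sup A > 0"
    proof -
      obtain t where t: "t \<in> A" using Ane by blast
      then have "t > 0" using \<delta> by (auto simp: A_def)
      then show ?thesis using cSup_upper[OF t Abd] by linarith
    qed
    then have "Sup A / 2 < Sup A" by simp
    then obtain t where t: "t \<in> A" "Sup A / 2 < t" using less_cSupE[OF _ Ane] by metis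
    then obtain E where E: "E \<in> \<D>" "x \<in> W E" "t = \<delta> E" by (auto simp: A_def)
    have e: "0 < \<epsilon> E" "\<epsilon> E \<le> r" "0 < \<delta> E" "\<delta> E \<le> \<epsilon> E / 4" using \<epsilon> \<delta> E(1) by simp_all
    obtain T where T: "T \<in> \<U>" "enlarge X d E (\<epsilon> E) \<subseteq> T" using \<epsilon> E(1) by blast
    have WE: "W F \<subseteq> enlarge X d E (\<epsilon> E)" if F: "F \<in> \<D>" "x \<in> W F" for F
    proof
      have "\<delta> F \<in> A" using F by (auto simp: A_def)
      then have dF: "\<delta> F < 2 * \<delta> E" using cSup_upper[OF _ Abd] t E by force
      obtain p where p: "p \<in> E" "d p x < \<delta> E / 8" using E(2) Wsub[of E] by (auto simp: enlarge_def)
      obtain q where q: "q \<in> F" "d q x < \<delta> F / 8" using F(2) Wsub[of F] by (auto simp: enlarge_def)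
      have pX: "p \<in> topspace X" and qX: "q \<in> topspace X" using p q DX E F by blast+
      have "d p q \<le> d p x + d q x" using triangle'[OF pX x qX] .
      then have "d p q < \<delta> E" using p q dF e by linarith
      then have "q \<in> enlarge X d E (\<delta> E)" using p qX unfolding enlarge_def by blast
      then have "F \<inter> enlarge X d E (\<delta> E) \<noteq> {}" using q by blast
      then have FE: "F \<subseteq> enlarge X d E (\<epsilon> E / 2)" using \<delta> E(1) F(1) by simp
      fix w assume "w \<in> W F"
      then obtain b where b: "b \<in> F" "d b w < \<delta> F / 8" "w \<in> topspace X" using Wsub[of F] by (auto simp: enlarge_def)
      then obtain c where c: "c \<in> E" "d c b < \<epsilon> E / 2" using FE by (auto simp: enlarge_def)
      have bX: "b \<in> topspace X" and cX: "c \<in> topspace X" using b c DX E F by blast+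
      have "d c w < \<epsilon> E" using triangle[OF cX bX b(3)] b(2) c(2) dF e by linarith
      then show "w \<in> enlarge X d E (\<epsilon> E)" using c b unfolding enlarge_def by blast
    qed
    have "enlarge X d E (\<epsilon> E) \<subseteq> enlarge X d E r" using e by (intro enlarge_mono)
    then have TE: "enlarge X d E (\<epsilon> E) \<subseteq> T \<inter> enlarge X d E r" using T(2) by (rule Int_greatest[rotated])
    have "\<forall>V\<in>W ` \<D>. x \<in> V \<longrightarrow> V \<subseteq> T \<inter> enlarge X d E r"
    proof (intro ballI impI, elim imageE)
      fix V F assume "x \<in> V" "V = W F" "F \<in> \<D>"
      then show "V \<subseteq> T \<inter> enlarge X d E r" using order_trans[OF WE TE] by simp
    qed
    then show "\<exists>U\<in>\<U>. \<exists>D\<in>\<D>. \<forall>V\<in>W ` \<D>. x \<in> V \<longrightarrow> V \<subseteq> U \<inter> enlarge X d D r"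
      by (intro bexI[OF _ T(1)] bexI[OF _ E(1)])
  qed
qed

section \<open>Normal sequences of saturated covers and the separation of elements\<close>

lemma saturated_cover_contains:
  assumes "decomposition X \<D>" "open_cover X \<W>" "\<And>W. W \<in> \<W> \<Longrightarrow> saturated \<D> W" "D \<in> \<D>"
  shows "\<exists>W\<in>\<W>. D \<subseteq> W"
proof -
  have "D \<noteq> {}" using assms(1,4) by (simp add: decomposition_def)
  then obtain x where x: "x \<in> D" by blast
  then have "x \<in> \<Union>\<W>" using decomposition_subset[OF assms(1,4)] assms(2) by (auto simp: open_cover_def)
  then obtain W where W: "W \<in> \<W>" "x \<in> W" by blast
  then show ?thesis using saturated_meets[OF assms(1) assms(3)[OF W(1)] assms(4)] x by blast
qed

text \<open>Barycentric refinement at each stage makes this a normal sequence of covers, as in the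
  metrization of a uniformity. It plays the part of a metric on the quotient, but consists of
  saturated covers of \<open>X\<close>, which is what shrinkability accepts. The meshes
  \<open>1 / 2 ^ n\<close> relate it to \<open>d\<close>: all members through a point lie close to
  one element.\<close>

lemma saturated_normal_sequence:
  assumes d: "complete_metric_for X d" and D: "decomposition X \<D>" and v: "vanishing X \<D>"
    and U: "\<And>U. U \<in> \<U> \<Longrightarrow> openin X U" "\<And>D. D \<in> \<D> \<Longrightarrow> \<exists>U\<in>\<U>. D \<subseteq> U"
  obtains \<W> :: "nat \<Rightarrow> 'a set set" where "\<And>n. open_cover X (\<W> n)" "\<And>n W. W \<in> \<W> n \<Longrightarrow> saturated \<D> W"
    "\<And>x. x \<in> topspace X \<Longrightarrow> \<exists>U\<in>\<U>. \<forall>W\<in>\<W> 0. x \<in> W \<longrightarrow> W \<subseteq> U"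
    "\<And>n x. x \<in> topspace X \<Longrightarrow> \<exists>U\<in>\<W> n. \<forall>W\<in>\<W> (Suc n). x \<in> W \<longrightarrow> W \<subseteq> U"
    "\<And>n x. x \<in> topspace X \<Longrightarrow> \<exists>D\<in>\<D>. \<forall>W\<in>\<W> n. x \<in> W \<longrightarrow> W \<subseteq> enlarge X d D (1 / 2 ^ n)"
proof -
  define R where "R r \<V> \<W> \<longleftrightarrow> open_cover X \<W> \<and> (\<forall>W\<in>\<W>. saturated \<D> W) \<and>
    (\<forall>x\<in>topspace X. \<exists>U\<in>\<V>. \<exists>D\<in>\<D>. \<forall>W\<in>\<W>. x \<in> W \<longrightarrow> W \<subseteq> U \<inter> enlarge X d D r)"
    for r :: real and \<V> \<W>
  have ex: "\<exists>\<W>. R r \<V> \<W>" if V: "\<And>U. U \<in> \<V> \<Longrightarrow> openin X U" "\<And>D. D \<in> \<D> \<Longrightarrow> \<exists>U\<in>\<V>. D \<subseteq> U" and r: "0 < r" for r \<V>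
  proof (rule saturated_barycentric_refinement[OF d D v V r])
    fix \<W> assume "open_cover X \<W>" "\<And>W. W \<in> \<W> \<Longrightarrow> saturated \<D> W"
      "\<And>x. x \<in> topspace X \<Longrightarrow> \<exists>U\<in>\<V>. \<exists>D\<in>\<D>. \<forall>W\<in>\<W>. x \<in> W \<longrightarrow> W \<subseteq> U \<inter> enlarge X d D r"
    then have "R r \<V> \<W>" unfolding R_def by blast
    then show ?thesis by blast
  qed
  have ex': "\<exists>\<W>'. R r \<W> \<W>'" if W: "R r' \<V> \<W>" and r: "0 < r" for r r' \<V> \<W>
  proof (rule ex[OF _ _ r])
    show "openin X U" if "U \<in> \<W>" for U using W that by (simp add: R_def open_cover_def)
    show "\<exists>U\<in>\<W>. D \<subseteq> U" if "D \<in> \<D>" for D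
      using saturated_cover_contains[OF D _ _ that, of \<W>] W unfolding R_def by blast
  qed
  obtain \<W>0 where W0: "R 1 \<U> \<W>0" using ex[OF U] by fastforce
  define g where "g r \<W> = (SOME \<W>'. R r \<W> \<W>')" for r \<W>
  have g: "R r \<W> (g r \<W>)" if "R r' \<V> \<W>" "0 < r" for r r' \<V> \<W>
    unfolding g_def using someI_ex[OF ex'[OF that]] .
  define \<W> where "\<W> = rec_nat \<W>0 (\<lambda>n \<V>. g (1 / 2 ^ Suc n) \<V>)"
  have WS: "\<W> 0 = \<W>0" "\<W> (Suc n) = g (1 / 2 ^ Suc n) (\<W> n)" for n by (simp_all add: \<W>_def)
  have RS: "\<exists>\<V>. R (1 / 2 ^ n) \<V> (\<W> n)" for n
  proof (induction n)
    case 0 then show ?case using W0 WS by auto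
  next
    case (Suc n)
    then obtain \<V> where "R (1 / 2 ^ n) \<V> (\<W> n)" by blast
    from g[OF this, of "1 / 2 ^ Suc n"] show ?case using WS(2)[of n] by auto
  qed
  have RS': "R (1 / 2 ^ Suc n) (\<W> n) (\<W> (Suc n))" for n
  proof -
    obtain \<V> where "R (1 / 2 ^ n) \<V> (\<W> n)" using RS by blast
    from g[OF this, of "1 / 2 ^ Suc n"] show ?thesis using WS(2)[of n] by simp
  qed
  show ?thesis
  proof (rule that[of \<W>])
    fix n
    obtain \<V> where V: "R (1 / 2 ^ n) \<V> (\<W> n)" using RS by blast
    show "open_cover X (\<W> n)" using V by (simp add: R_def)
    show "saturated \<D> W" if "W \<in> \<W> n" for W using V that by (simp add: R_def)
    fix x assume x: "x \<in> topspace X"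
    show "\<exists>D\<in>\<D>. \<forall>W\<in>\<W> n. x \<in> W \<longrightarrow> W \<subseteq> enlarge X d D (1 / 2 ^ n)"
      using V x unfolding R_def by (meson le_inf_iff)
    show "\<exists>U\<in>\<W> n. \<forall>W\<in>\<W> (Suc n). x \<in> W \<longrightarrow> W \<subseteq> U"
      using RS'[of n] x unfolding R_def by (meson le_inf_iff)
  next
    fix x assume x: "x \<in> topspace X"
    show "\<exists>U\<in>\<U>. \<forall>W\<in>\<W> 0. x \<in> W \<longrightarrow> W \<subseteq> U"
      using W0 x unfolding R_def WS(1) by (meson le_inf_iff)
  qed
qed

text \<open>An element \<open>C\<close> passing close enough to \<open>D\<close> stays entirely
  close to \<open>D\<close> by upper semicontinuity, so \<open>y\<close>, being close to
  \<open>C\<close>, is close to \<open>D\<close>. The compact set \<open>D\<close> has positive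
  distance from a disjoint closed set \<open>E\<close>, which excludes
  \<open>D \<noteq> E\<close>.\<close>

lemma decomposition_separated:
  assumes d: "complete_metric_for X d" and D: "decomposition X \<D>" and v: "vanishing X \<D>"
    and x: "x \<in> D" "D \<in> \<D>" and y: "y \<in> E" "E \<in> \<D>"
    and near: "\<And>n. \<exists>C\<in>\<D>. x \<in> enlarge X d C (1 / 2 ^ n) \<and> y \<in> enlarge X d C (1 / 2 ^ n)"
  shows "D = E"
proof (rule ccontr)
  assume n: "D \<noteq> E"
  interpret Metric_space "topspace X" d using complete_metric_forD[OF d] by simp
  have X: "metrizable_space X" using complete_metric_for_imp_metrizable[OF d] .
  note DX = decomposition_subset[OF D x(2)]
  have comp: "compactin X D" using D x by (simp add: decomposition_def)
  have "openin X (topspace X - E)"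
    using decomposition_closedin[OF metrizable_imp_Hausdorff_space[OF X] D y(2)] by (simp add: closedin_def)
  moreover have "D \<subseteq> topspace X - E" using DX decomposition_eqI[OF D x(2) y(2)] n by blast
  ultimately obtain \<rho> where \<rho>: "\<rho> > 0" "enlarge X d D \<rho> \<subseteq> topspace X - E" using compact_enlarge[OF d comp] by metis
  let ?S = "saturated_interior \<D> (enlarge X d D (\<rho> / 2))"
  have "openin X ?S" using openin_saturated_interior[OF X D v openin_enlarge[OF d DX]] .
  moreover have "D \<subseteq> ?S" using subset_saturated_interior[OF x(2) subset_enlarge[OF d DX]] \<rho> by simp
  ultimately obtain \<delta> where \<delta>: "\<delta> > 0" "enlarge X d D \<delta> \<subseteq> ?S" using compact_enlarge[OF d comp] by metis
  have "min \<delta> (\<rho> / 2) > 0" using \<delta> \<rho> by simp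
  then obtain n where n: "(1 / 2) ^ n < min \<delta> (\<rho> / 2)" using real_arch_pow_inv[of "min \<delta> (\<rho> / 2)" "1 / 2"] by auto
  then have n: "1 / 2 ^ n < \<delta>" "1 / 2 ^ n < \<rho> / 2" by (simp_all add: power_one_over)
  obtain C where C: "C \<in> \<D>" "x \<in> enlarge X d C (1 / 2 ^ n)" "y \<in> enlarge X d C (1 / 2 ^ n)" using near by blast
  note CX = decomposition_subset[OF D C(1)]
  obtain c where c: "c \<in> C" "d c x < 1 / 2 ^ n" using C by (auto simp: enlarge_def)
  obtain c' where c': "c' \<in> C" "d c' y < 1 / 2 ^ n" "y \<in> topspace X" using C by (auto simp: enlarge_def)
  have "d x c < \<delta>" using c n commute[of x c] by simp
  then have "c \<in> enlarge X d D \<delta>" using x c CX unfolding enlarge_def by blast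
  then have "C \<inter> ?S \<noteq> {}" using \<delta> c by blast
  from saturated_meets[OF D saturated_saturated_interior C(1) this]
  have "c' \<in> enlarge X d D (\<rho> / 2)" using saturated_interior_subset[of \<D> "enlarge X d D (\<rho> / 2)"] c' by blast
  then obtain a where a: "a \<in> D" "d a c' < \<rho> / 2" by (auto simp: enlarge_def)
  have aX: "a \<in> topspace X" and cX': "c' \<in> topspace X" using a c' DX CX by blast+
  have "d a y < \<rho>" using triangle[OF aX cX' c'(3)] a c' n by linarith
  then have "y \<in> enlarge X d D \<rho>" using a c' unfolding enlarge_def by blast
  then show False using \<rho> y by blast
qed

text \<open>Each step precomposes \<open>s n\<close> with a homeomorphism \<open>t\<close> supplied
  by shrinkability. Uniform control of the inverses, which compactness would give, is obtained by
  enlarging the metric: \<open>e (Suc n)\<close> is chosen after \<open>s (Suc n)\<close>, so that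
  points closer than 1 have preimages in a common member of \<open>\<W> (Suc n)\<close>. The metrics
  increase, so an estimate in a late one holds in all earlier ones. The indices in the last claim
  are shifted because the smallness reached at one stage bounds the move of the next.\<close>

lemma shrinking_sequence:
  fixes \<W> :: "nat \<Rightarrow> 'a set set"
  assumes d: "complete_metric_for X d" and D: "decomposition X \<D>" and v: "vanishing X \<D>"
    and shr: "shrinkable X \<D>"
    and W: "\<And>n. open_cover X (\<W> n)" "\<And>n W. W \<in> \<W> n \<Longrightarrow> saturated \<D> W"
  obtains s s' e where "\<And>n. homeomorphic_maps X X (s n) (s' n)" "\<And>n. complete_metric_for X (e n)"
    "\<And>x. s 0 x = x" "\<And>n x y. e n x y \<le> e (Suc n) x y"
    "\<And>n x y. \<lbrakk>x \<in> topspace X; y \<in> topspace X; e n x y < 1\<rbrakk> \<Longrightarrow> \<exists>W\<in>\<W> n. s' n x \<in> W \<and> s' n y \<in> W"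
    "\<And>n x. x \<in> topspace X \<Longrightarrow> \<exists>W\<in>\<W> (Suc n). x \<in> W \<and> s' n (s (Suc n) x) \<in> W"
    "\<And>n D x y. \<lbrakk>D \<in> \<D>; x \<in> D; y \<in> D\<rbrakk> \<Longrightarrow> e n (s (Suc n) x) (s (Suc n) y) < (1 / 8) / 2 ^ n"
    "\<And>n x. x \<in> topspace X \<Longrightarrow> e n (s (Suc n) x) (s (Suc (Suc n)) x) < (1 / 8) / 2 ^ n"
proof -
  have X: "metrizable_space X" using complete_metric_for_imp_metrizable[OF d] .
  define P where "P n q \<longleftrightarrow> (case q of (s, s', \<S>, e) \<Rightarrow>
    homeomorphic_maps X X s s' \<and> open_cover X \<S> \<and> (\<forall>D\<in>\<D>. \<exists>S\<in>\<S>. s ` D \<subseteq> S) \<and> complete_metric_for X e \<and>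
    (\<forall>x\<in>topspace X. \<forall>y\<in>topspace X. e x y < 1 \<longrightarrow> (\<exists>W\<in>\<W> n. s' x \<in> W \<and> s' y \<in> W)))"
    for n and q :: "('a \<Rightarrow> 'a) \<times> ('a \<Rightarrow> 'a) \<times> 'a set set \<times> ('a \<Rightarrow> 'a \<Rightarrow> real)"
  define Q where "Q n q q1 \<longleftrightarrow> (case q of (s, s', \<S>, e) \<Rightarrow> case q1 of (s1, s1', \<S>1, e1) \<Rightarrow>
    (\<forall>x y. e x y \<le> e1 x y) \<and> (\<forall>x\<in>topspace X. \<exists>S\<in>\<S>. s x \<in> S \<and> s1 x \<in> S) \<and>
    (\<forall>x\<in>topspace X. \<exists>W\<in>\<W> (Suc n). x \<in> W \<and> s' (s1 x) \<in> W) \<and>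
    (\<forall>S\<in>\<S>1. \<forall>x\<in>S. \<forall>y\<in>S. e x y < (1 / 8) / 2 ^ n))"
    for n and q q1 :: "('a \<Rightarrow> 'a) \<times> ('a \<Rightarrow> 'a) \<times> 'a set set \<times> ('a \<Rightarrow> 'a \<Rightarrow> real)"
  \<comment> \<open>The initial cover \<open>{topspace X}\<close> puts no bound on the first move,
    which is only restricted by the cover \<open>\<W> 1\<close>.\<close>
  have init: "\<exists>e. P 0 (\<lambda>x. x, \<lambda>x. x, {topspace X}, e)"
  proof (rule complete_metric_for_refine[OF d W(1)[of 0]])
    fix e assume e: "complete_metric_for X e" "\<And>x y. d x y \<le> e x y"
      "\<And>x y. \<lbrakk>x \<in> topspace X; y \<in> topspace X; e x y < 1\<rbrakk> \<Longrightarrow> \<exists>U\<in>\<W> 0. x \<in> U \<and> y \<in> U"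
    have "homeomorphic_maps X X (\<lambda>x. x) (\<lambda>x. x)" by (simp add: homeomorphic_maps_def)
    moreover have "open_cover X {topspace X}" by (simp add: open_cover_def)
    ultimately have "P 0 (\<lambda>x. x, \<lambda>x. x, {topspace X}, e)"
      using e decomposition_subset[OF D] by (simp add: P_def)
    then show ?thesis by blast
  qed
  have step: "\<exists>q1. P (Suc n) q1 \<and> Q n q q1" if q: "P n q" for n q
  proof -
    obtain s s' \<S> e where q_eq: "q = (s, s', \<S>, e)" by (cases q)
    have s: "homeomorphic_maps X X s s'" and S: "open_cover X \<S>"
      and DS: "\<And>D. D \<in> \<D> \<Longrightarrow> \<exists>S\<in>\<S>. s ` D \<subseteq> S" and e: "complete_metric_for X e"
      using q unfolding P_def q_eq by simp_all
    interpret Metric_space "topspace X" e using complete_metric_forD[OF e] by simp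
    have top: "mtopology = X" using complete_metric_forD(2)[OF e] .
    note sD = homeomorphic_mapsD[OF s]
    have cs: "continuous_map X X s" using s by (simp add: homeomorphic_maps_def)
    define \<rho> :: real where "\<rho> = (1 / 16) / 2 ^ n"
    have \<rho>: "\<rho> > 0" "2 * \<rho> = (1 / 8) / 2 ^ n" by (simp_all add: \<rho>_def)
    \<comment> \<open>The factor \<open>W\<close> keeps \<open>t x\<close> near \<open>x\<close> in
      the normal sequence, the preimage of \<open>S\<close> keeps \<open>s (t x)\<close> near
      \<open>s x\<close>. The saturated interiors of these sets still cover, because each whole
      element lies in some \<open>W\<close> and its image in some \<open>S\<close>.\<close>
    define \<U> where "\<U> = {saturated_interior \<D> (W \<inter> {x \<in> topspace X. s x \<in> S}) | W S. W \<in> \<W> (Suc n) \<and> S \<in> \<S>}"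
    have preo: "openin X {x \<in> topspace X. s x \<in> S}" if "openin X S" for S
      using openin_continuous_map_preimage[OF cs that] .
    have U: "open_cover X \<U>"
      unfolding open_cover_def
    proof
      show op: "\<forall>U\<in>\<U>. openin X U"
      proof
        fix T assume "T \<in> \<U>"
        then obtain W S where WS: "W \<in> \<W> (Suc n)" "S \<in> \<S>"
          "T = saturated_interior \<D> (W \<inter> {x \<in> topspace X. s x \<in> S})" unfolding \<U>_def by blast
        have "openin X W" "openin X S" using WS(1,2) W(1)[of "Suc n"] S by (simp_all add: open_cover_def)
        then have "openin X (W \<inter> {x \<in> topspace X. s x \<in> S})" using preo by (simp add: openin_Int)
        then show "openin X T" unfolding WS(3) by (rule openin_saturated_interior[OF X D v])
      qed
      have "topspace X \<subseteq> \<Union>\<U>"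
      proof
        fix x assume x: "x \<in> topspace X"
        note E = decomp_map_in[OF D x]
        let ?E = "decomp_map \<D> x"
        have "\<exists>W\<in>\<W> (Suc n). ?E \<subseteq> W"
          by (rule saturated_cover_contains[OF D W(1)[of "Suc n"] W(2)[where n = "Suc n"] E(1)])
        then obtain W where W': "W \<in> \<W> (Suc n)" "?E \<subseteq> W" by blast
        obtain S where S': "S \<in> \<S>" "s ` ?E \<subseteq> S" using DS[OF E(1)] by blast
        have "?E \<subseteq> W \<inter> {x \<in> topspace X. s x \<in> S}" using W' S' decomposition_subset[OF D E(1)] by blast
        from subset_saturated_interior[OF E(1) this] E(2)
        have "x \<in> saturated_interior \<D> (W \<inter> {x \<in> topspace X. s x \<in> S})" by blast
        moreover have "saturated_interior \<D> (W \<inter> {x \<in> topspace X. s x \<in> S}) \<in> \<U>"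
          unfolding \<U>_def using W'(1) S'(1) by blast
        ultimately show "x \<in> \<Union>\<U>" by (rule UnionI[rotated])
      qed
      then show "\<Union>\<U> = topspace X" using op openin_subset by blast
    qed
    have Usat: "\<forall>U\<in>\<U>. saturated \<D> U" using saturated_saturated_interior by (auto simp: \<U>_def)
    have ball: "openin X (mball y \<rho>)" for y using openin_mball[of y \<rho>] unfolding top .
    define \<V> where "\<V> = (\<lambda>y. {x \<in> topspace X. s x \<in> mball y \<rho>}) ` topspace X"
    have V: "open_cover X \<V>"
      unfolding open_cover_def
    proof
      show op: "\<forall>U\<in>\<V>. openin X U" unfolding \<V>_def using preo[OF ball] by (simp del: in_mball)
      have "topspace X \<subseteq> \<Union>\<V>"
      proof
        fix x assume x: "x \<in> topspace X"
        then have "x \<in> {x' \<in> topspace X. s x' \<in> mball (s x) \<rho>}" using sD(1) \<rho> by simp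
        then show "x \<in> \<Union>\<V>" unfolding \<V>_def using sD(1)[OF x] by blast
      qed
      then show "\<Union>\<V> = topspace X" using op openin_subset by blast
    qed
    have "\<exists>h. homeomorphic_map X X h \<and> maps_close_on (topspace X) h id \<U> \<and> family_inscribed {h ` D | D. D \<in> \<D>} \<V>"
      using shr U Usat V unfolding shrinkable_def by simp
    then obtain t where t0: "homeomorphic_map X X t \<and> maps_close_on (topspace X) t id \<U> \<and>
        family_inscribed {t ` D | D. D \<in> \<D>} \<V>" by (rule exE)
    then obtain t' where t: "homeomorphic_maps X X t t'" using homeomorphic_map_maps by blast
    note tD = homeomorphic_mapsD[OF t]
    have close: "\<exists>U\<in>\<U>. x \<in> U \<and> t x \<in> U" if x: "x \<in> topspace X" for x
    proof (cases "t x = x")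
      case True
      have "x \<in> \<Union>\<U>" using U x by (simp add: open_cover_def)
      then show ?thesis using True by auto
    next
      case False
      then show ?thesis using t0 x unfolding maps_close_on_def by auto
    qed
    define s1 where "s1 x = s (t x)" for x
    define s1' where "s1' x = t' (s' x)" for x
    have s1: "homeomorphic_maps X X s1 s1'"
      using homeomorphic_maps_compose'[OF t s] unfolding s1_def[abs_def] s1'_def[abs_def] .
    note s1D = homeomorphic_mapsD[OF s1]
    define \<S>1 where "\<S>1 = (\<lambda>y. mball y \<rho>) ` topspace X"
    have S1: "open_cover X \<S>1"
      unfolding open_cover_def
    proof
      show op: "\<forall>U\<in>\<S>1. openin X U" unfolding \<S>1_def using ball by simp
      have "topspace X \<subseteq> \<Union>\<S>1" using \<rho> by (auto simp: \<S>1_def)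
      then show "\<Union>\<S>1 = topspace X" using op openin_subset by blast
    qed
    have DS1: "\<exists>S\<in>\<S>1. s1 ` E \<subseteq> S" if E: "E \<in> \<D>" for E
    proof -
      have "t ` E \<in> {t ` D | D. D \<in> \<D>}" using E by blast
      from bspec[OF conjunct2[OF conjunct2[OF t0], unfolded family_inscribed_def] this]
      obtain V where "V \<in> \<V>" "t ` E \<subseteq> V" by (rule bexE)
      then obtain y where y: "y \<in> topspace X" "t ` E \<subseteq> {x \<in> topspace X. s x \<in> mball y \<rho>}" by (auto simp: \<V>_def)
      have "s1 ` E \<subseteq> mball y \<rho>"
      proof
        fix z assume "z \<in> s1 ` E"
        then obtain x where x: "x \<in> E" "z = s (t x)" by (auto simp: s1_def)
        then have "t x \<in> {x \<in> topspace X. s x \<in> mball y \<rho>}" using y(2) by blast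
        then show "z \<in> mball y \<rho>" using x(2) by blast
      qed
      then show ?thesis using y(1) by (auto simp: \<S>1_def)
    qed
    have c1: "open_cover X ((`) s1 ` \<W> (Suc n))"
      unfolding open_cover_def
    proof
      show op: "\<forall>U\<in>(`) s1 ` \<W> (Suc n). openin X U"
        using homeomorphic_maps_openin_image[OF s1] W(1)[of "Suc n"] by (simp add: open_cover_def)
      have "\<Union>((`) s1 ` \<W> (Suc n)) = s1 ` \<Union>(\<W> (Suc n))" by blast
      also have "\<dots> = s1 ` topspace X" using W(1)[of "Suc n"] by (simp add: open_cover_def)
      also have "\<dots> = topspace X"
        using homeomorphic_imp_surjective_map[OF homeomorphic_maps_imp_map[OF s1]] .
      finally show "\<Union>((`) s1 ` \<W> (Suc n)) = topspace X" .
    qed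
    show ?thesis
    proof (rule complete_metric_for_refine[OF e c1])
      fix e1 assume e1: "complete_metric_for X e1" "\<And>x y. e x y \<le> e1 x y"
        and e1': "\<And>x y. \<lbrakk>x \<in> topspace X; y \<in> topspace X; e1 x y < 1\<rbrakk> \<Longrightarrow> \<exists>U\<in>(`) s1 ` \<W> (Suc n). x \<in> U \<and> y \<in> U"
      have "\<exists>W\<in>\<W> (Suc n). s1' x \<in> W \<and> s1' y \<in> W"
        if xy: "x \<in> topspace X" "y \<in> topspace X" "e1 x y < 1" for x y
      proof -
        obtain W' where W': "W' \<in> \<W> (Suc n)" "x \<in> s1 ` W'" "y \<in> s1 ` W'" using e1'[OF xy] by blast
        have "W' \<subseteq> topspace X" using W(1)[of "Suc n"] W'(1) openin_subset by (auto simp: open_cover_def)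
        then have "s1' ` s1 ` W' = W'" by (rule homeomorphic_maps_image_image[OF s1])
        then have "s1' x \<in> W'" "s1' y \<in> W'" using W'(2,3) by blast+
        then show ?thesis using W'(1) by blast
      qed
      then have "P (Suc n) (s1, s1', \<S>1, e1)"
        using s1 S1 DS1 e1(1) by (simp add: P_def)
      moreover have "Q n q (s1, s1', \<S>1, e1)"
        unfolding Q_def q_eq prod.case
      proof (intro conjI allI ballI)
        show "e x y \<le> e1 x y" for x y by (rule e1(2))
        fix x assume x: "x \<in> topspace X"
        obtain U where "U \<in> \<U>" "x \<in> U" "t x \<in> U" using close[OF x] by blast
        then obtain W' S' where WS: "W' \<in> \<W> (Suc n)" "S' \<in> \<S>"
          "x \<in> saturated_interior \<D> (W' \<inter> {x \<in> topspace X. s x \<in> S'})"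
          "t x \<in> saturated_interior \<D> (W' \<inter> {x \<in> topspace X. s x \<in> S'})" by (auto simp: \<U>_def)
        then have xx: "x \<in> W' \<inter> {x \<in> topspace X. s x \<in> S'}" "t x \<in> W' \<inter> {x \<in> topspace X. s x \<in> S'}"
          using subsetD[OF saturated_interior_subset] WS(3,4) by metis+
        then show "\<exists>S\<in>\<S>. s x \<in> S \<and> s1 x \<in> S" using WS(2) unfolding s1_def by blast
        have "s' (s1 x) = t x" using sD(3)[OF tD(1)[OF x]] by (simp add: s1_def)
        then show "\<exists>W\<in>\<W> (Suc n). x \<in> W \<and> s' (s1 x) \<in> W" using WS(1) xx by auto
      next
        fix S x y assume S: "S \<in> \<S>1" and xy: "x \<in> S" "y \<in> S"
        then obtain z where z: "z \<in> topspace X" "x \<in> mball z \<rho>" "y \<in> mball z \<rho>" by (auto simp: \<S>1_def)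
        then have "e x y \<le> e z x + e z y" by (intro triangle'') auto
        moreover have "e z x < \<rho>" "e z y < \<rho>" using z by simp_all
        ultimately show "e x y < (1 / 8) / 2 ^ n" using \<rho>(2) by linarith
      qed
      ultimately show ?thesis by blast
    qed
  qed
  obtain e0 where e0: "P 0 (\<lambda>x. x, \<lambda>x. x, {topspace X}, e0)" using init by blast
  obtain g where g: "\<And>n q. P n q \<Longrightarrow> P (Suc n) (g n q) \<and> Q n q (g n q)" using step by metis
  define f where "f = rec_nat (\<lambda>x. x, \<lambda>x. x, {topspace X}, e0) g"
  have f0: "f 0 = (\<lambda>x. x, \<lambda>x. x, {topspace X}, e0)" and fS: "f (Suc n) = g n (f n)" for n by (simp_all add: f_def)
  have fP: "P n (f n)" for n by (induction n) (use e0 g f0 fS in auto)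
  have fQ: "Q n (f n) (f (Suc n))" for n using g[OF fP] fS by simp
  define s where "s n = fst (f n)" for n
  define s' where "s' n = fst (snd (f n))" for n
  define \<S> where "\<S> n = fst (snd (snd (f n)))" for n
  define e where "e n = snd (snd (snd (f n)))" for n
  have fe: "f n = (s n, s' n, \<S> n, e n)" for n by (simp add: s_def s'_def \<S>_def e_def)
  note P = fP[unfolded fe P_def prod.case] and Q = fQ[unfolded fe Q_def prod.case]
  have Q4: "e n x y < (1 / 8) / 2 ^ n" if "S \<in> \<S> (Suc n)" "x \<in> S" "y \<in> S" for n S x y
    using Q[of n] that by blast
  show ?thesis
  proof (rule that[of s s' e])
    show "homeomorphic_maps X X (s n) (s' n)" "complete_metric_for X (e n)" for n using P[of n] by blast+
    show "s 0 x = x" for x using f0 by (simp add: s_def)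
    show "e n x y \<le> e (Suc n) x y" for n x y using Q[of n] by blast
    show "\<exists>W\<in>\<W> n. s' n x \<in> W \<and> s' n y \<in> W" if "x \<in> topspace X" "y \<in> topspace X" "e n x y < 1" for n x y
      using P[of n] that by blast
    show "\<exists>W\<in>\<W> (Suc n). x \<in> W \<and> s' n (s (Suc n) x) \<in> W" if "x \<in> topspace X" for n x
      using Q[of n] that by blast
    show "e n (s (Suc n) x) (s (Suc n) y) < (1 / 8) / 2 ^ n" if xy: "E \<in> \<D>" "x \<in> E" "y \<in> E" for n E x y
    proof -
      obtain S where S: "S \<in> \<S> (Suc n)" "s (Suc n) ` E \<subseteq> S" using P[of "Suc n"] xy(1) by blast
      show ?thesis by (rule Q4[OF S(1)]) (use S(2) xy in blast)+
    qed
    show "e n (s (Suc n) x) (s (Suc (Suc n)) x) < (1 / 8) / 2 ^ n" if x: "x \<in> topspace X" for n x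
    proof -
      obtain S where S: "S \<in> \<S> (Suc n)" "s (Suc n) x \<in> S" "s (Suc (Suc n)) x \<in> S"
        using Q[of "Suc n"] x by blast
      then show ?thesis by (rule Q4)
    qed
  qed
qed

text \<open>Compact sets are totally bounded, and for every \<open>\<epsilon>\<close> a tail of the
  sequence lies \<open>\<epsilon>\<close>-near to one of them, so the range is totally bounded;
  completeness turns a Cauchy subsequence into a convergent one.\<close>

lemma sequence_near_compacts_subsequence:
  fixes z :: "nat \<Rightarrow> 'a"
  assumes d: "complete_metric_for X d" and z: "range z \<subseteq> topspace X"
    and near: "\<And>\<epsilon>. 0 < \<epsilon> \<Longrightarrow> \<exists>C N. compactin X C \<and> (\<forall>i\<ge>N. z i \<in> enlarge X d C \<epsilon>)"
  obtains r x where "strict_mono r" "limitin X (z \<circ> r) x sequentially"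
proof -
  interpret Metric_space "topspace X" d using complete_metric_forD[OF d] by simp
  have top: "mtopology = X" using complete_metric_forD(2)[OF d] .
  have "mtotally_bounded (range z)"
    unfolding mtotally_bounded_def
  proof (intro allI impI)
    fix \<epsilon> :: real assume e: "\<epsilon> > 0"
    then have "\<epsilon> / 4 > 0" by simp
    from near[OF this] obtain C N where C: "compactin X C" "\<forall>i\<ge>N. z i \<in> enlarge X d C (\<epsilon> / 4)" by blast
    have CX: "C \<subseteq> topspace X" using compactin_subset_topspace[OF C(1)] .
    have "mtotally_bounded C" using C(1) top by (simp add: compactin_imp_mtotally_bounded)
    then obtain K where K: "finite K" "K \<subseteq> C" "C \<subseteq> (\<Union>x\<in>K. mball x (\<epsilon> / 4))"
      unfolding mtotally_bounded_def using \<open>\<epsilon> / 4 > 0\<close> by meson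
    \<comment> \<open>Total boundedness asks for centres in the range of \<open>z\<close>, so each
      \<open>k\<close> is replaced by a nearby term. If there is none, the index is arbitrary, but
      such a \<open>k\<close> never serves to cover a term.\<close>
    define c where "c k = (SOME i. z i \<in> mball k (\<epsilon> / 2))" for k
    let ?K = "z ` {..<N} \<union> (\<lambda>k. z (c k)) ` K"
    have "range z \<subseteq> (\<Union>x\<in>?K. mball x \<epsilon>)"
    proof
      fix y assume "y \<in> range z"
      then obtain i where i: "y = z i" by blast
      have zi: "z j \<in> topspace X" for j using z by blast
      show "y \<in> (\<Union>x\<in>?K. mball x \<epsilon>)"
      proof (cases "i < N")
        case True
        then have "z i \<in> ?K" by blast
        moreover have "z i \<in> mball (z i) \<epsilon>" using zi e by simp
        ultimately show ?thesis using i by blast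
      next
        case False
        then have "z i \<in> enlarge X d C (\<epsilon> / 4)" using C(2) by simp
        then obtain a where a: "a \<in> C" "d a (z i) < \<epsilon> / 4" by (auto simp: enlarge_def)
        then obtain k where k: "k \<in> K" "a \<in> mball k (\<epsilon> / 4)" using K(3) by blast
        have kX: "k \<in> topspace X" "a \<in> topspace X" "d k a < \<epsilon> / 4" using k(2) by simp_all
        have "d k (z i) < \<epsilon> / 2" using triangle[OF kX(1,2) zi[of i]] a(2) kX(3) by linarith
        then have "z i \<in> mball k (\<epsilon> / 2)" using kX zi by simp
        then have "z (c k) \<in> mball k (\<epsilon> / 2)" unfolding c_def by (rule someI)
        then have "d k (z (c k)) < \<epsilon> / 2" by simp
        then have "d (z (c k)) (z i) < \<epsilon>"
          using triangle''[OF zi[of "c k"] kX(1) zi[of i]] \<open>d k (z i) < \<epsilon> / 2\<close> by linarith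
        then have "z i \<in> mball (z (c k)) \<epsilon>" using zi by simp
        then show ?thesis using k(1) i by blast
      qed
    qed
    moreover have "finite ?K" "?K \<subseteq> range z" using K(1) by auto
    ultimately show "\<exists>K. finite K \<and> K \<subseteq> range z \<and> range z \<subseteq> (\<Union>x\<in>K. mball x \<epsilon>)" by blast
  qed
  then obtain r where r: "strict_mono r" "MCauchy (z \<circ> r)"
    unfolding mtotally_bounded_sequentially by blast
  then obtain x where "limitin mtopology (z \<circ> r) x sequentially"
    using complete_metric_forD(3)[OF d] unfolding mcomplete_def by blast
  then show ?thesis using that r(1) top by simp
qed

lemma closedin_sequentially:
  assumes d: "complete_metric_for X d"
  shows "closedin X S \<longleftrightarrow> S \<subseteq> topspace X \<and>
    (\<forall>u l. range u \<subseteq> S \<and> limitin X u l sequentially \<longrightarrow> l \<in> S)"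
  using Metric_space.metric_closedin_iff_sequentially_closed[OF complete_metric_forD(1)[OF d], of S]
  unfolding complete_metric_forD(2)[OF d] .

text \<open>\<open>\<sigma>\<close> is the limit of the \<open>s n\<close>. Shrinking the elements
  makes it constant on each of them; following the normal sequence makes it separate them, since
  points with the same image lie near a common element at every scale. Closedness, automatic for
  compact \<open>X\<close>, is the delicate point: points whose images converge are eventually near
  a compact element at every scale, hence have a convergent subsequence.\<close>

lemma shrinking_limit:
  assumes d: "complete_metric_for X d" and D: "decomposition X \<D>" and v: "vanishing X \<D>"
    and shr: "shrinkable X \<D>"
    and U: "\<And>U. U \<in> \<U> \<Longrightarrow> openin X U" "\<And>D. D \<in> \<D> \<Longrightarrow> \<exists>U\<in>\<U>. D \<subseteq> U"
  obtains \<sigma> where "continuous_map X X \<sigma>" "closed_map X X \<sigma>" "\<sigma> ` topspace X = topspace X"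
    "\<And>D x y. \<lbrakk>D \<in> \<D>; x \<in> D; y \<in> D\<rbrakk> \<Longrightarrow> \<sigma> x = \<sigma> y"
    "\<And>D E x y. \<lbrakk>D \<in> \<D>; E \<in> \<D>; x \<in> D; y \<in> E; \<sigma> x = \<sigma> y\<rbrakk> \<Longrightarrow> D = E"
    "\<And>x. x \<in> topspace X \<Longrightarrow> \<exists>U\<in>\<U>. x \<in> U \<and> \<sigma> x \<in> U"
proof (rule saturated_normal_sequence[OF d D v U])
  fix \<W> :: "nat \<Rightarrow> 'a set set"
  assume W1: "\<And>n. open_cover X (\<W> n)" and W2: "\<And>n W. W \<in> \<W> n \<Longrightarrow> saturated \<D> W"
    and W0: "\<And>x. x \<in> topspace X \<Longrightarrow> \<exists>U\<in>\<U>. \<forall>W\<in>\<W> 0. x \<in> W \<longrightarrow> W \<subseteq> U"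
    and Wb: "\<And>n x. x \<in> topspace X \<Longrightarrow> \<exists>U\<in>\<W> n. \<forall>W\<in>\<W> (Suc n). x \<in> W \<longrightarrow> W \<subseteq> U"
    and Wd: "\<And>n x. x \<in> topspace X \<Longrightarrow> \<exists>D\<in>\<D>. \<forall>W\<in>\<W> n. x \<in> W \<longrightarrow> W \<subseteq> enlarge X d D (1 / 2 ^ n)"
  show ?thesis
  proof (rule shrinking_sequence[OF d D v shr W1 W2])
    fix s s' :: "nat \<Rightarrow> 'a \<Rightarrow> 'a" and e
    assume s: "\<And>n. homeomorphic_maps X X (s n) (s' n)" and e: "\<And>n. complete_metric_for X (e n)"
      and s0: "\<And>x. s 0 x = x" and emono: "\<And>n x y. e n x y \<le> e (Suc n) x y"
      and eW: "\<And>n x y. \<lbrakk>x \<in> topspace X; y \<in> topspace X; e n x y < 1\<rbrakk> \<Longrightarrow> \<exists>W\<in>\<W> n. s' n x \<in> W \<and> s' n y \<in> W"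
      and sW: "\<And>n x. x \<in> topspace X \<Longrightarrow> \<exists>W\<in>\<W> (Suc n). x \<in> W \<and> s' n (s (Suc n) x) \<in> W"
      and sD: "\<And>n D x y. \<lbrakk>D \<in> \<D>; x \<in> D; y \<in> D\<rbrakk> \<Longrightarrow> e n (s (Suc n) x) (s (Suc n) y) < (1 / 8) / 2 ^ n"
      and ss: "\<And>n x. x \<in> topspace X \<Longrightarrow> e n (s (Suc n) x) (s (Suc (Suc n)) x) < (1 / 8) / 2 ^ n"
    have Hd: "Hausdorff_space X"
      using metrizable_imp_Hausdorff_space[OF complete_metric_for_imp_metrizable[OF d]] .
    have WX: "W \<subseteq> topspace X" if "W \<in> \<W> n" for W n
      using W1[of n] that openin_subset by (auto simp: open_cover_def)
    have emon: "e n x y \<le> e m x y" if "n \<le> m" for n m x y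
      using lift_Suc_mono_le[of "\<lambda>n. e n x y", OF emono that] .
    have cs: "continuous_map X X (s n)" and cs': "continuous_map X X (s' n)" for n
      using s[of n] by (simp_all add: homeomorphic_maps_def)
    have sX: "s n x \<in> topspace X" "s' n x \<in> topspace X" if "x \<in> topspace X" for n x
      using homeomorphic_mapsD(1,2)[OF s] that by simp_all
    \<comment> \<open>A limit is taken in each metric \<open>e k\<close>, starting from
      \<open>s (Suc k)\<close>, where the bounds for \<open>e k\<close> begin. These are limits in
      one Hausdorff topology, hence equal, and \<open>\<sigma>\<close> is controlled in all the
      metrics at once. The \<open>1 / 4\<close> is twice the displacement bound
      \<open>1 / 8\<close>.\<close>
    have ex: "\<exists>F. continuous_map X X F \<and> (\<forall>n. \<forall>x\<in>topspace X. e k (s (n + Suc k) x) (F x) \<le> (1 / 4) / 2 ^ n)" for k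
    proof (rule uniform_geometric_limit[OF e[of k], of "\<lambda>n. s (n + Suc k)" "1 / 8"])
      show "continuous_map X X (s (n + Suc k))" for n by (rule cs)
      show "(0::real) \<le> 1 / 8" by simp
      show "e k (s (n + Suc k) x) (s (Suc n + Suc k) x) \<le> (1 / 8) / 2 ^ n" if x: "x \<in> topspace X" for n x
      proof -
        have "e k (s (n + Suc k) x) (s (Suc n + Suc k) x) \<le> e (n + k) (s (n + Suc k) x) (s (Suc n + Suc k) x)"
          by (rule emon) simp
        also have "\<dots> < (1 / 8) / 2 ^ (n + k)" using ss[OF x, of "n + k"] by simp
        also have "\<dots> \<le> (1 / 8) / 2 ^ n" by (intro divide_left_mono power_increasing) auto
        finally show ?thesis by simp
      qed
      fix F assume F: "continuous_map X X F"
        and "\<And>n x. x \<in> topspace X \<Longrightarrow> e k (s (n + Suc k) x) (F x) \<le> 2 * (1 / 8) / 2 ^ n"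
      then have "\<forall>n. \<forall>x\<in>topspace X. e k (s (n + Suc k) x) (F x) \<le> (1 / 4) / 2 ^ n" by simp
      then show "\<exists>F. continuous_map X X F \<and> (\<forall>n. \<forall>x\<in>topspace X. e k (s (n + Suc k) x) (F x) \<le> (1 / 4) / 2 ^ n)"
        using F by blast
    qed
    then obtain F where F: "\<And>k. continuous_map X X (F k) \<and>
        (\<forall>n. \<forall>x\<in>topspace X. e k (s (n + Suc k) x) (F k x) \<le> (1 / 4) / 2 ^ n)" by metis
    define \<sigma> where "\<sigma> = F 0"
    have c\<sigma>: "continuous_map X X \<sigma>" using F by (simp add: \<sigma>_def)
    have FX: "F k x \<in> topspace X" if "x \<in> topspace X" for k x
      using F[of k] that by (auto simp: continuous_map_def)
    have \<sigma>X: "\<sigma> x \<in> topspace X" if "x \<in> topspace X" for x using FX that by (simp add: \<sigma>_def)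
    have limF: "limitin X (\<lambda>n. s n x) (F k x) sequentially" if x: "x \<in> topspace X" for k x
    proof (rule limitin_sequentially_offset_rev[of _ _ "Suc k"])
      show "limitin X (\<lambda>n. s (n + Suc k) x) (F k x) sequentially"
        by (rule limitin_geometric[OF e[of k] FX[OF x] sX(1)[OF x]]) (use F[of k] x in blast)
    qed
    have F\<sigma>: "F k x = \<sigma> x" if x: "x \<in> topspace X" for k x
      unfolding \<sigma>_def using limitin_Hausdorff_unique[OF limF[OF x] limF[OF x] _ Hd] by simp
    have near: "e k (s (n + Suc k) x) (\<sigma> x) \<le> (1 / 4) / 2 ^ n" if x: "x \<in> topspace X" for k n x
      using F[of k] F\<sigma>[OF x] x by metis
    \<comment> \<open>The middle point is \<open>s' k (s (Suc k) x)\<close>: it shares a member with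
      \<open>x\<close> by the construction of the step, and one with
      \<open>s' k (\<sigma> x)\<close> because \<open>s (Suc k) x\<close> and
      \<open>\<sigma> x\<close> are less than 1 apart in \<open>e k\<close>. In \<open>star\<close>,
      barycentric refinement at this point merges both members into one of the previous
      stage.\<close>
    have mid: "\<exists>W\<in>\<W> k. \<exists>W'\<in>\<W> k. \<exists>p\<in>topspace X. p \<in> W \<and> p \<in> W' \<and> x \<in> W \<and> s' k (\<sigma> x) \<in> W'"
      if x: "x \<in> topspace X" for k x
    proof -
      let ?p = "s' k (s (Suc k) x)"
      have pX: "?p \<in> topspace X" using sX x by blast
      obtain V where V: "V \<in> \<W> (Suc k)" "x \<in> V" "?p \<in> V" using sW[OF x] by blast
      obtain W where W: "W \<in> \<W> k" "V \<subseteq> W" using Wb[OF pX, of k] V by blast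
      have "e k (s (Suc k) x) (\<sigma> x) < 1" using near[OF x, of k 0] by simp
      from eW[OF sX(1)[OF x] \<sigma>X[OF x] this] obtain W' where "W' \<in> \<W> k" "?p \<in> W'" "s' k (\<sigma> x) \<in> W'" by blast
      then show ?thesis using W V pX by blast
    qed
    have star: "\<exists>W\<in>\<W> k. x \<in> W \<and> s' (Suc k) (\<sigma> x) \<in> W" if x: "x \<in> topspace X" for k x
    proof -
      obtain W W' p where *: "W \<in> \<W> (Suc k)" "W' \<in> \<W> (Suc k)" "p \<in> topspace X" "p \<in> W" "p \<in> W'"
        "x \<in> W" "s' (Suc k) (\<sigma> x) \<in> W'" using mid[OF x, of "Suc k"] by blast
      obtain T where T: "T \<in> \<W> k" "\<forall>W\<in>\<W> (Suc k). p \<in> W \<longrightarrow> W \<subseteq> T" using Wb[OF *(3), of k] by blast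
      then have "W \<subseteq> T" "W' \<subseteq> T" using * by simp_all
      then show ?thesis using T(1) * by blast
    qed
    have closed: "closedin X (\<sigma> ` A)" if A: "closedin X A" for A
      unfolding closedin_sequentially[OF d]
    proof (intro conjI allI impI)
      have AX: "A \<subseteq> topspace X" using closedin_subset[OF A] .
      then show "\<sigma> ` A \<subseteq> topspace X" using \<sigma>X by blast
      fix u y assume u: "range u \<subseteq> \<sigma> ` A \<and> limitin X u y sequentially"
      then have yX: "y \<in> topspace X" by (simp add: limitin_def)
      have "\<forall>i. \<exists>a. a \<in> A \<and> u i = \<sigma> a" using u by blast
      then obtain z where z: "\<And>i. z i \<in> A" "\<And>i. u i = \<sigma> (z i)" by metis
      have zX: "z i \<in> topspace X" for i using z(1) AX by blast
      have comp: "\<exists>C N. compactin X C \<and> (\<forall>i\<ge>N. z i \<in> enlarge X d C \<epsilon>)" if eps: "0 < \<epsilon>" for \<epsilon>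
      proof -
        obtain k where "(1 / 2) ^ k < \<epsilon>" using real_arch_pow_inv[OF eps, of "1 / 2"] by auto
        then have k: "1 / 2 ^ k < \<epsilon>" by (simp add: power_one_over)
        \<comment> \<open>A substitute for a preimage of \<open>y\<close>. For large
          \<open>i\<close> the point pulled back from \<open>u i\<close> shares a member with
          \<open>?x\<close> by continuity and one with \<open>z i\<close> by \<open>star\<close>;
          one more refinement puts \<open>z i\<close> and \<open>?x\<close> into a common member of
          \<open>\<W> k\<close>, hence near the element \<open>C\<close> attached to
          \<open>?x\<close>.\<close>
        let ?x = "s' (Suc (Suc k)) y"
        have xX: "?x \<in> topspace X" using sX(2)[OF yX] .
        have "?x \<in> \<Union>(\<W> (Suc k))" using W1[of "Suc k"] xX by (simp add: open_cover_def)
        then obtain W where W: "W \<in> \<W> (Suc k)" "?x \<in> W" by blast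
        have "openin X W" using W1[of "Suc k"] W(1) by (simp add: open_cover_def)
        then have "openin X {w \<in> topspace X. s' (Suc (Suc k)) w \<in> W}"
          using openin_continuous_map_preimage[OF cs'] by blast
        moreover have "y \<in> {w \<in> topspace X. s' (Suc (Suc k)) w \<in> W}" using yX W by blast
        ultimately have "\<exists>N. \<forall>n\<ge>N. u n \<in> {w \<in> topspace X. s' (Suc (Suc k)) w \<in> W}"
          using u unfolding limitin_sequentially by blast
        then obtain N where N: "\<And>n. n \<ge> N \<Longrightarrow> s' (Suc (Suc k)) (u n) \<in> W" by blast
        obtain C where C: "C \<in> \<D>" "\<forall>T\<in>\<W> k. ?x \<in> T \<longrightarrow> T \<subseteq> enlarge X d C (1 / 2 ^ k)"
          using Wd[OF xX, of k] by blast
        have "z i \<in> enlarge X d C \<epsilon>" if i: "i \<ge> N" for i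
        proof -
          let ?p = "s' (Suc (Suc k)) (u i)"
          have pX: "?p \<in> topspace X" using N[OF i] WX[OF W(1)] by blast
          obtain W' where W': "W' \<in> \<W> (Suc k)" "z i \<in> W'" "?p \<in> W'"
            using star[OF zX, of "Suc k" i] z(2)[of i] by auto
          obtain T where T: "T \<in> \<W> k" "\<forall>W\<in>\<W> (Suc k). ?p \<in> W \<longrightarrow> W \<subseteq> T" using Wb[OF pX, of k] by blast
          have "W \<subseteq> T" "W' \<subseteq> T" using T(2) W(1) W' N[OF i] by simp_all
          then have "?x \<in> T" "z i \<in> T" using W(2) W'(2) by blast+
          then have "z i \<in> enlarge X d C (1 / 2 ^ k)" using C(2) T(1) by blast
          then show ?thesis using enlarge_mono[of "1 / 2 ^ k" \<epsilon> X d C] k by auto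
        qed
        moreover have "compactin X C" using D C(1) by (simp add: decomposition_def)
        ultimately show ?thesis by blast
      qed
      have "range z \<subseteq> topspace X" using zX by blast
      from sequence_near_compacts_subsequence[OF d this comp]
      obtain r x where r: "strict_mono r" "limitin X (z \<circ> r) x sequentially" by metis
      have "range (z \<circ> r) \<subseteq> A" using z(1) by auto
      then have "x \<in> A" using A r(2) closedin_sequentially[OF d, of A] by blast
      have L1: "limitin X (\<sigma> \<circ> (z \<circ> r)) (\<sigma> x) sequentially" using continuous_map_limit[OF c\<sigma> r(2)] .
      have L2: "limitin X (\<sigma> \<circ> (z \<circ> r)) y sequentially"
      proof -
        have "limitin X (u \<circ> r) y sequentially" using limitin_subsequence[OF r(1) conjunct2[OF u]] .
        moreover have "u \<circ> r = \<sigma> \<circ> (z \<circ> r)" using z(2) by auto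
        ultimately show ?thesis by simp
      qed
      have "\<sigma> x = y" using limitin_Hausdorff_unique[OF L1 L2 _ Hd] by simp
      then show "y \<in> \<sigma> ` A" using \<open>x \<in> A\<close> by blast
    qed
    have surj: "\<sigma> ` topspace X = topspace X"
    proof
      show "\<sigma> ` topspace X \<subseteq> topspace X" using \<sigma>X by blast
      show "topspace X \<subseteq> \<sigma> ` topspace X"
      proof
        fix y assume y: "y \<in> topspace X"
        \<comment> \<open>\<open>s' (Suc n) y\<close> is an approximate preimage:
          \<open>\<sigma>\<close> sends it within \<open>(1 / 4) / 2 ^ n\<close> of
          \<open>y\<close>. The image of \<open>\<sigma>\<close> is closed, so it contains
          \<open>y\<close>.\<close>
        define w where "w n = \<sigma> (s' (Suc n) y)" for n
        have wX: "w n \<in> topspace X" for n using \<sigma>X sX(2)[OF y] by (simp add: w_def)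
        interpret E: Metric_space "topspace X" "e 0" using complete_metric_forD[OF e[of 0]] by simp
        have "e 0 (w n) y \<le> (1 / 4) / 2 ^ n" for n
          using near[OF sX(2)[OF y, of "Suc n"], of 0 n] homeomorphic_mapsD(4)[OF s y, of "Suc n"]
            E.commute[of "w n" y] by (simp add: w_def)
        then have "limitin X w y sequentially" by (rule limitin_geometric[OF e[of 0] y wX])
        moreover have "range w \<subseteq> \<sigma> ` topspace X" using sX(2)[OF y] by (auto simp: w_def)
        ultimately show "y \<in> \<sigma> ` topspace X"
          using closed[OF closedin_topspace] closedin_sequentially[OF d, of "\<sigma> ` topspace X"] by blast
      qed
    qed
    show ?thesis
    proof (rule that[OF c\<sigma> _ surj])
      show "closed_map X X \<sigma>" using closed by (simp add: closed_map_def)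
      show "\<sigma> x = \<sigma> y" if xy: "D' \<in> \<D>" "x \<in> D'" "y \<in> D'" for D' x y
      proof -
        interpret E: Metric_space "topspace X" "e 0" using complete_metric_forD[OF e[of 0]] by simp
        have X: "x \<in> topspace X" "y \<in> topspace X" using decomposition_subset[OF D xy(1)] xy by blast+
        have L1: "limitin X (\<lambda>n. s (Suc n) x) (\<sigma> y) sequentially"
        proof (rule limitin_geometric[OF e[of 0] \<sigma>X[OF X(2)] sX(1)[OF X(1)]])
          fix n
          have "e 0 (s (Suc n) x) (s (Suc n) y) \<le> e n (s (Suc n) x) (s (Suc n) y)" by (rule emon) simp
          moreover have "e 0 (s (Suc n) y) (\<sigma> y) \<le> (1 / 4) / 2 ^ n" using near[OF X(2), of 0 n] by simp
          moreover have "(3 / 8) / 2 ^ n = (1 / 8) / 2 ^ n + (1 / 4) / (2::real) ^ n" by (simp flip: add_divide_distrib)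
          ultimately show "e 0 (s (Suc n) x) (\<sigma> y) \<le> (3 / 8) / 2 ^ n"
            using sD[OF xy, of n] E.triangle[OF sX(1)[OF X(1)] sX(1)[OF X(2)] \<sigma>X[OF X(2)], of "Suc n" "Suc n"] by linarith
        qed
        have L2: "limitin X (\<lambda>n. s (Suc n) x) (\<sigma> x) sequentially"
          using limitin_sequentially_offset[OF limF[OF X(1), of 0], of 1] by (simp add: \<sigma>_def)
        show ?thesis using limitin_Hausdorff_unique[OF L2 L1 _ Hd] by simp
      qed
      show "D' = E" if DE: "D' \<in> \<D>" "E \<in> \<D>" "x \<in> D'" "y \<in> E" and eq: "\<sigma> x = \<sigma> y" for D' E x y
      proof (rule decomposition_separated[OF d D v DE(3,1,4,2)])
        fix n
        have X: "x \<in> topspace X" "y \<in> topspace X" using decomposition_subset[OF D] DE by blast+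
        let ?p = "s' (Suc n) (\<sigma> x)"
        have pX: "?p \<in> topspace X" using sX(2)[OF \<sigma>X[OF X(1)]] .
        obtain C where C: "C \<in> \<D>" "\<forall>W\<in>\<W> n. ?p \<in> W \<longrightarrow> W \<subseteq> enlarge X d C (1 / 2 ^ n)" using Wd[OF pX, of n] by blast
        have "x \<in> enlarge X d C (1 / 2 ^ n)" using star[OF X(1), of n] C(2) by blast
        moreover have "y \<in> enlarge X d C (1 / 2 ^ n)" using star[OF X(2), of n] C(2) eq by auto
        ultimately show "\<exists>C\<in>\<D>. x \<in> enlarge X d C (1 / 2 ^ n) \<and> y \<in> enlarge X d C (1 / 2 ^ n)" using C(1) by blast
      qed
      show "\<exists>U\<in>\<U>. x \<in> U \<and> \<sigma> x \<in> U" if x: "x \<in> topspace X" for x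
      proof -
        \<comment> \<open>At stage 0 the homeomorphism is the identity, so \<open>mid\<close> speaks
          of \<open>\<sigma> x\<close> itself, and the barycentric refinement of \<open>\<U>\<close>
          applies at \<open>p\<close>.\<close>
        obtain W W' p where *: "W \<in> \<W> 0" "W' \<in> \<W> 0" "p \<in> topspace X" "p \<in> W" "p \<in> W'"
          "x \<in> W" "s' 0 (\<sigma> x) \<in> W'" using mid[OF x, of 0] by blast
        obtain T where T: "T \<in> \<U>" "\<forall>W\<in>\<W> 0. p \<in> W \<longrightarrow> W \<subseteq> T" using W0[OF *(3)] by blast
        have "s' 0 (\<sigma> x) = \<sigma> x" using homeomorphic_mapsD(4)[OF s \<sigma>X[OF x], of 0] s0 by simp
        moreover have "W \<subseteq> T" "W' \<subseteq> T" using T * by simp_all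
        ultimately have "x \<in> T" "\<sigma> x \<in> T" using * by auto
        then show ?thesis using T(1) by blast
      qed
    qed
  qed
qed

text \<open>\<open>\<sigma>\<close> is a quotient map, being continuous, closed and onto, and it has
  the same fibres as the projection to the quotient. Each of the two maps therefore factors through
  the other, and the factors are inverse homeomorphisms.\<close>

lemma shrinking_theorem:
  assumes d: "complete_metric_for X d" and D: "decomposition X \<D>" and v: "vanishing X \<D>"
    and shr: "shrinkable X \<D>"
    and U: "\<And>U. U \<in> \<U> \<Longrightarrow> openin X U" "\<And>D. D \<in> \<D> \<Longrightarrow> \<exists>U\<in>\<U>. D \<subseteq> U"
  obtains g g' where "homeomorphic_maps (decomp_space X \<D>) X g g'"
    "\<And>x. x \<in> topspace X \<Longrightarrow> \<exists>U\<in>\<U>. x \<in> U \<and> g (decomp_map \<D> x) \<in> U"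
proof (rule shrinking_limit[OF d D v shr U])
  let ?Y = "decomp_space X \<D>"
  let ?q = "decomp_map \<D>"
  fix \<sigma> assume \<sigma>: "continuous_map X X \<sigma>" "closed_map X X \<sigma>" "\<sigma> ` topspace X = topspace X"
    and eq1: "\<And>D x y. \<lbrakk>D \<in> \<D>; x \<in> D; y \<in> D\<rbrakk> \<Longrightarrow> \<sigma> x = \<sigma> y"
    and eq2: "\<And>D E x y. \<lbrakk>D \<in> \<D>; E \<in> \<D>; x \<in> D; y \<in> E; \<sigma> x = \<sigma> y\<rbrakk> \<Longrightarrow> D = E"
    and cl: "\<And>x. x \<in> topspace X \<Longrightarrow> \<exists>U\<in>\<U>. x \<in> U \<and> \<sigma> x \<in> U"
  have q: "quotient_map X ?Y ?q" using quotient_map_decomp_map[OF D] .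
  have qs: "quotient_map X X \<sigma>" using continuous_closed_imp_quotient_map[OF \<sigma>] .
  have f1: "\<sigma> x = \<sigma> y" if "x \<in> topspace X" "y \<in> topspace X" "?q x = ?q y" for x y
    by (rule eq1[OF decomp_map_in(1)[OF D that(1)] decomp_map_in(2)[OF D that(1)]])
       (use decomp_map_in(2)[OF D that(2)] that(3) in simp)
  have f2: "?q x = ?q y" if "x \<in> topspace X" "y \<in> topspace X" "\<sigma> x = \<sigma> y" for x y
    by (rule eq2[OF decomp_map_in(1)[OF D that(1)] decomp_map_in(1)[OF D that(2)]
          decomp_map_in(2)[OF D that(1)] decomp_map_in(2)[OF D that(2)] that(3)])
  show ?thesis
  proof (rule quotient_map_lift_exists[OF q \<sigma>(1) f1])
    fix g assume g: "continuous_map ?Y X g" "\<And>x. x \<in> topspace X \<Longrightarrow> g (?q x) = \<sigma> x"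
    show ?thesis
    proof (rule quotient_map_lift_exists[OF qs quotient_imp_continuous_map[OF q] f2])
      fix g' assume g': "continuous_map X ?Y g'" "\<And>x. x \<in> topspace X \<Longrightarrow> g' (\<sigma> x) = ?q x"
      have "homeomorphic_maps ?Y X g g'"
        unfolding homeomorphic_maps_def
      proof (intro conjI ballI g(1) g'(1))
        fix y assume "y \<in> topspace ?Y"
        then obtain x where x: "x \<in> topspace X" "y = ?q x"
          using quotient_imp_surjective_map[OF q] by blast
        then show "g' (g y) = y" using g(2) g'(2) by simp
      next
        fix y assume "y \<in> topspace X"
        then obtain x where x: "x \<in> topspace X" "y = \<sigma> x" using \<sigma>(3) by blast
        then show "g (g' y) = y" using g(2) g'(2) by simp
      qed
      then show ?thesis using that[of g g'] cl g(2) by simp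
    qed
  qed
qed

section \<open>Density of the liftable homeomorphisms\<close>

lemma strongly_shrinkable_imp_shrinkable:
  assumes "decomposition X \<D>" "strongly_shrinkable X \<D>"
  shows "shrinkable X \<D>"
proof -
  have "saturated \<D> (topspace X)" using assms(1) unfolding saturated_def decomposition_def by blast
  then have "shrinkable (subtopology X (topspace X)) {D \<in> \<D>. D \<subseteq> topspace X}"
    using assms(2) unfolding strongly_shrinkable_def by blast
  moreover have "{D \<in> \<D>. D \<subseteq> topspace X} = \<D>" using decomposition_subset[OF assms(1)] by blast
  ultimately show ?thesis by (simp add: subtopology_topspace)
qed

text \<open>The pullback of \<open>\<rho>\<close> is in general only a pseudometric, as
  \<open>q\<close> need not be injective; the capped summand restores separation and completeness at
  a cost of at most \<open>c\<close>.\<close>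

lemma complete_metric_for_pullback:
  assumes d: "complete_metric_for X d" and \<rho>: "Metric_space (topspace Y) \<rho>"
    and top: "Metric_space.mtopology (topspace Y) \<rho> = Y"
    and c: "0 < c" and q: "continuous_map X Y q"
  shows "complete_metric_for X (\<lambda>x y. min c (d x y) + \<rho> (q x) (q y))"
proof (rule complete_metric_for_add[OF complete_metric_for_capped[OF d c]])
  interpret Metric_space "topspace Y" \<rho> by (rule \<rho>)
  have qY: "q x \<in> topspace Y" if "x \<in> topspace X" for x using q that by (auto simp: continuous_map_def)
  show "0 \<le> \<rho> (q x) (q y)" for x y by simp
  show "\<rho> (q x) (q y) = \<rho> (q y) (q x)" for x y by (rule commute)
  show "\<rho> (q x) (q x) = 0" if "x \<in> topspace X" for x using qY[OF that] by simp
  show "\<rho> (q x) (q z) \<le> \<rho> (q x) (q y) + \<rho> (q y) (q z)"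
    if "x \<in> topspace X" "y \<in> topspace X" "z \<in> topspace X" for x y z
    using triangle qY that by blast
  show "\<exists>U. openin X U \<and> x \<in> U \<and> (\<forall>y\<in>U. \<rho> (q x) (q y) < e)" if x: "x \<in> topspace X" and e: "0 < e" for x e
  proof (intro exI conjI ballI)
    have "openin Y (mball (q x) e)" using openin_mball[of "q x" e] unfolding top .
    then show "openin X {y \<in> topspace X. q y \<in> mball (q x) e}" by (rule openin_continuous_map_preimage[OF q])
    show "x \<in> {y \<in> topspace X. q y \<in> mball (q x) e}" using x qY e by simp
    show "\<rho> (q x) (q y) < e" if "y \<in> {y \<in> topspace X. q y \<in> mball (q x) e}" for y using that by simp
  qed
qed

text \<open>The preimages under \<open>p\<close> of \<open>e / 2\<close>-balls are open, and each
  element lies in one of them because \<open>p\<close> is constant on elements. So they serve as the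
  cover in the shrinking theorem, and closeness is read off in \<open>Y\<close>. With
  \<open>p\<close> as a parameter, both decompositions can be measured in one metric on the quotient
  by \<open>\<B>\<close>.\<close>

lemma decomposition_near_homeomorphism:
  assumes d: "complete_metric_for X d" and D: "decomposition X \<D>" and v: "vanishing X \<D>"
    and shr: "shrinkable X \<D>"
    and \<rho>: "Metric_space (topspace Y) \<rho>" and top: "Metric_space.mtopology (topspace Y) \<rho> = Y"
    and p: "continuous_map X Y p" and pD: "\<And>D x y. D \<in> \<D> \<Longrightarrow> x \<in> D \<Longrightarrow> y \<in> D \<Longrightarrow> p x = p y"
    and e: "0 < e"
  obtains g g' where "homeomorphic_maps (decomp_space X \<D>) X g g'"
    "\<And>x. x \<in> topspace X \<Longrightarrow> \<rho> (p x) (p (g (decomp_map \<D> x))) < e"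
proof -
  interpret Metric_space "topspace Y" \<rho> by (rule \<rho>)
  have pY: "p x \<in> topspace Y" if "x \<in> topspace X" for x using p that by (auto simp: continuous_map_def)
  define \<U> where "\<U> = (\<lambda>y. {x \<in> topspace X. p x \<in> mball y (e / 2)}) ` topspace Y"
  have op: "openin X U" if "U \<in> \<U>" for U
  proof -
    obtain y where y: "U = {x \<in> topspace X. p x \<in> mball y (e / 2)}" using \<open>U \<in> \<U>\<close> unfolding \<U>_def by blast
    have "openin Y (mball y (e / 2))" using openin_mball[of y "e / 2"] unfolding top .
    then show ?thesis unfolding y by (rule openin_continuous_map_preimage[OF p])
  qed
  have cov: "\<exists>U\<in>\<U>. E \<subseteq> U" if E: "E \<in> \<D>" for E
  proof -
    have "E \<noteq> {}" using D E by (simp add: decomposition_def)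
    then obtain x where x: "x \<in> E" by blast
    have EX: "E \<subseteq> topspace X" using decomposition_subset[OF D E] .
    then have px: "p x \<in> topspace Y" using pY x by blast
    have "E \<subseteq> {z \<in> topspace X. p z \<in> mball (p x) (e / 2)}"
    proof
      fix z assume z: "z \<in> E"
      then have "p z = p x" using pD[OF E z x] by simp
      then show "z \<in> {z \<in> topspace X. p z \<in> mball (p x) (e / 2)}" using z EX px e by auto
    qed
    then show ?thesis unfolding \<U>_def using px by blast
  qed
  show ?thesis
  proof (rule shrinking_theorem[OF d D v shr op cov])
    fix g g' assume g: "homeomorphic_maps (decomp_space X \<D>) X g g'"
      and cl: "\<And>x. x \<in> topspace X \<Longrightarrow> \<exists>U\<in>\<U>. x \<in> U \<and> g (decomp_map \<D> x) \<in> U"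
    show ?thesis
    proof (rule that[OF g])
      fix x assume "x \<in> topspace X"
      from cl[OF this] obtain y where y: "y \<in> topspace Y" "p x \<in> mball y (e / 2)"
        "p (g (decomp_map \<D> x)) \<in> mball y (e / 2)" unfolding \<U>_def by blast
      then have "\<rho> (p x) (p (g (decomp_map \<D> x))) \<le> \<rho> y (p x) + \<rho> y (p (g (decomp_map \<D> x)))"
        by (intro triangle'') simp_all
      moreover have "\<rho> y (p x) < e / 2" "\<rho> y (p (g (decomp_map \<D> x))) < e / 2" using y by simp_all
      ultimately show "\<rho> (p x) (p (g (decomp_map \<D> x))) < e" by linarith
    qed
  qed
qed

lemma continuous_map_decomp_image:
  assumes A: "decomposition X \<A>" and B: "decomposition X \<B>" and H: "continuous_map X X H"
    and HA: "\<And>D. D \<in> \<A> \<Longrightarrow> H ` D \<in> \<B>"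
  shows "continuous_map (decomp_space X \<A>) (decomp_space X \<B>) ((`) H)"
    "\<And>x. x \<in> topspace X \<Longrightarrow> decomp_map \<B> (H x) = H ` decomp_map \<A> x"
proof -
  show eq: "decomp_map \<B> (H x) = H ` decomp_map \<A> x" if "x \<in> topspace X" for x
    using decomp_map_eq[OF B HA[OF decomp_map_in(1)[OF A that]] imageI[OF decomp_map_in(2)[OF A that]]] .
  have "continuous_map X (decomp_space X \<B>) (decomp_map \<B> \<circ> H)"
    using continuous_map_compose[OF H quotient_imp_continuous_map[OF quotient_map_decomp_map[OF B]]] .
  then have "continuous_map X (decomp_space X \<B>) ((`) H \<circ> decomp_map \<A>)"
    by (rule continuous_map_eq) (simp add: eq)
  then show "continuous_map (decomp_space X \<A>) (decomp_space X \<B>) ((`) H)"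
    by (rule continuous_compose_quotient_map[OF quotient_map_decomp_map[OF A]])
qed

text \<open>Homeomorphisms \<open>gA\<close> and \<open>gB\<close> of the quotients onto
  \<open>X\<close> turn \<open>f\<close> into the homeomorphism
  \<open>h = gB \<circ> f \<circ> gA'\<close> of \<open>X\<close> from which the back-and-forth
  starts. Closeness to \<open>f\<close> is measured by one metric \<open>\<rho>\<close> on the
  quotient by \<open>\<B>\<close>, chosen such that distance below 1 forces a common member of
  \<open>\<U>\<close>.\<close>

lemma liftable_approximation:
  assumes d: "complete_metric_for X d" and K: "tame_family X \<K>"
    and A: "tame_decomposition X \<K> \<A>" and dnA: "dense_decomposition X \<A>"
    and B: "tame_decomposition X \<K> \<B>" and dnB: "dense_decomposition X \<B>"
    and f: "f \<in> homeos (decomp_space X \<A>) (decomp_space X \<B>)"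
    and U: "open_cover (decomp_space X \<B>) \<U>"
  shows "\<exists>\<phi> \<in> homeos (decomp_space X \<A>) (decomp_space X \<B>).
            liftable X \<A> \<B> \<phi> \<and> maps_close_on (topspace (decomp_space X \<A>)) f \<phi> \<U>"
proof -
  let ?Z = "decomp_space X \<A>" and ?Y = "decomp_space X \<B>"
  note AD = tame_decompositionD[OF A] and BD = tame_decompositionD[OF B]
  note tsZ = topspace_decomp_space[OF AD(1)] and tsY = topspace_decomp_space[OF BD(1)]
  have shA: "shrinkable X \<A>" using strongly_shrinkable_imp_shrinkable[OF AD(1,3)] .
  have shB: "shrinkable X \<B>" using strongly_shrinkable_imp_shrinkable[OF BD(1,3)] .
  have cX: "completely_metrizable_space X"
    using Metric_space.completely_metrizable_space_mtopology[OF complete_metric_forD(1,3)[OF d]]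
    by (simp add: complete_metric_forD(2)[OF d])
  \<comment> \<open>The quotient inherits complete metrizability from \<open>X\<close>, to which it
    is homeomorphic by the shrinking theorem; the trivial cover suffices for that.\<close>
  have "completely_metrizable_space ?Y"
  proof (rule shrinking_theorem[OF d BD(1,2) shB, of "{topspace X}"])
    show "openin X V" if "V \<in> {topspace X}" for V using that by simp
    show "\<exists>V\<in>{topspace X}. E \<subseteq> V" if "E \<in> \<B>" for E using decomposition_subset[OF BD(1) that] by simp
    fix g g' assume "homeomorphic_maps ?Y X g g'"
    then have "?Y homeomorphic_space X" by (rule homeomorphic_maps_imp_homeomorphic_space)
    then show ?thesis using cX homeomorphic_completely_metrizable_space by blast
  qed
  then obtain \<rho>0 where \<rho>0: "complete_metric_for ?Y \<rho>0" by (rule complete_metric_for_exists)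
  obtain \<rho> where \<rho>: "complete_metric_for ?Y \<rho>"
    and \<rho>U: "\<And>x y. \<lbrakk>x \<in> topspace ?Y; y \<in> topspace ?Y; \<rho> x y < 1\<rbrakk> \<Longrightarrow> \<exists>V\<in>\<U>. x \<in> V \<and> y \<in> V"
    using complete_metric_for_refine[OF \<rho>0 U] by metis
  note \<rho>D = complete_metric_forD[OF \<rho>]
  interpret R: Metric_space "topspace ?Y" \<rho> using \<rho>D by simp
  have fh: "homeomorphic_map ?Z ?Y f" using f by (simp add: homeos_def)
  then obtain f' where ff: "homeomorphic_maps ?Z ?Y f f'" using homeomorphic_map_maps by blast
  let ?qA = "decomp_map \<A>" and ?q = "decomp_map \<B>"
  define p where "p x = f (?qA x)" for x
  have cqA: "continuous_map X ?Z ?qA" and cq: "continuous_map X ?Y ?q"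
    using quotient_imp_continuous_map[OF quotient_map_decomp_map] AD(1) BD(1) by blast+
  have cp: "continuous_map X ?Y p"
    using continuous_map_compose[OF cqA homeomorphic_imp_continuous_map[OF fh]] unfolding p_def[abs_def] o_def .
  have qY: "?q x \<in> topspace ?Y" "p x \<in> topspace ?Y" if "x \<in> topspace X" for x
    using cq cp that by (auto simp: continuous_map_def)
  have pA: "p x = p y" if "D \<in> \<A>" "x \<in> D" "y \<in> D" for D x y
    using decomp_map_eq[OF AD(1) that(1)] that(2,3) by (simp add: p_def)
  have qB: "?q x = ?q y" if "D \<in> \<B>" "x \<in> D" "y \<in> D" for D x y
    using decomp_map_eq[OF BD(1) that(1)] that(2,3) by simp
  \<comment> \<open>The budget: the start is within \<open>e\<close> of \<open>f\<close> and the
    back-and-forth adds at most \<open>120 * e\<close>, so \<open>121 * e\<close> has to stay below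
    1.\<close>
  define e :: real where "e = 1 / 200"
  have e: "0 < e" "0 < e / 2" by (simp_all add: e_def)
  show ?thesis
  proof (rule decomposition_near_homeomorphism[OF d AD(1,2) shA \<rho>D(1,2) cp pA e(2)],
      assumption, assumption, assumption,
      rule decomposition_near_homeomorphism[OF d BD(1,2) shB \<rho>D(1,2) cq qB e(2)],
      assumption, assumption, assumption)
    fix gA gA' gB gB'
    assume gA: "homeomorphic_maps ?Z X gA gA'" and gA1: "\<And>x. x \<in> topspace X \<Longrightarrow> \<rho> (p x) (p (gA (?qA x))) < e / 2"
      and gB: "homeomorphic_maps ?Y X gB gB'" and gB1: "\<And>x. x \<in> topspace X \<Longrightarrow> \<rho> (?q x) (?q (gB (?q x))) < e / 2"
    define h where "h x = gB (f (gA' x))" for x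
    define k where "k x = gA (f' (gB' x))" for x
    have hk: "homeomorphic_maps X X h k"
      using homeomorphic_maps_compose'[OF homeomorphic_maps_sym'[OF gA] homeomorphic_maps_compose'[OF ff gB]]
      unfolding h_def[abs_def] k_def[abs_def] .
    note hkD = homeomorphic_mapsD[OF hk]
    \<comment> \<open>Write \<open>x = gA (?qA z)\<close>, so that \<open>h x = gB (p z)\<close>:
      both \<open>p x\<close> and \<open>?q (h x)\<close> lie within \<open>e / 2\<close> of
      \<open>p z\<close>.\<close>
    have near: "\<rho> (?q (h x)) (p x) < e" if x: "x \<in> topspace X" for x
    proof -
      have "gA' x \<in> topspace ?Z" using homeomorphic_mapsD(2)[OF gA x] .
      then obtain z where z: "z \<in> topspace X" "gA' x = ?qA z"
        using quotient_imp_surjective_map[OF quotient_map_decomp_map[OF AD(1)]] by blast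
      have gz: "gA (?qA z) = x" using homeomorphic_mapsD(4)[OF gA x] z by simp
      obtain w where w: "w \<in> topspace X" "p z = ?q w"
        using quotient_imp_surjective_map[OF quotient_map_decomp_map[OF BD(1)]] qY(2)[OF z(1)] by blast
      have hx: "h x = gB (?q w)" using z w by (simp add: h_def p_def)
      have 1: "\<rho> (p z) (p x) < e / 2" using gA1[OF z(1)] gz by simp
      have 2: "\<rho> (p z) (?q (h x)) < e / 2" using gB1[OF w(1)] hx w(2) by simp
      have "\<rho> (?q (h x)) (p x) \<le> \<rho> (p z) (?q (h x)) + \<rho> (p z) (p x)"
        using R.triangle'' qY z(1) x hkD(1)[OF x] by simp
      then show ?thesis using 1 2 by linarith
    qed
    \<comment> \<open>Capping \<open>d\<close> makes every element of \<open>\<A>\<close> small for \<open>d1\<close> and every element of \<open>\<B>\<close>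
      small for \<open>d2\<close>; since \<open>q \<circ> h\<close> is close to \<open>p\<close>, their images are small as well. Hence nothing
      has to be matched at the start, while the summand in \<open>\<rho>\<close> keeps control of the distance to \<open>f\<close>.\<close>
    define d1 where "d1 x y = min (e / 2) (d x y) + \<rho> (p x) (p y)" for x y
    define d2 where "d2 x y = min (e / 2) (d x y) + \<rho> (?q x) (?q y)" for x y
    have d1: "complete_metric_for X d1" unfolding d1_def[abs_def]
      by (rule complete_metric_for_pullback[OF d \<rho>D(1,2) e(2) cp])
    have d2: "complete_metric_for X d2" unfolding d2_def[abs_def]
      by (rule complete_metric_for_pullback[OF d \<rho>D(1,2) e(2) cq])
    have elt: "\<exists>x\<in>topspace X. x \<in> D" if D: "decomposition X \<D>" "D \<in> \<D>" for D \<D>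
      using D unfolding decomposition_def by fastforce
    have pm: "partial_matching X \<A> \<B> d1 d2 h k {} e (6 * e) e (20 * e)"
      unfolding partial_matching_def
    proof (intro conjI ballI)
      show "homeomorphic_maps X X h k" by (rule hk)
      fix D assume "D \<in> \<A> - {}"
      then have D: "D \<in> \<A>" by simp
      note DX = decomposition_subset[OF AD(1) D]
      obtain x where x: "x \<in> topspace X" "x \<in> D" using elt[OF AD(1) D] by blast
      show "small X d1 e D" unfolding small_def
      proof (intro bexI[OF _ x(1)] ballI conjI)
        fix y assume y: "y \<in> D"
        then show "y \<in> topspace X" using DX by blast
        have "\<rho> (p x) (p y) = 0" using pA[OF D x(2) y] qY(2)[OF x(1)] by simp
        then show "d1 x y < e" using e by (simp add: d1_def min_def)
      qed
      show "small X d2 (6 * e) (h ` D)" unfolding small_def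
      proof (intro bexI[OF _ hkD(1)[OF x(1)]] ballI)
        fix z assume "z \<in> h ` D"
        then obtain y where y: "y \<in> D" "z = h y" by blast
        then have yX: "y \<in> topspace X" using DX by blast
        have "\<rho> (?q (h x)) (?q (h y)) \<le> \<rho> (?q (h x)) (p x) + \<rho> (?q (h y)) (p x)"
          using R.triangle' qY hkD(1) x(1) yX by simp
        moreover have "p y = p x" using pA[OF D y(1) x(2)] .
        ultimately have "\<rho> (?q (h x)) (?q (h y)) < 2 * e" using near[OF x(1)] near[OF yX] by simp
        moreover have "min (e / 2) (d (h x) (h y)) \<le> e / 2" by simp
        ultimately have "d2 (h x) (h y) < 6 * e" using e unfolding d2_def by linarith
        then show "z \<in> topspace X \<and> d2 (h x) z < 6 * e" using y hkD(1)[OF yX] by simp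
      qed
    next
      fix E assume "E \<in> \<B> - (`) h ` {}"
      then have E: "E \<in> \<B>" by simp
      note EX = decomposition_subset[OF BD(1) E]
      obtain x where x: "x \<in> topspace X" "x \<in> E" using elt[OF BD(1) E] by blast
      show "small X d2 e E" unfolding small_def
      proof (intro bexI[OF _ x(1)] ballI conjI)
        fix y assume y: "y \<in> E"
        then show "y \<in> topspace X" using EX by blast
        have "\<rho> (?q x) (?q y) = 0" using qB[OF E x(2) y] qY(1)[OF x(1)] by simp
        then show "d2 x y < e" using e by (simp add: d2_def min_def)
      qed
      show "small X d1 (20 * e) (k ` E)" unfolding small_def
      proof (intro bexI[OF _ hkD(2)[OF x(1)]] ballI)
        fix z assume "z \<in> k ` E"
        then obtain y where y: "y \<in> E" "z = k y" by blast
        then have yX: "y \<in> topspace X" using EX by blast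
        have nk: "\<rho> (?q u) (p (k u)) < e" if "u \<in> topspace X" for u
          using near[OF hkD(2)[OF that]] hkD(4)[OF that] by simp
        have "\<rho> (p (k x)) (p (k y)) \<le> \<rho> (?q x) (p (k x)) + \<rho> (?q x) (p (k y))"
          using R.triangle'' qY hkD(2) x(1) yX by simp
        moreover have "?q y = ?q x" using qB[OF E y(1) x(2)] .
        ultimately have "\<rho> (p (k x)) (p (k y)) < 2 * e" using nk[OF x(1)] nk[OF yX] by simp
        moreover have "min (e / 2) (d (k x) (k y)) \<le> e / 2" by simp
        ultimately have "d1 (k x) (k y) < 20 * e" using e unfolding d1_def by linarith
        then show "z \<in> topspace X \<and> d1 (k x) z < 20 * e" using y hkD(2)[OF yX] by simp
      qed
    qed simp_all
    show ?thesis
    proof (rule back_and_forth[OF d1 d2 K A dnA B dnB e(1) pm])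
      fix H L assume HL: "homeomorphic_maps X X H L"
        and mv: "\<And>x. x \<in> topspace X \<Longrightarrow> d2 (h x) (H x) \<le> 120 * e"
        and HA: "\<And>D. D \<in> \<A> \<Longrightarrow> H ` D \<in> \<B>" and LB: "\<And>E. E \<in> \<B> \<Longrightarrow> L ` E \<in> \<A>"
      \<comment> \<open>Restricted to \<open>\<A>\<close>, since members of \<open>homeos\<close>
        are normalised off the domain.\<close>
      define \<phi> where "\<phi> = restrict ((`) H) \<A>"
      have cH: "continuous_map X X H" and cL: "continuous_map X X L"
        using HL by (simp_all add: homeomorphic_maps_def)
      note HD = homeomorphic_mapsD[OF HL]
      have "homeomorphic_maps ?Z ?Y ((`) H) ((`) L)"
        unfolding homeomorphic_maps_def
      proof (intro conjI ballI)
        show "continuous_map ?Z ?Y ((`) H)" by (rule continuous_map_decomp_image(1)[OF AD(1) BD(1) cH HA])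
        show "continuous_map ?Y ?Z ((`) L)" by (rule continuous_map_decomp_image(1)[OF BD(1) AD(1) cL LB])
        show "L ` H ` D = D" if "D \<in> topspace ?Z" for D
          using homeomorphic_maps_image_image[OF HL] decomposition_subset[OF AD(1)] that tsZ by simp
        show "H ` L ` D = D" if "D \<in> topspace ?Y" for D
          using homeomorphic_maps_image_image[OF homeomorphic_maps_sym'[OF HL]]
            decomposition_subset[OF BD(1)] that tsY by simp
      qed
      then have "homeomorphic_map ?Z ?Y ((`) H)" by (rule homeomorphic_maps_imp_map)
      then have hom: "homeomorphic_map ?Z ?Y \<phi>"
        by (rule homeomorphic_map_eq) (simp add: \<phi>_def tsZ)
      have in_h: "\<phi> \<in> homeos ?Z ?Y" using hom by (simp add: homeos_def \<phi>_def tsZ)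
      have com: "?q (H x) = \<phi> (?qA x)" if x: "x \<in> topspace X" for x
        using continuous_map_decomp_image(2)[OF AD(1) BD(1) cH HA x] decomp_map_in(1)[OF AD(1) x]
        by (simp add: \<phi>_def)
      have lift: "liftable X \<A> \<B> \<phi>" unfolding liftable_def
        using hom homeomorphic_maps_imp_map[OF HL] com by blast
      have "maps_close_on (topspace ?Z) f \<phi> \<U>" unfolding maps_close_on_def
      proof (intro ballI impI)
        fix D assume "D \<in> topspace ?Z"
        then have D: "D \<in> \<A>" using tsZ by simp
        obtain x where x: "x \<in> topspace X" "x \<in> D" using elt[OF AD(1) D] by blast
        have qx: "?qA x = D" using decomp_map_eq[OF AD(1) D x(2)] .
        have "\<rho> (?q (h x)) (?q (H x)) \<le> 120 * e"
        proof -
          interpret M: Metric_space "topspace X" d using complete_metric_forD[OF d] by simp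
          have "0 \<le> min (e / 2) (d (h x) (H x))" using e by simp
          then show ?thesis using mv[OF x(1)] unfolding d2_def by linarith
        qed
        moreover have "\<rho> (p x) (?q (H x)) \<le> \<rho> (?q (h x)) (p x) + \<rho> (?q (h x)) (?q (H x))"
          using R.triangle'' qY x(1) hkD(1) HD(1) by simp
        ultimately have "\<rho> (p x) (?q (H x)) < 1" using near[OF x(1)] by (simp add: e_def)
        from \<rho>U[OF qY(2)[OF x(1)] qY(1)[OF HD(1)[OF x(1)]] this]
        obtain V where "V \<in> \<U>" "p x \<in> V" "?q (H x) \<in> V" by blast
        then show "\<exists>V\<in>\<U>. {f D, \<phi> D} \<subseteq> V" using com[OF x(1)] qx by (auto simp: p_def)
      qed
      then show ?thesis using in_h lift by blast
    qed
  qed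
qed

theorem theorem2p7:
  fixes X :: "'a topology" and \<K> \<A> \<B> :: "'a set set"
  assumes "completely_metrizable_space X"
    and "strongly_locally_homogeneous X"
    and "tame_family X \<K>"
    and "tame_decomposition X \<K> \<A>" and "dense_decomposition X \<A>"
    and "tame_decomposition X \<K> \<B>" and "dense_decomposition X \<B>"
  shows "limitation_topology (decomp_space X \<A>) (decomp_space X \<B>) closure_of
           {\<phi> \<in> homeos (decomp_space X \<A>) (decomp_space X \<B>). liftable X \<A> \<B> \<phi>}
         = homeos (decomp_space X \<A>) (decomp_space X \<B>)
    \<and> (\<forall>f \<in> homeos (decomp_space X \<A>) (decomp_space X \<B>). \<forall>\<U>.
         open_cover (decomp_space X \<B>) \<U> \<longrightarrow>
         (\<exists>\<phi> \<in> homeos (decomp_space X \<A>) (decomp_space X \<B>).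
            liftable X \<A> \<B> \<phi> \<and> maps_close_on (topspace (decomp_space X \<A>)) f \<phi> \<U>))"
proof -
  let ?Z = "decomp_space X \<A>" and ?Y = "decomp_space X \<B>"
  obtain d where d: "complete_metric_for X d" using complete_metric_for_exists[OF assms(1)] .
  have approx: "\<exists>\<phi>\<in>homeos ?Z ?Y. liftable X \<A> \<B> \<phi> \<and> maps_close_on (topspace ?Z) f \<phi> \<U>"
    if "f \<in> homeos ?Z ?Y" "open_cover ?Y \<U>" for f \<U>
    using liftable_approximation[OF d assms(3-7) that] .
  have "limitation_topology ?Z ?Y closure_of {\<phi> \<in> homeos ?Z ?Y. liftable X \<A> \<B> \<phi>} = homeos ?Z ?Y"
  proof
    show "limitation_topology ?Z ?Y closure_of {\<phi> \<in> homeos ?Z ?Y. liftable X \<A> \<B> \<phi>} \<subseteq> homeos ?Z ?Y"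
      using closure_of_subset_topspace topspace_limitation_topology by metis
    show "homeos ?Z ?Y \<subseteq> limitation_topology ?Z ?Y closure_of {\<phi> \<in> homeos ?Z ?Y. liftable X \<A> \<B> \<phi>}"
    proof
      fix f assume f: "f \<in> homeos ?Z ?Y"
      show "f \<in> limitation_topology ?Z ?Y closure_of {\<phi> \<in> homeos ?Z ?Y. liftable X \<A> \<B> \<phi>}"
        unfolding in_closure_of topspace_limitation_topology
      proof (intro conjI f allI impI)
        fix T assume T: "f \<in> T \<and> openin (limitation_topology ?Z ?Y) T"
        \<comment> \<open>By its definition the limitation topology provides, for an open
          \<open>T\<close> containing \<open>f\<close>, a cover whose neighbourhood of
          \<open>f\<close> lies in \<open>T\<close>; so approximation along all covers gives
          density.\<close>
        then obtain \<U> where U: "open_cover ?Y \<U>" "limitation_nbhd ?Z ?Y f \<U> \<subseteq> T"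
          unfolding openin_limitation_topology by blast
        obtain \<phi> where \<phi>: "\<phi> \<in> homeos ?Z ?Y" "liftable X \<A> \<B> \<phi>" "maps_close_on (topspace ?Z) f \<phi> \<U>"
          using approx[OF f U(1)] by blast
        then have "\<phi> \<in> T" using U(2) by (auto simp: limitation_nbhd_def)
        then show "\<exists>y. y \<in> {\<phi> \<in> homeos ?Z ?Y. liftable X \<A> \<B> \<phi>} \<and> y \<in> T" using \<phi> by blast
      qed
    qed
  qed
  then show ?thesis using approx by blast
qed

end
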